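(* Let $X$ be a continuum. If $f:Y\to X=Y/G$ is a generalized regular covering map with $Y$ a continuum, then there is a unique (mod $\pi_P(X)$) homeomorphism $h:\widehat{X}\to\widehat{Y}$ such that $\widehat{\phi}_X=f\circ\widehat{\phi}_Y\circ h$, where $\widehat{\phi}_X:\widehat{X}\to X$ and $\widehat{\phi}_Y:\widehat{Y}\to Y$ are the compact universal covering maps of $X$ and $Y$, respectively.
   Context: "Unique (mod $\pi_P(X)$)" means that the set of all such homeomorphisms is $\{h\circ g:g\in\pi_P(X)\}$. A continuum is a compact, connected, metrizable space. A regular covering map $f:Y\to X=Y/G$ between topological spaces is a covering map that is also the quotient map of a free action of a group $G$ of homeomorphisms of $Y$. A cover of $X$ by a continuum is a regular covering map $f:Y\to X$ with $Y$ a continuum. Uniform spaces: a uniform space is a topological space with a compatible uniformity, whose entourages are taken to be symmetric; a compact space carries its unique compatible uniformity. For a map $g$ and $E\subset Y\times Y$, $g(E)$ means $(g\times g)(E)$. A group $G$ of bijections of a uniform space $Y$ acts isomorphically if $Y$ has a basis of entourages $E$ with $g(E)=E$ for all $g\in G$; $Y/G$ then has the quotient uniformity, consisting of the images of entourages. For an entourage $E$ let $U_E(G)=\{g\in G:(y,g(y))\in E\ \forall y\in Y\}$, $S_E(G)=\{g\in G:(y,g(y))\in E\text{ for some }y\in Y\}$, and $N_E(G)$ the subgroup generated by $S_E(G)$. $G$ acts prodiscretely if for every entourage $E$ there is an entourage $F$ with $N_F(G)\subset U_E(G)$. $G$ has the topology (and uniformity) of uniform convergence, for which the $U_E(G)$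 form a basis at the identity. A generalized regular covering map $f:Y\to X=Y/G$ with deck group $G$ is the quotient map of an isomorphic and prodiscrete action of a complete group $G$ on $Y$ (with $X$ identified with $Y/G$). Compact universal cover of a continuum $X$: two covers $f_1:Y_1\to X=Y_1/G_1$, $f_2:Y_2\to X=Y_2/G_2$ are equivalent if there are a homeomorphism $h:Y_1\to Y_2$ and an isomorphism $\theta:G_1\to G_2$ with $f_2\circ h=f_1$ and $h\circ g=\theta(g)\circ h$ for all $g\in G_1$. Let $\{f_i:X_i\to X=X_i/G_i\}$ be the family of all covers of $X$ by continua, one from each equivalence class, with basepoints $*$ in $X$ and the $X_i$ such that $f_i( * )=*$. Write $f_i\leq f_j$ if there is a continuous surjection $f_{ij}:X_j\to X_i$ with $f_j=f_i\circ f_{ij}$; this is a directed order, the basepoint preserving $f_{ij}$ is unique, and there are homomorphisms $\theta_{ij}:G_j\to G_i$ with $\theta_{ij}(g)\circ f_{ij}=f_{ij}\circ g$. Put $\widehat{X}=\varprojlim X_i$ and $\pi_P(X)=\varprojlim G_i$, acting coordinatewise on $\widehat{X}$; the compact universal covering map $\widehat{\phi}_X:\widehat{X}\to X=\widehat{X}/\pi_P(X)$ is the projection, a generalized regular covering map. *)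

theory Defs
  imports "HOL-Analysis.Analysis" "HOL-Algebra.Bij" "HOL-Algebra.Generated_Groups"
begin

section \<open>Continua and regular covering maps\<close>

(* Nonemptiness is not part of this definition; wherever it matters it comes from a basepoint. *)
definition continuum :: "'a topology \<Rightarrow> bool" where
  "continuum X \<longleftrightarrow> compact_space X \<and> connected_space X \<and> metrizable_space X"

definition covering_map :: "'b topology \<Rightarrow> 'a topology \<Rightarrow> ('b \<Rightarrow> 'a) \<Rightarrow> bool" where
  "covering_map Y X f \<longleftrightarrow>
     continuous_map Y X f \<and> f ` topspace Y = topspace X \<and>
     (\<forall>x\<in>topspace X. \<exists>T. openin X T \<and> x \<in> T \<and>
        (\<exists>\<V>. \<Union>\<V> = {y \<in> topspace Y. f y \<in> T} \<and>
             (\<forall>V\<in>\<V>. openin Y V) \<and> pairwise disjnt \<V> \<and>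
             (\<forall>V\<in>\<V>. homeomorphic_map (subtopology Y V) (subtopology X T) f)))"

(* Groups of bijections of S are subgroups of BijGroup S, so their elements are
   extensional functions on S and the multiplication is "compose S". *)

definition orbit_map :: "'b set \<Rightarrow> ('b \<Rightarrow> 'b) set \<Rightarrow> ('b \<Rightarrow> 'a) \<Rightarrow> 'a set \<Rightarrow> bool" where
  "orbit_map S G f T \<longleftrightarrow>
     f ` S = T \<and> (\<forall>y\<in>S. \<forall>y'\<in>S. f y = f y' \<longleftrightarrow> (\<exists>g\<in>G. y' = g y))"

definition regular_covering_map ::
  "'b topology \<Rightarrow> ('b \<Rightarrow> 'b) set \<Rightarrow> ('b \<Rightarrow> 'a) \<Rightarrow> 'a topology \<Rightarrow> bool" where
  "regular_covering_map Y G f X \<longleftrightarrow>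
     covering_map Y X f \<and>
     subgroup G (BijGroup (topspace Y)) \<and>
     (\<forall>g\<in>G. homeomorphic_map Y Y g) \<and>
     (\<forall>g\<in>G. \<forall>y\<in>topspace Y. g y = y \<longrightarrow> g = \<one>\<^bsub>BijGroup (topspace Y)\<^esub>) \<and>
     quotient_map Y X f \<and>
     orbit_map (topspace Y) G f (topspace X)"

datatype ('b, 'a) covering =
  Covering (cov_space: "'b topology") (cov_map: "'b \<Rightarrow> 'a") (cov_group: "('b \<Rightarrow> 'b) set")

abbreviation cov_points :: "('b, 'a) covering \<Rightarrow> 'b set" where
  "cov_points c \<equiv> topspace (cov_space c)"

definition continuum_cover :: "'a topology \<Rightarrow> ('b, 'a) covering \<Rightarrow> bool" where
  "continuum_cover X c \<longleftrightarrow>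
     continuum (cov_space c) \<and>
     regular_covering_map (cov_space c) (cov_group c) (cov_map c) X"

definition covering_equiv :: "('b, 'a) covering \<Rightarrow> ('c, 'a) covering \<Rightarrow> bool" where
  "covering_equiv c d \<longleftrightarrow>
     (\<exists>h \<theta>. homeomorphic_map (cov_space c) (cov_space d) h \<and>
        \<theta> \<in> iso (BijGroup (cov_points c)\<lparr>carrier := cov_group c\<rparr>)
                (BijGroup (cov_points d)\<lparr>carrier := cov_group d\<rparr>) \<and>
        (\<forall>y\<in>cov_points c. cov_map d (h y) = cov_map c y) \<and>
        (\<forall>g\<in>cov_group c. \<forall>y\<in>cov_points c. h (g y) = \<theta> g (h y)))"

definition covering_le :: "('b, 'a) covering \<Rightarrow> ('c, 'a) covering \<Rightarrow> bool" where
  "covering_le c d \<longleftrightarrow>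
     (\<exists>k. continuous_map (cov_space d) (cov_space c) k \<and>
        k ` cov_points d = cov_points c \<and>
        (\<forall>y\<in>cov_points d. cov_map d y = cov_map c (k y)))"

section \<open>Uniform spaces and generalized regular covering maps\<close>

(* \<E> is the set of all symmetric entourages of a uniformity inducing the topology of X. *)
definition uniformity_of :: "'a topology \<Rightarrow> ('a \<times> 'a) set set \<Rightarrow> bool" where
  "uniformity_of X \<E> \<longleftrightarrow>
     \<E> \<noteq> {} \<and>
     (\<forall>E\<in>\<E>. E \<subseteq> topspace X \<times> topspace X \<and> Id_on (topspace X) \<subseteq> E \<and> sym E) \<and>
     (\<forall>E\<in>\<E>. \<forall>F. E \<subseteq> F \<and> F \<subseteq> topspace X \<times> topspace X \<and> sym F \<longrightarrow> F \<in> \<E>) \<and>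
     (\<forall>E\<in>\<E>. \<forall>F\<in>\<E>. E \<inter> F \<in> \<E>) \<and>
     (\<forall>E\<in>\<E>. \<exists>F\<in>\<E>. F O F \<subseteq> E) \<and>
     (\<forall>U. openin X U \<longleftrightarrow> U \<subseteq> topspace X \<and> (\<forall>x\<in>U. \<exists>E\<in>\<E>. E `` {x} \<subseteq> U))"

definition acts_isomorphically :: "('b \<times> 'b) set set \<Rightarrow> ('b \<Rightarrow> 'b) set \<Rightarrow> bool" where
  "acts_isomorphically \<E> G \<longleftrightarrow>
     (\<forall>E\<in>\<E>. \<exists>F\<in>\<E>. F \<subseteq> E \<and> (\<forall>g\<in>G. map_prod g g ` F = F))"

definition U_ent :: "'b set \<Rightarrow> ('b \<Rightarrow> 'b) set \<Rightarrow> ('b \<times> 'b) set \<Rightarrow> ('b \<Rightarrow> 'b) set" where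
  "U_ent S G E = {g \<in> G. \<forall>y\<in>S. (y, g y) \<in> E}"

definition S_ent :: "'b set \<Rightarrow> ('b \<Rightarrow> 'b) set \<Rightarrow> ('b \<times> 'b) set \<Rightarrow> ('b \<Rightarrow> 'b) set" where
  "S_ent S G E = {g \<in> G. \<exists>y\<in>S. (y, g y) \<in> E}"

definition N_ent :: "'b set \<Rightarrow> ('b \<Rightarrow> 'b) set \<Rightarrow> ('b \<times> 'b) set \<Rightarrow> ('b \<Rightarrow> 'b) set" where
  "N_ent S G E = generate (BijGroup S) (S_ent S G E)"

definition acts_prodiscretely ::
  "'b set \<Rightarrow> ('b \<times> 'b) set set \<Rightarrow> ('b \<Rightarrow> 'b) set \<Rightarrow> bool" where
  "acts_prodiscretely S \<E> G \<longleftrightarrow> (\<forall>E\<in>\<E>. \<exists>F\<in>\<E>. N_ent S G F \<subseteq> U_ent S G E)"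

(* Completeness for the uniformity of uniform convergence, with basic entourages
   {(g, h). \<forall>y\<in>S. (g y, h y) \<in> E}: every Cauchy filter on G converges in G. *)
definition complete_unif_conv ::
  "'b set \<Rightarrow> ('b \<times> 'b) set set \<Rightarrow> ('b \<Rightarrow> 'b) set \<Rightarrow> bool" where
  "complete_unif_conv S \<E> G \<longleftrightarrow>
     (\<forall>F \<le> principal G. F \<noteq> bot \<longrightarrow>
        (\<forall>E\<in>\<E>. eventually (\<lambda>(g, h). \<forall>y\<in>S. (g y, h y) \<in> E) (F \<times>\<^sub>F F)) \<longrightarrow>
        (\<exists>g\<in>G. \<forall>E\<in>\<E>. eventually (\<lambda>h. \<forall>y\<in>S. (g y, h y) \<in> E) F))"

(* The last conjunct says that X carries the quotient uniformity of Y/G. *)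
definition generalized_regular_covering_map ::
  "'b topology \<Rightarrow> ('b \<times> 'b) set set \<Rightarrow> ('b \<Rightarrow> 'b) set \<Rightarrow> ('b \<Rightarrow> 'a) \<Rightarrow>
   'a topology \<Rightarrow> ('a \<times> 'a) set set \<Rightarrow> bool" where
  "generalized_regular_covering_map Y \<E> G f X \<F> \<longleftrightarrow>
     uniformity_of Y \<E> \<and> uniformity_of X \<F> \<and>
     subgroup G (BijGroup (topspace Y)) \<and>
     acts_isomorphically \<E> G \<and>
     acts_prodiscretely (topspace Y) \<E> G \<and>
     complete_unif_conv (topspace Y) \<E> G \<and>
     orbit_map (topspace Y) G f (topspace X) \<and>
     \<F> = {map_prod f f ` E | E. E \<in> \<E>}"

section \<open>The compact universal cover\<close>

(* I is a set of representatives of the equivalence classes of covers of X by continua,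
   and b chooses basepoints.  Representatives are taken among topologies on sets of reals;
   every cover by a continuum, over any type, is equivalent to one of these:
   see continuum_cover_representative below. *)
definition pointed_cover_system ::
  "'a topology \<Rightarrow> 'a \<Rightarrow> (real, 'a) covering set \<Rightarrow> ((real, 'a) covering \<Rightarrow> real) \<Rightarrow> bool" where
  "pointed_cover_system X x I b \<longleftrightarrow>
     x \<in> topspace X \<and>
     (\<forall>i\<in>I. continuum_cover X i) \<and>
     (\<forall>c :: (real, 'a) covering. continuum_cover X c \<longrightarrow> (\<exists>!i. i \<in> I \<and> covering_equiv c i)) \<and>
     (\<forall>i\<in>I. b i \<in> cov_points i \<and> cov_map i (b i) = x)"

(* The basepoint preserving map X_j -> X_i for i \<le> j, as an extensional function. *)
definition bonding_map ::
  "((real, 'a) covering \<Rightarrow> real) \<Rightarrow> (real, 'a) covering \<Rightarrow> (real, 'a) covering \<Rightarrow> real \<Rightarrow> real" where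
  "bonding_map b i j =
     (THE k. k \<in> extensional (cov_points j) \<and>
        continuous_map (cov_space j) (cov_space i) k \<and>
        k ` cov_points j = cov_points i \<and>
        (\<forall>y\<in>cov_points j. cov_map j y = cov_map i (k y)) \<and>
        k (b j) = b i)"

definition bonding_hom ::
  "((real, 'a) covering \<Rightarrow> real) \<Rightarrow> (real, 'a) covering \<Rightarrow> (real, 'a) covering \<Rightarrow>
   (real \<Rightarrow> real) \<Rightarrow> (real \<Rightarrow> real)" where
  "bonding_hom b i j g =
     (THE g'. g' \<in> cov_group i \<and>
        (\<forall>y\<in>cov_points j. g' (bonding_map b i j y) = bonding_map b i j (g y)))"

definition compact_universal_cover ::
  "(real, 'a) covering set \<Rightarrow> ((real, 'a) covering \<Rightarrow> real) \<Rightarrow>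
   ((real, 'a) covering \<Rightarrow> real) topology" where
  "compact_universal_cover I b =
     subtopology (product_topology cov_space I)
       {p \<in> \<Pi>\<^sub>E i\<in>I. cov_points i.
          \<forall>i\<in>I. \<forall>j\<in>I. covering_le i j \<longrightarrow> bonding_map b i j (p j) = p i}"

definition profinite_group ::
  "(real, 'a) covering set \<Rightarrow> ((real, 'a) covering \<Rightarrow> real) \<Rightarrow>
   ((real, 'a) covering \<Rightarrow> (real \<Rightarrow> real)) set" where
  "profinite_group I b =
     {\<gamma> \<in> \<Pi>\<^sub>E i\<in>I. cov_group i.
        \<forall>i\<in>I. \<forall>j\<in>I. covering_le i j \<longrightarrow> bonding_hom b i j (\<gamma> j) = \<gamma> i}"

definition coordinatewise ::
  "(real, 'a) covering set \<Rightarrow> ((real, 'a) covering \<Rightarrow> (real \<Rightarrow> real)) \<Rightarrow>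
   ((real, 'a) covering \<Rightarrow> real) \<Rightarrow> ((real, 'a) covering \<Rightarrow> real)" where
  "coordinatewise I \<gamma> p = (\<lambda>i\<in>I. \<gamma> i (p i))"

definition compact_universal_covering_map ::
  "(real, 'a) covering set \<Rightarrow> ((real, 'a) covering \<Rightarrow> real) \<Rightarrow> 'a" where
  "compact_universal_covering_map I p = (THE x. \<forall>i\<in>I. cov_map i (p i) = x)"

(* Homeomorphisms are counted as extensional functions on the points of A. *)
definition homeomorphisms_over ::
  "'p topology \<Rightarrow> ('p \<Rightarrow> 'a) \<Rightarrow> 'q topology \<Rightarrow> ('q \<Rightarrow> 'a) \<Rightarrow> ('p \<Rightarrow> 'q) set" where
  "homeomorphisms_over A \<alpha> B \<beta> =
     {h \<in> extensional (topspace A). homeomorphic_map A B h \<and> (\<forall>p\<in>topspace A. \<alpha> p = \<beta> (h p))}"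

section \<open>Every cover by a continuum is equivalent to one over a set of reals\<close>

lemma compact_metrizable_lepoll_real:
  assumes "compact_space Y" "metrizable_space Y"
  shows "topspace Y \<lesssim> (UNIV :: real set)"
proof -
  obtain M d where "Metric_space M d" and Y: "Y = Metric_space.mtopology M d"
    using assms(2) unfolding metrizable_space_def by blast
  interpret Metric_space M d by fact
  have "mtotally_bounded M"
    using assms(1) compactin_imp_mtotally_bounded[of M] by (simp add: Y compact_space_def)
  then have "\<exists>K. finite K \<and> K \<subseteq> M \<and> M \<subseteq> (\<Union>x\<in>K. mball x (1 / Suc n))" for n
    unfolding mtotally_bounded_def by simp
  then obtain K where K: "\<And>n. finite (K n)" "\<And>n. K n \<subseteq> M"
      "\<And>n. M \<subseteq> (\<Union>x\<in>K n. mball x (1 / Suc n))" by metis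
  define C where "C = (\<Union>n. K n) \<times> (UNIV :: nat set)"
  have "countable C"
    unfolding C_def using K(1) by (intro countable_SIGMA countable_UN) (auto simp: countable_finite)
  define e where "e = (\<lambda>y. to_nat_on C ` {(c, n). (c, n) \<in> C \<and> y \<in> mball c (1 / Suc n)})"
  have "inj_on e M"
  proof (rule inj_onI, rule ccontr)
    fix y z assume yz: "y \<in> M" "z \<in> M" "e y = e z" "y \<noteq> z"
    then have pos: "d y z > 0" by simp
    then obtain n where n: "1 / Suc n < d y z / 2"
      using nat_approx_posE[of "d y z / 2"] by auto
    obtain c where c: "c \<in> K n" "y \<in> mball c (1 / Suc n)" using K(3)[of n] yz(1) by blast
    have "inj_on (to_nat_on C) C" using \<open>countable C\<close> by (rule inj_on_to_nat_on)
    then have "{(c, n). (c, n) \<in> C \<and> y \<in> mball c (1 / Suc n)} =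
               {(c, n). (c, n) \<in> C \<and> z \<in> mball c (1 / Suc n)}"
      using yz(3) unfolding e_def by (subst (asm) inj_on_image_eq_iff[of _ C]) auto
    moreover have "(c, n) \<in> {(c, n). (c, n) \<in> C \<and> y \<in> mball c (1 / Suc n)}"
      using c C_def by auto
    ultimately have "z \<in> mball c (1 / Suc n)" by blast
    with c n show False
      using triangle[of y c z] commute[of c y] by (auto simp: in_mball)
  qed
  then have "M \<lesssim> (UNIV :: nat set set)" by (auto simp: lepoll_def)
  then have "M \<lesssim> (UNIV :: real set)"
    using lepoll_trans1 nat_sets_eqpoll_reals lepoll_trans2 by blast
  then show ?thesis by (simp add: Y)
qed

lemma homeomorphic_map_pullback:
  assumes "inj_on e (topspace Y)"
  shows "homeomorphic_map Y (pullback_topology (e ` topspace Y) (inv_into (topspace Y) e) Y) e"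
    (is "homeomorphic_map Y ?Z e")
proof -
  let ?e' = "inv_into (topspace Y) e"
  have "continuous_map ?Z Y (id \<circ> ?e')" by (rule continuous_map_pullback) simp
  moreover have "continuous_map Y ?Z e"
  proof (rule continuous_map_pullback')
    show "continuous_map Y Y (?e' \<circ> e)"
      by (rule continuous_map_eq[OF continuous_map_id]) (use assms in auto)
  qed auto
  ultimately have "homeomorphic_maps Y ?Z e ?e'"
    using assms by (auto simp: homeomorphic_maps_def topspace_pullback_topology)
  then show ?thesis using homeomorphic_map_maps by blast
qed

lemma covering_equiv_sym:
  assumes "continuum_cover X c" "covering_equiv c d"
  shows "covering_equiv d c"
proof -
  let ?A = "BijGroup (cov_points c)\<lparr>carrier := cov_group c\<rparr>"
  let ?B = "BijGroup (cov_points d)\<lparr>carrier := cov_group d\<rparr>"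
  obtain h \<theta> where h: "homeomorphic_map (cov_space c) (cov_space d) h" "\<theta> \<in> iso ?A ?B"
    "\<And>y. y \<in> cov_points c \<Longrightarrow> cov_map d (h y) = cov_map c y"
    "\<And>g y. g \<in> cov_group c \<Longrightarrow> y \<in> cov_points c \<Longrightarrow> h (g y) = \<theta> g (h y)"
    using assms(2) unfolding covering_equiv_def by blast
  obtain k where k: "homeomorphic_maps (cov_space c) (cov_space d) h k"
    using h(1) homeomorphic_map_maps by blast
  have kt: "\<And>y. y \<in> cov_points d \<Longrightarrow> k y \<in> cov_points c \<and> h (k y) = y"
      "\<And>y. y \<in> cov_points c \<Longrightarrow> k (h y) = y"
    using k by (auto simp: homeomorphic_maps_def continuous_map_def Pi_iff)
  have sg: "subgroup (cov_group c) (BijGroup (cov_points c))"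
    using assms(1) by (simp add: continuum_cover_def regular_covering_map_def)
  then have "group ?A" by (rule subgroup.subgroup_is_group) (rule group_BijGroup)
  let ?\<theta> = "inv_into (carrier ?A) \<theta>"
  have i: "?\<theta> \<in> iso ?B ?A" using group.iso_set_sym[OF \<open>group ?A\<close> h(2)] .
  have b: "bij_betw \<theta> (cov_group c) (cov_group d)" using h(2) by (simp add: iso_def)
  have "k (g y) = ?\<theta> g (k y)" if g: "g \<in> cov_group d" and y: "y \<in> cov_points d" for g y
  proof -
    let ?g = "?\<theta> g"
    have g': "?g \<in> cov_group c" "\<theta> ?g = g"
      using b g by (auto simp: bij_betw_inv_into_right inv_into_into bij_betw_def)
    have "?g (k y) \<in> cov_points c"
      using g' sg kt(1)[OF y] by (auto simp: subgroup_def BijGroup_def dest: Bij_imp_funcset)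
    then show ?thesis
      using h(4)[OF g'(1), of "k y"] kt y g'(2) by metis
  qed
  moreover have "homeomorphic_map (cov_space d) (cov_space c) k"
    using k homeomorphic_maps_map homeomorphic_maps_sym by blast
  ultimately show ?thesis
    unfolding covering_equiv_def using i kt h(3) by metis
qed

lemma covering_equiv_trans:
  assumes "covering_equiv c d" "covering_equiv d e"
  shows "covering_equiv c e"
proof -
  let ?A = "BijGroup (cov_points c)\<lparr>carrier := cov_group c\<rparr>"
  let ?B = "BijGroup (cov_points d)\<lparr>carrier := cov_group d\<rparr>"
  let ?C = "BijGroup (cov_points e)\<lparr>carrier := cov_group e\<rparr>"
  obtain h \<theta> where h: "homeomorphic_map (cov_space c) (cov_space d) h" "\<theta> \<in> iso ?A ?B"
    "\<And>y. y \<in> cov_points c \<Longrightarrow> cov_map d (h y) = cov_map c y"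
    "\<And>g y. g \<in> cov_group c \<Longrightarrow> y \<in> cov_points c \<Longrightarrow> h (g y) = \<theta> g (h y)"
    using assms(1) unfolding covering_equiv_def by blast
  obtain h' \<theta>' where h': "homeomorphic_map (cov_space d) (cov_space e) h'" "\<theta>' \<in> iso ?B ?C"
    "\<And>y. y \<in> cov_points d \<Longrightarrow> cov_map e (h' y) = cov_map d y"
    "\<And>g y. g \<in> cov_group d \<Longrightarrow> y \<in> cov_points d \<Longrightarrow> h' (g y) = \<theta>' g (h' y)"
    using assms(2) unfolding covering_equiv_def by blast
  have ht: "h y \<in> cov_points d" if "y \<in> cov_points c" for y
    using h(1) that homeomorphic_imp_surjective_map by blast
  have \<theta>t: "\<theta> g \<in> cov_group d" if "g \<in> cov_group c" for g
    using h(2) that by (auto simp: iso_def bij_betw_def)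
  show ?thesis
    unfolding covering_equiv_def
  proof (intro exI conjI ballI)
    show "homeomorphic_map (cov_space c) (cov_space e) (h' \<circ> h)"
      by (rule homeomorphic_map_compose[OF h(1) h'(1)])
    show "\<theta>' \<circ> \<theta> \<in> iso ?A ?C" using iso_set_trans h(2) h'(2) .
  qed (use h h' ht \<theta>t in auto)
qed


lemma regular_covering_map_transport:
  fixes Y :: "'b topology" and Z :: "'c topology"
  assumes reg: "regular_covering_map Y G f X" and hk: "homeomorphic_maps Y Z h k"
  defines "\<kappa> \<equiv> \<lambda>g. \<lambda>z\<in>topspace Z. h (g (k z))"
  shows "regular_covering_map Z (\<kappa> ` G) (f \<circ> k) X"
    and "\<kappa> \<in> iso (BijGroup (topspace Y)\<lparr>carrier := G\<rparr>) (BijGroup (topspace Z)\<lparr>carrier := \<kappa> ` G\<rparr>)"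
    and "\<And>g y. g \<in> G \<Longrightarrow> y \<in> topspace Y \<Longrightarrow> h (g y) = \<kappa> g (h y)"
proof -
  let ?S = "topspace Y" and ?T = "topspace Z"
  have cov: "covering_map Y X f" and sg: "subgroup G (BijGroup ?S)"
    and hom: "\<And>g. g \<in> G \<Longrightarrow> homeomorphic_map Y Y g"
    and free: "\<And>g y. g \<in> G \<Longrightarrow> y \<in> ?S \<Longrightarrow> g y = y \<Longrightarrow> g = \<one>\<^bsub>BijGroup ?S\<^esub>"
    and quot: "quotient_map Y X f" and orb: "orbit_map ?S G f (topspace X)"
    using reg unfolding regular_covering_map_def by auto
  have h: "homeomorphic_map Y Z h" and k: "homeomorphic_map Z Y k"
    using hk homeomorphic_map_maps homeomorphic_maps_sym by blast+
  have hc: "h y \<in> ?T" "k (h y) = y" if "y \<in> ?S" for y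
    using hk that by (auto simp: homeomorphic_maps_def continuous_map_def Pi_iff)
  have kc: "k z \<in> ?S" "h (k z) = z" if "z \<in> ?T" for z
    using hk that by (auto simp: homeomorphic_maps_def continuous_map_def Pi_iff)
  have him: "h ` ?S = ?T" and kim: "k ` ?T = ?S" using hc kc by force+
  have GB: "G \<subseteq> Bij ?S" using subgroup.subset[OF sg] by (simp add: BijGroup_def)
  have Bt: "g y \<in> ?S" if "g \<in> Bij ?S" "y \<in> ?S" for g y
    using that Bij_imp_funcset by blast
  have bh: "bij_betw h ?S ?T" and bk: "bij_betw k ?T ?S"
    using hc kc by (auto intro!: bij_betwI[where g=k] bij_betwI[where g=h])
  have \<kappa>B: "\<kappa> g \<in> Bij ?T" if "g \<in> Bij ?S" for g
  proof -
    have "bij_betw g ?S ?S" using that by (simp add: Bij_def)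
    then have "bij_betw (h \<circ> (g \<circ> k)) ?T ?T"
      by (intro bij_betw_trans[OF bij_betw_trans[OF bk] bh])
    then have "bij_betw (\<kappa> g) ?T ?T"
      by (rule bij_betw_cong[THEN iffD1, rotated]) (simp add: \<kappa>_def)
    then show ?thesis by (simp add: Bij_def \<kappa>_def)
  qed
  have \<kappa>hom: "\<kappa> \<in> Group.hom (BijGroup ?S) (BijGroup ?T)"
  proof (rule homI)
    fix g g' assume "g \<in> carrier (BijGroup ?S)" "g' \<in> carrier (BijGroup ?S)"
    then have g: "g \<in> Bij ?S" "g' \<in> Bij ?S" by (simp_all add: BijGroup_def)
    have "\<kappa> (compose ?S g g') = compose ?T (\<kappa> g) (\<kappa> g')"
    proof (rule extensionalityI[of _ ?T])
      fix z assume z: "z \<in> ?T"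
      have "g' (k z) \<in> ?S" using Bt[OF g(2) kc(1)[OF z]] .
      then show "\<kappa> (compose ?S g g') z = compose ?T (\<kappa> g) (\<kappa> g') z"
        using z kc(1)[OF z] hc by (simp add: \<kappa>_def compose_def)
    qed (simp_all add: \<kappa>_def)
    then show "\<kappa> (g \<otimes>\<^bsub>BijGroup ?S\<^esub> g') = \<kappa> g \<otimes>\<^bsub>BijGroup ?T\<^esub> \<kappa> g'"
      using g \<kappa>B by (simp add: BijGroup_def)
  qed (use \<kappa>B in \<open>auto simp: BijGroup_def\<close>)
  then interpret \<kappa>: group_hom "BijGroup ?S" "BijGroup ?T" \<kappa>
    by (intro group_hom.intro group_BijGroup group_hom_axioms.intro)
  have sg': "subgroup (\<kappa> ` G) (BijGroup ?T)" using \<kappa>.subgroup_img_is_subgroup[OF sg] .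
  have \<kappa>inj: "inj_on \<kappa> (Bij ?S)"
  proof (rule inj_onI)
    fix g g' assume g: "g \<in> Bij ?S" "g' \<in> Bij ?S" "\<kappa> g = \<kappa> g'"
    have "g y = g' y" if "y \<in> ?S" for y
    proof -
      have "\<kappa> g (h y) = \<kappa> g' (h y)" using g(3) by simp
      then have "h (g y) = h (g' y)" using that hc by (simp add: \<kappa>_def)
      then show ?thesis using that g(1,2) Bt hc(2) by metis
    qed
    then show "g = g'" using g(1,2) Bij_imp_extensional extensionalityI by metis
  qed
  show 1: "h (g y) = \<kappa> g (h y)" if "g \<in> G" "y \<in> ?S" for g y
    using that hc by (simp add: \<kappa>_def)
  show "\<kappa> \<in> iso (BijGroup ?S\<lparr>carrier := G\<rparr>) (BijGroup ?T\<lparr>carrier := \<kappa> ` G\<rparr>)"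
    using \<kappa>hom GB inj_on_subset[OF \<kappa>inj GB]
    by (auto simp: iso_def hom_def bij_betw_def BijGroup_def)
  show "regular_covering_map Z (\<kappa> ` G) (f \<circ> k) X"
    unfolding regular_covering_map_def
  proof (intro conjI ballI impI)
    show "subgroup (\<kappa> ` G) (BijGroup ?T)" by fact
    have qk: "quotient_map Z Y k" using k homeomorphic_map_def by blast
    show "quotient_map Z X (f \<circ> k)" using quotient_map_compose[OF qk quot] .
    show "homeomorphic_map Z Z g'" if g': "g' \<in> \<kappa> ` G" for g'
    proof -
      obtain g where g: "g \<in> G" "g' = \<kappa> g" using g' by blast
      have "homeomorphic_map Z Z (h \<circ> (g \<circ> k))"
        by (rule homeomorphic_map_compose[OF homeomorphic_map_compose[OF k hom[OF g(1)]] h])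
      then show ?thesis by (rule homeomorphic_map_eq) (simp add: g \<kappa>_def)
    qed
    show "g' = \<one>\<^bsub>BijGroup ?T\<^esub>" if g': "g' \<in> \<kappa> ` G" and z: "z \<in> ?T" "g' z = z" for g' z
    proof -
      obtain g where g: "g \<in> G" "g' = \<kappa> g" using g' by blast
      have "h (g (k z)) = z" using z g by (simp add: \<kappa>_def)
      then have "g (k z) = k z" using hc(2)[of "g (k z)"] Bt GB g(1) kc(1)[OF z(1)] by force
      then have "g = \<one>\<^bsub>BijGroup ?S\<^esub>" using free[OF g(1)] kc(1)[OF z(1)] by blast
      then show ?thesis using g(2) \<kappa>.hom_one by simp
    qed
    show "orbit_map ?T (\<kappa> ` G) (f \<circ> k) (topspace X)"
      unfolding orbit_map_def
    proof (intro conjI ballI)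
      show "(f \<circ> k) ` ?T = topspace X"
        using orb kim unfolding orbit_map_def by (metis image_comp)
      fix z z' assume z: "z \<in> ?T" "z' \<in> ?T"
      have "(f \<circ> k) z = (f \<circ> k) z' \<longleftrightarrow> (\<exists>g\<in>G. k z' = g (k z))"
        using orb kc z by (simp add: orbit_map_def)
      also have "\<dots> \<longleftrightarrow> (\<exists>g\<in>G. z' = h (g (k z)))"
      proof (rule bex_cong[OF refl])
        fix g assume "g \<in> G"
        then have "g (k z) \<in> ?S" using Bt GB kc(1)[OF z(1)] by blast
        then show "k z' = g (k z) \<longleftrightarrow> z' = h (g (k z))"
          using hc(2)[of "g (k z)"] kc(2)[OF z(2)] by auto
      qed
      finally show "(f \<circ> k) z = (f \<circ> k) z' \<longleftrightarrow> (\<exists>g\<in>\<kappa> ` G. z' = g z)"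
        using z by (simp add: \<kappa>_def)
    qed
    show "covering_map Z X (f \<circ> k)"
      unfolding covering_map_def
    proof (intro conjI ballI)
      show "continuous_map Z X (f \<circ> k)"
        using cov k continuous_map_compose[of Z Y k X f]
        by (simp add: covering_map_def homeomorphic_imp_continuous_map)
      show "(f \<circ> k) ` ?T = topspace X"
        using cov kim unfolding covering_map_def by (metis image_comp)
      fix x assume "x \<in> topspace X"
      then obtain T \<V> where T: "openin X T" "x \<in> T" and U: "\<Union>\<V> = {y \<in> ?S. f y \<in> T}"
        and op: "\<And>V. V \<in> \<V> \<Longrightarrow> openin Y V" and dis: "pairwise disjnt \<V>"
        and loc: "\<And>V. V \<in> \<V> \<Longrightarrow> homeomorphic_map (subtopology Y V) (subtopology X T) f"
        using cov unfolding covering_map_def by meson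
      have VS: "V \<subseteq> ?S" if "V \<in> \<V>" for V using U that by blast
      show "\<exists>T. openin X T \<and> x \<in> T \<and>
        (\<exists>\<V>. \<Union>\<V> = {y \<in> ?T. (f \<circ> k) y \<in> T} \<and> (\<forall>V\<in>\<V>. openin Z V) \<and> pairwise disjnt \<V> \<and>
          (\<forall>V\<in>\<V>. homeomorphic_map (subtopology Z V) (subtopology X T) (f \<circ> k)))"
      proof (intro exI[of _ T] exI[of _ "(`) h ` \<V>"] conjI ballI T)
        have "\<Union>((`) h ` \<V>) = h ` {y \<in> ?S. f y \<in> T}" using U by (simp flip: image_Union)
        also have "\<dots> = {y \<in> ?T. (f \<circ> k) y \<in> T}"
        proof (intro equalityI subsetI)
          fix z assume "z \<in> {y \<in> ?T. (f \<circ> k) y \<in> T}"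
          then have "k z \<in> {y \<in> ?S. f y \<in> T}" "z = h (k z)" using kc by auto
          then show "z \<in> h ` {y \<in> ?S. f y \<in> T}" by blast
        qed (use hc in auto)
        finally show "\<Union>((`) h ` \<V>) = {y \<in> ?T. (f \<circ> k) y \<in> T}" .
        show "pairwise disjnt ((`) h ` \<V>)"
        proof (rule pairwiseI)
          fix A B assume "A \<in> (`) h ` \<V>" "B \<in> (`) h ` \<V>" "A \<noteq> B"
          then obtain V W where VW: "V \<in> \<V>" "W \<in> \<V>" "A = h ` V" "B = h ` W" "V \<noteq> W" by blast
          then have "disjnt V W" using dis by (simp add: pairwise_def)
          then show "disjnt A B"
            using VW(3,4) VS[OF VW(1)] VS[OF VW(2)] inj_on_image_Int[of h ?S V W] bh
            by (auto simp: disjnt_def bij_betw_def)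
        qed
        fix A assume "A \<in> (`) h ` \<V>"
        then obtain V where V: "V \<in> \<V>" "A = h ` V" by blast
        show "openin Z A"
          using V op homeomorphic_map_openness[OF h] VS by metis
        have "homeomorphic_map (subtopology Z (h ` V)) (subtopology Y V) k"
        proof (rule homeomorphic_map_subtopologies[OF k])
          show "k ` (?T \<inter> h ` V) = ?S \<inter> V"
          proof (intro equalityI subsetI)
            fix y assume "y \<in> ?S \<inter> V"
            then have "h y \<in> ?T \<inter> h ` V" "y = k (h y)" using hc by auto
            then show "y \<in> k ` (?T \<inter> h ` V)" by blast
          qed (use VS[OF V(1)] hc in auto)
        qed
        then show "homeomorphic_map (subtopology Z A) (subtopology X T) (f \<circ> k)"
          unfolding V(2) by (rule homeomorphic_map_compose[OF _ loc[OF V(1)]])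
      qed
    qed
  qed
qed

lemma continuum_cover_real:
  fixes c :: "('b, 'a) covering"
  assumes "continuum_cover X c"
  obtains d :: "(real, 'a) covering" where "continuum_cover X d" "covering_equiv c d"
proof -
  have cont: "continuum (cov_space c)"
    and reg: "regular_covering_map (cov_space c) (cov_group c) (cov_map c) X"
    using assms by (auto simp: continuum_cover_def)
  then obtain e :: "'b \<Rightarrow> real" where e: "inj_on e (cov_points c)"
    using compact_metrizable_lepoll_real[of "cov_space c"] by (auto simp: continuum_def lepoll_def)
  define Z where "Z = pullback_topology (e ` cov_points c) (inv_into (cov_points c) e) (cov_space c)"
  have hom: "homeomorphic_map (cov_space c) Z e"
    unfolding Z_def using homeomorphic_map_pullback[OF e] .
  then obtain k where k: "homeomorphic_maps (cov_space c) Z e k"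
    using homeomorphic_map_maps by blast
  define \<kappa> where "\<kappa> = (\<lambda>g. \<lambda>z\<in>topspace Z. e (g (k z)))"
  define d where "d = Covering Z (cov_map c \<circ> k) (\<kappa> ` cov_group c)"
  note tr = regular_covering_map_transport[OF reg k, folded \<kappa>_def]
  have "cov_space c homeomorphic_space Z"
    using hom homeomorphic_map_imp_homeomorphic_space by blast
  then have "continuum Z"
    using cont homeomorphic_compact_space homeomorphic_connected_space homeomorphic_metrizable_space
    unfolding continuum_def by blast
  then have "continuum_cover X d" using tr(1) by (simp add: continuum_cover_def d_def)
  moreover have "covering_equiv c d"
    unfolding covering_equiv_def
  proof (intro exI conjI ballI)
    show "homeomorphic_map (cov_space c) (cov_space d) e" using hom by (simp add: d_def)
    show "\<kappa> \<in> iso (BijGroup (cov_points c)\<lparr>carrier := cov_group c\<rparr>)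
                   (BijGroup (cov_points d)\<lparr>carrier := cov_group d\<rparr>)"
      using tr(2) by (simp add: d_def)
    show "cov_map d (e y) = cov_map c y" if "y \<in> cov_points c" for y
      using k that by (simp add: d_def homeomorphic_maps_def)
    show "e (g y) = \<kappa> g (e y)" if "g \<in> cov_group c" "y \<in> cov_points c" for g y
      using tr(3)[OF that] by (simp add: \<kappa>_def)
  qed
  ultimately show thesis using that by blast
qed

theorem continuum_cover_representative:
  fixes c :: "('b, 'a) covering"
  assumes sys: "pointed_cover_system X x I b" and c: "continuum_cover X c"
  shows "\<exists>!i. i \<in> I \<and> covering_equiv c i"
proof -
  obtain d :: "(real, 'a) covering" where d: "continuum_cover X d" "covering_equiv c d"
    by (rule continuum_cover_real[OF c])
  have "covering_equiv c i \<longleftrightarrow> covering_equiv d i" if "i \<in> I" for i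
    using d c covering_equiv_sym covering_equiv_trans by metis
  moreover have "\<exists>!i. i \<in> I \<and> covering_equiv d i"
    using sys d(1) by (simp add: pointed_cover_system_def)
  ultimately show ?thesis by metis
qed

theorem pointed_cover_system_exists:
  assumes "x \<in> topspace X"
  shows "\<exists>I b. pointed_cover_system X x I b"
proof -
  define rep :: "(real, 'a) covering \<Rightarrow> (real, 'a) covering" where
    "rep c = (SOME d. continuum_cover X d \<and> covering_equiv c d)" for c
  let ?C = "{c :: (real, 'a) covering. continuum_cover X c}"
  have refl: "covering_equiv c c" if cc: "continuum_cover X c" for c :: "(real, 'a) covering"
  proof -
    obtain d :: "(real, 'a) covering" where "continuum_cover X d" "covering_equiv c d"
      by (rule continuum_cover_real[OF cc])
    then show ?thesis using covering_equiv_sym covering_equiv_trans cc by blast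
  qed
  have rep: "continuum_cover X (rep c) \<and> covering_equiv c (rep c)" if "continuum_cover X c" for c
    unfolding rep_def by (rule someI[of _ c]) (use that refl in blast)
  have eq: "rep c = rep d" if "continuum_cover X c" "continuum_cover X d" "covering_equiv c d" for c d
  proof -
    have "covering_equiv c e \<longleftrightarrow> covering_equiv d e" for e :: "(real, 'a) covering"
      using that covering_equiv_sym covering_equiv_trans by metis
    then show ?thesis by (simp add: rep_def)
  qed
  have ex: "\<exists>y. y \<in> cov_points i \<and> cov_map i y = x" if "continuum_cover X i" for i :: "(real, 'a) covering"
  proof -
    have "cov_map i ` cov_points i = topspace X"
      using that by (simp add: continuum_cover_def regular_covering_map_def orbit_map_def)
    then show ?thesis using assms by (metis imageE)
  qed
  have b: "(SOME y. y \<in> cov_points i \<and> cov_map i y = x) \<in> cov_points i \<and>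
      cov_map i (SOME y. y \<in> cov_points i \<and> cov_map i y = x) = x"
    if "continuum_cover X i" for i :: "(real, 'a) covering"
    using someI_ex[OF ex[OF that]] .
  have uniq: "\<exists>!i. i \<in> rep ` ?C \<and> covering_equiv c i" if c: "continuum_cover X c"
    for c :: "(real, 'a) covering"
  proof (rule ex1I[of _ "rep c"])
    show "rep c \<in> rep ` ?C \<and> covering_equiv c (rep c)" using c rep by blast
    fix i assume i: "i \<in> rep ` ?C \<and> covering_equiv c i"
    then obtain d where d: "continuum_cover X d" "i = rep d" by blast
    have "covering_equiv (rep d) d" using covering_equiv_sym[OF d(1)] rep[OF d(1)] by blast
    moreover have "covering_equiv c (rep d)" using i d(2) by simp
    ultimately have "covering_equiv c d" using covering_equiv_trans[of c "rep d" d] by simp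
    from eq[OF c d(1) this] show "i = rep c" using d(2) by simp
  qed
  have cc: "continuum_cover X i" if "i \<in> rep ` ?C" for i using that rep by auto
  show ?thesis
    unfolding pointed_cover_system_def
  proof (intro exI conjI ballI allI impI)
    show "x \<in> topspace X" by fact
    show "continuum_cover X i" if "i \<in> rep ` ?C" for i using cc[OF that] .
    show "\<exists>!i. i \<in> rep ` ?C \<and> covering_equiv c i" if "continuum_cover X c"
      for c :: "(real, 'a) covering" using uniq[OF that] .
    show "(SOME y. y \<in> cov_points i \<and> cov_map i y = x) \<in> cov_points i" if "i \<in> rep ` ?C" for i
      using b[OF cc[OF that]] ..
    show "cov_map i (SOME y. y \<in> cov_points i \<and> cov_map i y = x) = x" if "i \<in> rep ` ?C" for i
      using b[OF cc[OF that]] ..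
  qed
qed

end

theory Submission
  imports Defs
begin

text \<open>
As for ordinary universal covers, the homeomorphism is found by lifting each of the two covering
  maps through the other, and uniqueness of lifts shows that the two lifts are inverse to each
  other. Since the spaces need not be locally connected, the work lies in finding a class of maps to which
  the compact universal cover lifts and whose lifts are unique.

  This class is that of pro-coverings: open surjections \<open>\<phi> : Z \<rightarrow> X\<close> from a compact Hausdorff space
  such that every neighbourhood of the diagonal of \<open>Z\<close> contains an equivalence relation \<open>R\<close> that is
  clopen in the fibre product of \<open>Z\<close> with itself over \<open>X\<close>. Then \<open>Z/R \<rightarrow> X\<close> is a finite covering, and
  \<open>Z\<close> is the limit of these quotients. Two lifts to \<open>Z\<close> of a map from a connected space are
  \<open>R\<close>-related on a clopen set, for each \<open>R\<close>, so they agree if they agree at a point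
  (\<open>pro_covering_lift_unique\<close>). A cover by a continuum is a pro-covering, with equality as \<open>R\<close>. A
  generalized regular covering map is one, with the orbits of the groups \<open>N\<^sub>F(G)\<close> as classes
  (\<open>generalized_regular_covering_map_pro_covering\<close>). A cover followed by a pro-covering is one
  (\<open>pro_covering_compose\<close>). So every cover \<open>Y\<^sub>j \<rightarrow> Y\<close> gives a pro-covering \<open>Y\<^sub>j \<rightarrow> Y \<rightarrow> X\<close>.

  The compact universal cover of \<open>X\<close> lifts to every pro-covering \<open>Z\<close> of \<open>X\<close>
  (\<open>lift_to_pro_covering\<close>): the finite covering \<open>Z/R\<close> has a Galois closure, which is a cover of \<open>X\<close> by
  a continuum and is constructed from the enumerations of the fibres (\<open>Galois_closure\<close>); this gives
  lifts to all quotients \<open>Z/R\<close>, which are compatible by uniqueness. Applied to all \<open>Y\<^sub>j\<close>, this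
  yields a map from the compact universal cover of \<open>X\<close> to that of \<open>Y\<close>. In the other direction, the
  pullback of a cover \<open>X\<^sub>i \<rightarrow> X\<close> to \<open>Y\<close> is a finite covering of \<open>Y\<close>, and its Galois closure is a
  cover of \<open>Y\<close>, so the compact universal cover of \<open>Y\<close> maps to each \<open>X\<^sub>i\<close>
  (\<open>lift_to_cover_of_base\<close>). With corresponding base points the two maps are inverse to each other.

  Two homeomorphisms over \<open>X\<close> differ by a self-homeomorphism of the compact universal cover of \<open>X\<close>
  over \<open>X\<close>. In each coordinate this agrees with a deck transformation at one point, hence
  everywhere (\<open>endomorphism_coordinatewise\<close>), which is the uniqueness modulo the profinite group.
\<close>

section \<open>Directed intersections and closed graphs\<close>

lemma directed_closed_Inter_nonempty:
  assumes "compact_space X" and "A \<noteq> {}"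
    and C: "\<And>a. a \<in> A \<Longrightarrow> closedin X (C a)" "\<And>a. a \<in> A \<Longrightarrow> C a \<noteq> {}"
    and dir: "\<And>a b. a \<in> A \<Longrightarrow> b \<in> A \<Longrightarrow> \<exists>c\<in>A. C c \<subseteq> C a \<inter> C b"
  shows "(\<Inter>a\<in>A. C a) \<noteq> {}"
proof -
  have "\<exists>c\<in>A. C c \<subseteq> \<Inter>F" if "finite F" "F \<subseteq> C ` A" for F
    using that
  proof (induction F)
    case empty
    then show ?case using \<open>A \<noteq> {}\<close> by auto
  next
    case (insert K F)
    then obtain a b where "a \<in> A" "C a \<subseteq> \<Inter>F" "b \<in> A" "K = C b" by auto
    then obtain c where "c \<in> A" "C c \<subseteq> C a \<inter> C b" using dir[of a b] by blast
    then show ?case using \<open>C a \<subseteq> \<Inter>F\<close> \<open>K = C b\<close> by blast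
  qed
  then have fip: "\<Inter>F \<noteq> {}" if "finite F \<and> F \<subseteq> C ` A" for F
    using C(2) that by fastforce
  have "\<forall>K\<in>C ` A. closedin X K" using C(1) by blast
  then show ?thesis
    using assms(1)[unfolded compact_space_fip, rule_format, of "C ` A"] fip by simp
qed

text \<open>By compactness, disjoint open neighbourhoods of the two parts of a separation of the intersection
  would already cover a member of the family.\<close>

lemma directed_connected_Inter:
  assumes X: "compact_space X" "Hausdorff_space X" and "A \<noteq> {}"
    and C: "\<And>a. a \<in> A \<Longrightarrow> closedin X (C a)" "\<And>a. a \<in> A \<Longrightarrow> connectedin X (C a)"
    and dir: "\<And>a b. a \<in> A \<Longrightarrow> b \<in> A \<Longrightarrow> \<exists>c\<in>A. C c \<subseteq> C a \<inter> C b"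
  shows "connectedin X (\<Inter>a\<in>A. C a)"
proof -
  define L where "L = (\<Inter>a\<in>A. C a)"
  have L: "closedin X L" unfolding L_def using C(1) \<open>A \<noteq> {}\<close> by blast
  have LC: "L \<subseteq> C a" if "a \<in> A" for a unfolding L_def using that by blast
  have False if E: "closedin X E1" "closedin X E2" "L \<subseteq> E1 \<union> E2"
      "E1 \<inter> E2 \<inter> L = {}" "E1 \<inter> L \<noteq> {}" "E2 \<inter> L \<noteq> {}" for E1 E2
  proof -
    have "normal_space X" using X compact_Hausdorff_or_regular_imp_normal_space by blast
    moreover have "closedin X (E1 \<inter> L)" "closedin X (E2 \<inter> L)" "disjnt (E1 \<inter> L) (E2 \<inter> L)"
      using E(1,2,4) L by (auto simp: disjnt_def)
    ultimately obtain U V where UV: "openin X U" "openin X V" "E1 \<inter> L \<subseteq> U" "E2 \<inter> L \<subseteq> V" "disjnt U V"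
      unfolding normal_space_def by meson
    define D where "D = (\<lambda>a. C a - (U \<union> V))"
    have clo: "closedin X (D a)" if "a \<in> A" for a
      unfolding D_def using C(1)[OF that] UV(1,2) by (intro closedin_diff openin_Un)
    have D_dir: "\<exists>c\<in>A. D c \<subseteq> D a \<inter> D b" if "a \<in> A" "b \<in> A" for a b
      using dir[OF that] unfolding D_def by auto
    have "(\<Inter>a\<in>A. D a) \<subseteq> L - (U \<union> V)" using \<open>A \<noteq> {}\<close> unfolding D_def L_def by auto
    then have empty: "(\<Inter>a\<in>A. D a) = {}" using UV(3,4) E(3) by auto
    have "\<exists>a\<in>A. D a = {}"
    proof (rule ccontr)
      assume "\<not> (\<exists>a\<in>A. D a = {})"
      then have "(\<Inter>a\<in>A. D a) \<noteq> {}"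
        by (intro directed_closed_Inter_nonempty[OF X(1) \<open>A \<noteq> {}\<close> clo _ D_dir]) auto
      then show False using empty by simp
    qed
    then obtain a where a: "a \<in> A" "D a = {}" by blast
    have "C a \<subseteq> U \<union> V" using a(2) D_def by simp
    moreover have "U \<inter> C a \<noteq> {}" "V \<inter> C a \<noteq> {}" using LC[OF a(1)] E(5,6) UV(3,4) by auto
    moreover have "U \<inter> V \<inter> C a = {}" using UV(5) by (auto simp: disjnt_def)
    ultimately show False using C(2)[OF a(1)] UV(1,2) unfolding connectedin by metis
  qed
  then have "connectedin X L"
    using closedin_subset[OF L] unfolding connectedin_closedin by metis
  then show ?thesis by (simp add: L_def)
qed

text \<open>The preimage of a closed set is the projection of a closed part of the graph, and projections
  along a compact factor are closed.\<close>

lemma closed_graph_imp_continuous_map: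
  assumes "compact_space Z" and "f \<in> topspace X \<rightarrow> topspace Z"
    and "closedin (prod_topology X Z) {(x, f x) | x. x \<in> topspace X}"
  shows "continuous_map X Z f"
  unfolding continuous_map_closedin
proof (intro conjI allI impI)
  show "f \<in> topspace X \<rightarrow> topspace Z" by fact
  fix C assume C: "closedin Z C"
  let ?G = "{(x, f x) | x. x \<in> topspace X}"
  have "closedin (prod_topology X Z) (?G \<inter> topspace X \<times> C)"
    using assms(3) C by (intro closedin_Int) (auto simp: closedin_prod_Times_iff)
  then have "closedin X (fst ` (?G \<inter> topspace X \<times> C))"
    using closed_map_fst[OF assms(1), of X] unfolding closed_map_def by blast
  moreover have "fst ` (?G \<inter> topspace X \<times> C) = {x \<in> topspace X. f x \<in> C}" by force
  ultimately show "closedin X {x \<in> topspace X. f x \<in> C}" by simp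
qed

lemma connected_space_two_closed:
  assumes "connected_space S" "closedin S A" "closedin S B" "A \<inter> B = {}" "A \<union> B = topspace S" "A \<noteq> {}"
  shows "A = topspace S"
  using assms unfolding connected_space_closedin by blast

section \<open>Locally injective maps\<close>

text \<open>For an open surjection of compact Hausdorff spaces this amounts to being a covering with finite
  fibres, but it is checked more easily than the existence of evenly covered neighbourhoods for
  pullbacks, composites and quotients.\<close>

definition locally_injective :: "'b topology \<Rightarrow> ('b \<Rightarrow> 'a) \<Rightarrow> bool" where
  "locally_injective B \<pi> \<longleftrightarrow> (\<forall>b\<in>topspace B. \<exists>V. openin B V \<and> b \<in> V \<and> inj_on \<pi> V)"

text \<open>Near a point of its image, \<^term>\<open>k\<close> is \<^term>\<open>\<psi>\<close> followed by a local inverse of \<^term>\<open>\<pi>\<close>.\<close>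

lemma open_map_lift:
  assumes "open_map C X \<psi>" "continuous_map B X \<pi>" "locally_injective B \<pi>" "continuous_map C B k"
    and over: "\<And>c. c \<in> topspace C \<Longrightarrow> \<psi> c = \<pi> (k c)"
  shows "open_map C B k"
  unfolding open_map_def
proof (intro allI impI)
  fix V assume V: "openin C V"
  have "\<exists>T. openin B T \<and> b \<in> T \<and> T \<subseteq> k ` V" if b: "b \<in> k ` V" for b
  proof -
    obtain v where v: "v \<in> V" "b = k v" using b by blast
    have vC: "v \<in> topspace C" using V v openin_subset by blast
    then have "b \<in> topspace B" using v assms(4) by (auto simp: continuous_map_def)
    then obtain W where W: "openin B W" "b \<in> W" "inj_on \<pi> W"
      using assms(3) unfolding locally_injective_def by blast
    define V' where "V' = V \<inter> {c \<in> topspace C. k c \<in> W}"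
    have V': "openin C V'"
      unfolding V'_def using V W(1) assms(4) openin_continuous_map_preimage by blast
    then have "openin X (\<psi> ` V')" using assms(1) unfolding open_map_def by blast
    then have "openin B (W \<inter> {b \<in> topspace B. \<pi> b \<in> \<psi> ` V'})"
      using W(1) assms(2) openin_continuous_map_preimage by blast
    moreover have "b \<in> W \<inter> {b \<in> topspace B. \<pi> b \<in> \<psi> ` V'}"
    proof -
      have "v \<in> V'" using v vC W(2) unfolding V'_def by auto
      then show ?thesis using v W(2) over[OF vC] \<open>b \<in> topspace B\<close> by (metis (mono_tags, lifting) IntI imageI mem_Collect_eq)
    qed
    moreover have "W \<inter> {b \<in> topspace B. \<pi> b \<in> \<psi> ` V'} \<subseteq> k ` V"
    proof
      fix a assume "a \<in> W \<inter> {b \<in> topspace B. \<pi> b \<in> \<psi> ` V'}"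
      then obtain c where c: "a \<in> W" "c \<in> V" "c \<in> topspace C" "k c \<in> W" "\<pi> a = \<psi> c"
        unfolding V'_def by auto
      then have "a = k c" using W(3) over[of c] by (auto dest: inj_onD)
      then show "a \<in> k ` V" using c by blast
    qed
    ultimately show ?thesis by blast
  qed
  then show "openin B (k ` V)" by (subst openin_subopen) blast
qed

text \<open>The image is open by the previous lemma and closed by compactness.\<close>

lemma surjective_lift:
  assumes "open_map C X \<psi>" "continuous_map B X \<pi>" "locally_injective B \<pi>" "continuous_map C B k"
    and "\<And>c. c \<in> topspace C \<Longrightarrow> \<psi> c = \<pi> (k c)"
    and "compact_space C" "topspace C \<noteq> {}" "connected_space B" "Hausdorff_space B"
  shows "k ` topspace C = topspace B"
proof -
  have "openin B (k ` topspace C)"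
    using open_map_lift[OF assms(1-5)] unfolding open_map_def by blast
  moreover have "closedin B (k ` topspace C)"
    using continuous_imp_closed_map[OF assms(4,6,9)] unfolding closed_map_def by blast
  ultimately show ?thesis
    using assms(7,8) unfolding connected_space_clopen_in by blast
qed

section \<open>Quotients of compact Hausdorff spaces by closed equivalence relations\<close>

definition quotient_space :: "'z topology \<Rightarrow> ('z \<times> 'z) set \<Rightarrow> 'z set topology" where
  "quotient_space Z R =
     topology (\<lambda>U. U \<subseteq> topspace Z // R \<and> openin Z {z \<in> topspace Z. R `` {z} \<in> U})"

lemma openin_quotient_space:
  "openin (quotient_space Z R) U \<longleftrightarrow> U \<subseteq> topspace Z // R \<and> openin Z {z \<in> topspace Z. R `` {z} \<in> U}"
proof -
  have "istopology (\<lambda>U. U \<subseteq> topspace Z // R \<and> openin Z {z \<in> topspace Z. R `` {z} \<in> U})"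
    unfolding istopology_def
  proof (intro conjI allI impI)
    fix U V assume "U \<subseteq> topspace Z // R \<and> openin Z {z \<in> topspace Z. R `` {z} \<in> U}"
      and "V \<subseteq> topspace Z // R \<and> openin Z {z \<in> topspace Z. R `` {z} \<in> V}"
    moreover have "{z \<in> topspace Z. R `` {z} \<in> U \<inter> V} =
      {z \<in> topspace Z. R `` {z} \<in> U} \<inter> {z \<in> topspace Z. R `` {z} \<in> V}" by blast
    ultimately show "U \<inter> V \<subseteq> topspace Z // R" "openin Z {z \<in> topspace Z. R `` {z} \<in> U \<inter> V}"
      by auto
  next
    fix \<K> assume K: "\<forall>U\<in>\<K>. U \<subseteq> topspace Z // R \<and> openin Z {z \<in> topspace Z. R `` {z} \<in> U}"
    moreover have "{z \<in> topspace Z. R `` {z} \<in> \<Union>\<K>} = (\<Union>U\<in>\<K>. {z \<in> topspace Z. R `` {z} \<in> U})"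
      by blast
    ultimately show "\<Union>\<K> \<subseteq> topspace Z // R" "openin Z {z \<in> topspace Z. R `` {z} \<in> \<Union>\<K>}"
      by auto
  qed
  then show ?thesis by (simp add: quotient_space_def)
qed

lemma topspace_quotient_space [simp]: "topspace (quotient_space Z R) = topspace Z // R"
proof
  show "topspace (quotient_space Z R) \<subseteq> topspace Z // R"
    using openin_topspace[of "quotient_space Z R"] unfolding openin_quotient_space by blast
  have "{z \<in> topspace Z. R `` {z} \<in> topspace Z // R} = topspace Z" by (auto intro: quotientI)
  then have "openin (quotient_space Z R) (topspace Z // R)"
    unfolding openin_quotient_space by simp
  then show "topspace Z // R \<subseteq> topspace (quotient_space Z R)" using openin_subset by blast
qed

lemma quotient_map_quotient_space: "quotient_map Z (quotient_space Z R) (\<lambda>z. R `` {z})"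
  unfolding quotient_map_def openin_quotient_space topspace_quotient_space
  by (auto simp: quotient_def)

text \<open>The saturation of a closed set is a projection of a closed part of \<^term>\<open>R\<close>.\<close>

lemma closed_map_quotient_space:
  assumes "compact_space Z" "equiv (topspace Z) R" "closedin (prod_topology Z Z) R"
  shows "closed_map Z (quotient_space Z R) (\<lambda>z. R `` {z})"
  unfolding closed_map_def
proof (intro allI impI)
  fix A assume A: "closedin Z A"
  let ?q = "\<lambda>z. R `` {z}"
  have AZ: "A \<subseteq> topspace Z" using A closedin_subset by blast
  have "closedin (prod_topology Z Z) (R \<inter> A \<times> topspace Z)"
    using A assms(3) by (intro closedin_Int) (auto simp: closedin_prod_Times_iff)
  then have "closedin Z (snd ` (R \<inter> A \<times> topspace Z))"
    using closed_map_snd[OF assms(1), of Z] unfolding closed_map_def by blast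
  moreover have "snd ` (R \<inter> A \<times> topspace Z) = {z \<in> topspace Z. ?q z \<in> ?q ` A}"
  proof (intro equalityI subsetI)
    fix z assume "z \<in> snd ` (R \<inter> A \<times> topspace Z)"
    then obtain a where "a \<in> A" "(a, z) \<in> R" "z \<in> topspace Z" by auto
    then show "z \<in> {z \<in> topspace Z. ?q z \<in> ?q ` A}"
      using equiv_class_eq[OF assms(2)] by blast
  next
    fix z assume "z \<in> {z \<in> topspace Z. ?q z \<in> ?q ` A}"
    then obtain a where "a \<in> A" "z \<in> topspace Z" "?q z = ?q a" by auto
    then have "(a, z) \<in> R" using assms(2) eq_equiv_class[of R a z] by metis
    then show "z \<in> snd ` (R \<inter> A \<times> topspace Z)" using \<open>a \<in> A\<close> \<open>z \<in> topspace Z\<close> by force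
  qed
  moreover have "?q ` A \<subseteq> topspace (quotient_space Z R)" using AZ by (auto intro: quotientI)
  ultimately show "closedin (quotient_space Z R) (?q ` A)"
    using quotient_map_quotient_space[of Z R]
    unfolding quotient_map_closedin by (elim conjE allE[of _ "?q ` A"]) simp
qed

lemma compact_Hausdorff_quotient_space:
  assumes "compact_space Z" "Hausdorff_space Z" "equiv (topspace Z) R" "closedin (prod_topology Z Z) R"
  shows "compact_space (quotient_space Z R)" "Hausdorff_space (quotient_space Z R)"
proof -
  note q = quotient_map_quotient_space[of Z R]
  show "compact_space (quotient_space Z R)"
    using image_compactin[of Z "topspace Z"] quotient_imp_continuous_map[OF q]
      quotient_imp_surjective_map[OF q] assms(1) by (metis compact_space_def)
  have "normal_space Z" using assms compact_Hausdorff_or_regular_imp_normal_space by blast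
  then show "Hausdorff_space (quotient_space Z R)"
    using normal_Hausdorff_space_closed_continuous_map_image[OF _ assms(2) closed_map_quotient_space[OF assms(1,3,4)]
      quotient_imp_continuous_map[OF q] quotient_imp_surjective_map[OF q]] by simp
qed

section \<open>Free actions of finite groups\<close>

text \<open>The group axioms in terms of the values of the functions, without reference to the
  multiplication and inverse of \<^term>\<open>BijGroup S\<close>.\<close>

lemma subgroup_BijGroup_apply:
  assumes "subgroup G (BijGroup S)"
  shows "\<And>g. g \<in> G \<Longrightarrow> g \<in> Bij S"
    and "\<And>g y. g \<in> G \<Longrightarrow> y \<in> S \<Longrightarrow> g y \<in> S"
    and "(\<lambda>y\<in>S. y) \<in> G"
    and "\<And>g h. g \<in> G \<Longrightarrow> h \<in> G \<Longrightarrow> compose S g h \<in> G"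
    and "\<And>g. g \<in> G \<Longrightarrow> \<exists>h\<in>G. \<forall>y\<in>S. h (g y) = y \<and> g (h y) = y"
proof -
  show GB: "g \<in> Bij S" if "g \<in> G" for g
    using subgroup.subset[OF assms] that by (auto simp: BijGroup_def)
  then show "g y \<in> S" if "g \<in> G" "y \<in> S" for g y
    using that Bij_imp_funcset by blast
  show "(\<lambda>y\<in>S. y) \<in> G" using subgroup.one_closed[OF assms] by (simp add: BijGroup_def)
  show "compose S g h \<in> G" if "g \<in> G" "h \<in> G" for g h
    using subgroup.m_closed[OF assms that] GB that by (simp add: BijGroup_def)
  show "\<exists>h\<in>G. \<forall>y\<in>S. h (g y) = y \<and> g (h y) = y" if g: "g \<in> G" for g
  proof (intro bexI ballI)
    let ?h = "inv\<^bsub>BijGroup S\<^esub> g"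
    show "?h \<in> G" using subgroup.m_inv_closed[OF assms g] .
    fix y assume y: "y \<in> S"
    have "bij_betw g S S" using GB[OF g] by (simp add: Bij_def)
    moreover have "?h = (\<lambda>x\<in>S. inv_into S g x)" using inv_BijGroup[OF GB[OF g]] .
    moreover have "g y \<in> S" using GB[OF g] y Bij_imp_funcset by blast
    ultimately show "?h (g y) = y \<and> g (?h y) = y"
      using y by (simp add: bij_betw_inv_into_left bij_betw_inv_into_right)
  qed
qed

lemma subgroup_BijGroupI:
  assumes "G \<subseteq> Bij S" "(\<lambda>y\<in>S. y) \<in> G"
    and "\<And>g h. g \<in> G \<Longrightarrow> h \<in> G \<Longrightarrow> compose S g h \<in> G"
    and "\<And>g. g \<in> G \<Longrightarrow> \<exists>h\<in>G. \<forall>y\<in>S. h (g y) = y"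
  shows "subgroup G (BijGroup S)"
proof (rule group.subgroupI[OF group_BijGroup])
  show "G \<subseteq> carrier (BijGroup S)" using assms(1) by (simp add: BijGroup_def)
  show "G \<noteq> {}" using assms(2) by blast
  show "g \<otimes>\<^bsub>BijGroup S\<^esub> h \<in> G" if "g \<in> G" "h \<in> G" for g h
    using assms(1,3) that by (auto simp: BijGroup_def)
  show "inv\<^bsub>BijGroup S\<^esub> g \<in> G" if g: "g \<in> G" for g
  proof -
    obtain h where h: "h \<in> G" "\<And>y. y \<in> S \<Longrightarrow> h (g y) = y" using assms(4)[OF g] by blast
    have "compose S h g = (\<lambda>y\<in>S. y)" using h(2) by (auto simp: compose_def)
    then have "inv\<^bsub>BijGroup S\<^esub> g = h"
      using group.inv_equality[OF group_BijGroup, where y=h and x=g] g h(1) assms(1) by (auto simp: BijGroup_def)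
    then show ?thesis using h(1) by simp
  qed
qed

locale free_finite_action =
  fixes P :: "'p topology" and K :: "('p \<Rightarrow> 'p) set" and \<pi> :: "'p \<Rightarrow> 'a" and X :: "'a topology"
  assumes compact: "compact_space P" and Haus: "Hausdorff_space P" and base: "Hausdorff_space X"
    and cont: "continuous_map P X \<pi>"
    and sub: "subgroup K (BijGroup (topspace P))" and fin: "finite K"
    and homeo: "\<And>g. g \<in> K \<Longrightarrow> homeomorphic_map P P g"
    and free: "\<And>g y. g \<in> K \<Longrightarrow> y \<in> topspace P \<Longrightarrow> g y = y \<Longrightarrow> g = (\<lambda>y\<in>topspace P. y)"
    and orbit: "orbit_map (topspace P) K \<pi> (topspace X)"
begin

lemmas act = subgroup_BijGroup_apply[OF sub]

lemma surj: "\<pi> ` topspace P = topspace X"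
  using orbit by (simp add: orbit_map_def)

lemma fibre: "y \<in> topspace P \<Longrightarrow> y' \<in> topspace P \<Longrightarrow> \<pi> y = \<pi> y' \<longleftrightarrow> (\<exists>g\<in>K. y' = g y)"
  using orbit by (simp add: orbit_map_def)

lemma invariant: "g \<in> K \<Longrightarrow> y \<in> topspace P \<Longrightarrow> \<pi> (g y) = \<pi> y"
  by (rule fibre[THEN iffD2, symmetric]) (auto intro: act(2))

lemma quotient: "quotient_map P X \<pi>"
  by (rule continuous_imp_quotient_map[OF cont compact base surj])

lemma saturation: "O' \<subseteq> topspace P \<Longrightarrow> {y \<in> topspace P. \<pi> y \<in> \<pi> ` O'} = (\<Union>g\<in>K. g ` O')"
proof (intro equalityI subsetI)
  fix y assume O: "O' \<subseteq> topspace P" and y: "y \<in> {y \<in> topspace P. \<pi> y \<in> \<pi> ` O'}"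
  then obtain v where "v \<in> O'" "\<pi> v = \<pi> y" by auto
  then show "y \<in> (\<Union>g\<in>K. g ` O')" using O y fibre[of v y] by blast
next
  fix y assume O: "O' \<subseteq> topspace P" and y: "y \<in> (\<Union>g\<in>K. g ` O')"
  then obtain g v where gv: "g \<in> K" "v \<in> O'" "y = g v" by blast
  then have "v \<in> topspace P" "y \<in> topspace P" using O act(2) by blast+
  moreover then have "\<pi> v = \<pi> y" using invariant gv by simp
  ultimately show "y \<in> {y \<in> topspace P. \<pi> y \<in> \<pi> ` O'}" using gv(2) by simp (metis imageI)
qed

lemma open_map: "open_map P X \<pi>"
  unfolding open_map_def
proof (intro allI impI)
  fix O' assume O': "openin P O'"
  then have sub: "O' \<subseteq> topspace P" using openin_subset by blast
  have "openin P (g ` O')" if "g \<in> K" for g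
    using homeomorphic_imp_open_map[OF homeo[OF that]] O' unfolding open_map_def by blast
  then have "openin P {y \<in> topspace P. \<pi> y \<in> \<pi> ` O'}"
    unfolding saturation[OF sub] by blast
  moreover have "\<pi> ` O' \<subseteq> topspace X" using surj sub by blast
  ultimately show "openin X (\<pi> ` O')" using quotient unfolding quotient_map_def by blast
qed

text \<open>Only finitely many points, the other points of its orbit, have to be separated from the given
  point.\<close>

lemma wandering_neighbourhood:
  assumes u: "u \<in> topspace P"
  obtains V where "openin P V" "u \<in> V"
    "\<And>g y. g \<in> K \<Longrightarrow> y \<in> V \<Longrightarrow> g y \<in> V \<Longrightarrow> g = (\<lambda>y\<in>topspace P. y)"
proof -
  let ?S = "topspace P"
  define K' where "K' = {g \<in> K. g u \<noteq> u}"
  have "\<exists>A B. openin P A \<and> openin P B \<and> u \<in> A \<and> g u \<in> B \<and> disjnt A B" if "g \<in> K'" for g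
    using Haus u act(2) that unfolding K'_def Hausdorff_space_def by (metis (mono_tags, lifting) mem_Collect_eq)
  then obtain A B where AB: "\<And>g. g \<in> K' \<Longrightarrow> openin P (A g) \<and> openin P (B g) \<and> u \<in> A g \<and> g u \<in> B g \<and> disjnt (A g) (B g)"
    by metis
  define V where "V = (\<Inter>g\<in>K'. A g \<inter> {y \<in> ?S. g y \<in> B g}) \<inter> ?S"
  have "openin P (A g \<inter> {y \<in> ?S. g y \<in> B g})" if "g \<in> K'" for g
    using that AB[OF that] homeo openin_continuous_map_preimage[of P P g "B g"]
    by (intro openin_Int) (auto simp: K'_def homeomorphic_imp_continuous_map)
  moreover have "finite K'" using fin by (simp add: K'_def)
  ultimately have "openin P V"
    unfolding V_def by (intro openin_INT)
  moreover have "u \<in> V" using u AB unfolding V_def by blast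
  moreover have "g = (\<lambda>y\<in>?S. y)" if g: "g \<in> K" "y \<in> V" "g y \<in> V" for g y
  proof (cases "g \<in> K'")
    case True
    then have "g y \<in> A g \<inter> B g" using g unfolding V_def by blast
    then show ?thesis using AB[OF True] by (auto simp: disjnt_iff)
  next
    case False
    then show ?thesis using free[OF g(1) u] g(1) by (simp add: K'_def)
  qed
  ultimately show thesis using that by blast
qed

text \<open>The translates of a wandering neighbourhood are the sheets over its image.\<close>

lemma regular_covering_map: "regular_covering_map P K \<pi> X"
proof -
  let ?S = "topspace P"
  have "\<exists>T. openin X T \<and> x \<in> T \<and> (\<exists>\<V>. \<Union>\<V> = {y \<in> ?S. \<pi> y \<in> T} \<and> (\<forall>V\<in>\<V>. openin P V) \<and>
      pairwise disjnt \<V> \<and> (\<forall>V\<in>\<V>. homeomorphic_map (subtopology P V) (subtopology X T) \<pi>))"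
    if x: "x \<in> topspace X" for x
  proof -
    obtain u where u: "u \<in> ?S" "\<pi> u = x" using x unfolding surj[symmetric] by blast
    obtain V where V: "openin P V" "u \<in> V"
      and off: "\<And>g y. g \<in> K \<Longrightarrow> y \<in> V \<Longrightarrow> g y \<in> V \<Longrightarrow> g = (\<lambda>y\<in>?S. y)"
      using wandering_neighbourhood[OF u(1)] by blast
    have VS: "V \<subseteq> ?S" using V(1) openin_subset by blast
    have gV: "openin P (g ` V)" if "g \<in> K" for g
      using homeomorphic_imp_open_map[OF homeo[OF that]] V(1) unfolding open_map_def by blast
    have gS: "g ` V \<subseteq> ?S" if "g \<in> K" for g using gV[OF that] openin_subset by blast
    have img: "\<pi> (g y) = \<pi> y" if "g \<in> K" "y \<in> V" for g y
      using invariant[OF that(1)] that(2) VS by blast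
    have inj: "inj_on \<pi> (g ` V)" if g: "g \<in> K" for g
    proof (rule inj_onI)
      fix a b assume "a \<in> g ` V" "b \<in> g ` V" "\<pi> a = \<pi> b"
      then obtain y z where yz: "y \<in> V" "z \<in> V" "a = g y" "b = g z" "\<pi> y = \<pi> z"
        using img[OF g] by auto
      then obtain k where k: "k \<in> K" "z = k y" using fibre[of y z] VS by blast
      then have "k = (\<lambda>y\<in>?S. y)" using off yz by blast
      then show "a = b" using k yz VS by auto
    qed
    show ?thesis
    proof (intro exI conjI ballI)
      show "openin X (\<pi> ` V)" using open_map V(1) unfolding open_map_def by blast
      show "x \<in> \<pi> ` V" using u V by blast
      show "\<Union>((\<lambda>g. g ` V) ` K) = {y \<in> ?S. \<pi> y \<in> \<pi> ` V}" using saturation[OF VS] by simp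
      show "openin P W" if "W \<in> (\<lambda>g. g ` V) ` K" for W using that gV by blast
      show "pairwise disjnt ((\<lambda>g. g ` V) ` K)"
      proof (rule pairwiseI)
        fix W W' assume W: "W \<in> (\<lambda>g. g ` V) ` K" "W' \<in> (\<lambda>g. g ` V) ` K" "W \<noteq> W'"
        then obtain g g' where g: "g \<in> K" "W = g ` V" "g' \<in> K" "W' = g' ` V" by blast
        show "disjnt W W'"
        proof (rule ccontr)
          assume "\<not> disjnt W W'"
          then obtain y y' where y: "y \<in> V" "y' \<in> V" "g y = g' y'" using g by (auto simp: disjnt_iff)
          obtain h where h: "h \<in> K" "\<And>y. y \<in> ?S \<Longrightarrow> h (g' y) = y \<and> g' (h y) = y"
            using act(5)[OF g(3)] by blast
          have k: "compose ?S h g \<in> K" using act(4) h(1) g(1) .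
          have "compose ?S h g y = y'" using y VS h(2)[of y'] by (auto simp: compose_def)
          then have *: "compose ?S h g = (\<lambda>y\<in>?S. y)" using off[OF k y(1)] y(2) by simp
          have "g z = g' z" if "z \<in> V" for z
          proof -
            have "z \<in> ?S" "g z \<in> ?S" using that VS act(2) g(1) by blast+
            then have "g' (h (g z)) = g z" "h (g z) = z"
              using h(2)[of "g z"] fun_cong[OF *, of z] by (auto simp: compose_def)
            then show ?thesis by simp
          qed
          then show False using W(3) g by simp
        qed
      qed
      show "homeomorphic_map (subtopology P W) (subtopology X (\<pi> ` V)) \<pi>"
        if "W \<in> (\<lambda>g. g ` V) ` K" for W
      proof -
        obtain g where g: "g \<in> K" "W = g ` V" using \<open>W \<in> _\<close> by blast
        have im: "\<pi> ` W = \<pi> ` V" unfolding g(2) image_image by (rule image_cong[OF refl img[OF g(1)]])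
        show ?thesis
        proof (rule bijective_open_imp_homeomorphic_map)
          show "continuous_map (subtopology P W) (subtopology X (\<pi> ` V)) \<pi>"
            using cont im by (auto simp: continuous_map_in_subtopology continuous_map_from_subtopology)
          show "open_map (subtopology P W) (subtopology X (\<pi> ` V)) \<pi>"
            using open_map_from_subtopology[OF open_map, of W] gV[OF g(1)] g(2) im
            by (intro open_map_into_subtopology) auto
          have ts: "topspace (subtopology P W) = W" using gS[OF g(1)] g(2) by auto
          show "\<pi> ` topspace (subtopology P W) = topspace (subtopology X (\<pi> ` V))"
            unfolding ts im using VS surj by auto
          show "inj_on \<pi> (topspace (subtopology P W))" unfolding ts using inj[OF g(1)] g(2) by simp
        qed
      qed
    qed
  qed
  then show ?thesis
    unfolding regular_covering_map_def covering_map_def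
    using cont surj sub homeo free quotient orbit by (auto simp: BijGroup_def)
qed

text \<open>If the base is connected, then the space need not be, but a clopen set containing a given
  point and as few points of its fibre as possible is: a smaller nonempty clopen set maps onto the
  base as well, so it would meet that fibre in fewer points.  The stabiliser of this piece acts
  on it with the same quotient.\<close>

lemma connected_piece:
  assumes X: "connected_space X" and u: "u \<in> topspace P"
  obtains C L where "closedin P C" "u \<in> C" "connected_space (subtopology P C)"
    "regular_covering_map (subtopology P C) L \<pi> X"
proof -
  let ?S = "topspace P"
  define F where "F = {y \<in> ?S. \<pi> u = \<pi> y}"
  have "F = (\<lambda>g. g u) ` K" using fibre[OF u] u act(2) by (auto simp: F_def)
  then have finF: "finite F" using fin by simp
  have onto: "\<pi> ` D = topspace X" if "openin P D" "closedin P D" "D \<noteq> {}" for D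
    using X that open_map continuous_imp_closed_map[OF cont compact base]
    unfolding connected_space_clopen_in open_map_def closed_map_def by (metis image_is_empty)
  define Q where "Q = (\<lambda>C. openin P C \<and> closedin P C \<and> u \<in> C)"
  have "Q ?S" using u by (simp add: Q_def)
  then obtain C where C: "Q C" and min: "\<And>D. Q D \<Longrightarrow> card (C \<inter> F) \<le> card (D \<inter> F)"
    using ex_has_least_nat[of Q ?S "\<lambda>C. card (C \<inter> F)"] by blast
  have opC: "openin P C" and clC: "closedin P C" and uC: "u \<in> C" using C by (auto simp: Q_def)
  have CS: "C \<subseteq> ?S" using clC closedin_subset by blast
  have smaller: False if "openin P D" "closedin P D" "D \<subseteq> C" "u \<in> D" "D \<noteq> C" for D
  proof -
    have "closedin P (C - D)" "openin P (C - D)" "C - D \<noteq> {}" using that clC opC by blast+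
    then have "\<pi> u \<in> \<pi> ` (C - D)" using onto surj u by blast
    then obtain w where "w \<in> C - D" "\<pi> w = \<pi> u" by auto
    then have "w \<in> F" "w \<in> C" "w \<notin> D" using CS by (auto simp: F_def)
    then have "D \<inter> F \<subset> C \<inter> F" using that(3) by blast
    then have "card (D \<inter> F) < card (C \<inter> F)" using finF by (intro psubset_card_mono) auto
    then show False using min[of D] that by (simp add: Q_def)
  qed
  have conC: "D = {} \<or> D = C" if D: "openin P D" "closedin P D" "D \<subseteq> C" for D
  proof (cases "u \<in> D")
    case True
    then show ?thesis using smaller D by blast
  next
    case False
    then show ?thesis using smaller[of "C - D"] D opC clC uC by blast
  qed
  define L where "L = (\<lambda>g. restrict g C) ` {g \<in> K. g ` C = C}"
  let ?P = "subtopology P C"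
  have tsC: "topspace ?P = C" using CS by auto
  have conn: "connected_space ?P"
    unfolding connected_space_clopen_in tsC
    using conC openin_trans_full[OF _ opC] closedin_trans_full[OF _ clC] by (metis closedin_subset tsC)
  have move: "g ` C = C" if g: "g \<in> K" "y \<in> C" "g y \<in> C" for g y
  proof -
    have gC: "openin P (g ` C)" "closedin P (g ` C)"
      using homeomorphic_imp_open_map[OF homeo[OF g(1)]] homeomorphic_imp_closed_map[OF homeo[OF g(1)]]
        opC clC unfolding open_map_def closed_map_def by blast+
    then have "C \<subseteq> g ` C" using conC[of "C \<inter> g ` C"] g opC clC by blast
    moreover
    define D where "D = {y \<in> C. g y \<in> C}"
    have D: "D = C \<inter> {y \<in> ?S. g y \<in> C}" using CS by (auto simp: D_def)
    have cg: "continuous_map P P g" using homeo[OF g(1)] homeomorphic_imp_continuous_map by blast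
    have "openin P D" "closedin P D"
      unfolding D using opC clC openin_continuous_map_preimage[OF cg] closedin_continuous_map_preimage[OF cg] by blast+
    then have "D = C" using conC[of D] g by (auto simp: D_def)
    then have "g ` C \<subseteq> C" by (auto simp: D_def)
    ultimately show ?thesis by blast
  qed
  have "free_finite_action ?P L \<pi> X"
  proof (rule free_finite_action.intro)
    show "compact_space ?P" using clC compact closedin_compact_space compact_space_subtopology by blast
    show "Hausdorff_space ?P" using Haus Hausdorff_space_subtopology by blast
    show "Hausdorff_space X" by (rule base)
    show "continuous_map ?P X \<pi>" using cont continuous_map_from_subtopology by blast
    show "finite L" using fin by (simp add: L_def)
    show "subgroup L (BijGroup (topspace ?P))"
      unfolding tsC
    proof (rule subgroup_BijGroupI)
      show "L \<subseteq> Bij C"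
      proof
        fix l assume "l \<in> L"
        then obtain g where g: "g \<in> K" "g ` C = C" "l = restrict g C" by (auto simp: L_def)
        have "inj_on g C" using act(1)[OF g(1)] CS by (auto simp: Bij_def bij_betw_def intro: inj_on_subset)
        then show "l \<in> Bij C" using g by (auto simp: Bij_def bij_betw_def)
      qed
      have "(\<lambda>y\<in>?S. y) ` C = C" "restrict (\<lambda>y\<in>?S. y) C = (\<lambda>y\<in>C. y)" using CS by (force simp: restrict_def)+
      then show "(\<lambda>y\<in>C. y) \<in> L" unfolding L_def using act(3) by (metis (mono_tags, lifting) image_eqI mem_Collect_eq)
      fix l assume "l \<in> L"
      then obtain g where g: "g \<in> K" "g ` C = C" "l = restrict g C" by (auto simp: L_def)
      obtain h where h: "h \<in> K" "\<And>y. y \<in> ?S \<Longrightarrow> h (g y) = y \<and> g (h y) = y"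
        using act(5)[OF g(1)] by blast
      have "h (g u) \<in> C" "g u \<in> C" using h(2) u uC g by auto
      then have "h ` C = C" using move[OF h(1)] by blast
      then have "restrict h C \<in> L" using h(1) by (auto simp: L_def)
      moreover have "\<forall>y\<in>C. restrict h C (l y) = y" using g h(2) CS by auto
      ultimately show "\<exists>h\<in>L. \<forall>y\<in>C. h (l y) = y" by blast
      fix m assume "m \<in> L"
      then obtain k where k: "k \<in> K" "k ` C = C" "m = restrict k C" by (auto simp: L_def)
      have "compose ?S g k ` C = g ` k ` C"
        unfolding image_image by (rule image_cong) (use CS in \<open>auto simp: compose_def\<close>)
      then have "compose ?S g k ` C = C" using g(2) k(2) by simp
      moreover have "compose C l m = restrict (compose ?S g k) C"
      proof
        fix y
        have "k y \<in> C" if "y \<in> C" using k(2) that by blast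
        then show "compose C l m y = restrict (compose ?S g k) C y"
          using CS by (cases "y \<in> C") (auto simp: compose_def g(3) k(3))
      qed
      ultimately show "compose C l m \<in> L" using act(4)[OF g(1) k(1)] by (auto simp: L_def)
    qed
    show "homeomorphic_map ?P ?P l" if "l \<in> L" for l
    proof -
      obtain g where g: "g \<in> K" "g ` C = C" "l = restrict g C" using \<open>l \<in> L\<close> by (auto simp: L_def)
      have "homeomorphic_map ?P ?P g"
        by (rule homeomorphic_map_subtopologies[OF homeo[OF g(1)]]) (use g CS in \<open>auto simp: Int_absorb1\<close>)
      then show ?thesis by (rule homeomorphic_map_eq) (simp add: g tsC)
    qed
    show "l = (\<lambda>y\<in>topspace ?P. y)" if l: "l \<in> L" and y: "y \<in> topspace ?P" "l y = y" for l y
    proof -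
      obtain g where g: "g \<in> K" "l = restrict g C" using l by (auto simp: L_def)
      then have "g = (\<lambda>y\<in>?S. y)" using free[of g y] y CS tsC by auto
      then show ?thesis using g CS tsC by (auto simp: restrict_def fun_eq_iff)
    qed
    show "orbit_map (topspace ?P) L \<pi> (topspace X)"
      unfolding orbit_map_def tsC
    proof (intro conjI ballI)
      show "\<pi> ` C = topspace X" using onto opC clC uC by blast
      fix y y' assume y: "y \<in> C" "y' \<in> C"
      show "\<pi> y = \<pi> y' \<longleftrightarrow> (\<exists>l\<in>L. y' = l y)"
      proof
        assume "\<pi> y = \<pi> y'"
        then obtain g where g: "g \<in> K" "y' = g y" using fibre[of y y'] y CS by blast
        then have "restrict g C \<in> L" using move[of g y] y by (auto simp: L_def)
        then show "\<exists>l\<in>L. y' = l y" using g y by (intro bexI[of _ "restrict g C"]) auto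
      next
        assume "\<exists>l\<in>L. y' = l y"
        then obtain g where "g \<in> K" "y' = g y" using y by (auto simp: L_def)
        then show "\<pi> y = \<pi> y'" using fibre[of y y'] y CS by blast
      qed
    qed
  qed
  then have "regular_covering_map ?P L \<pi> X" by (rule free_finite_action.regular_covering_map)
  then show thesis using that clC uC conn by blast
qed

end

section \<open>Fibre products and metrizability\<close>

definition kernel_pair :: "'z topology \<Rightarrow> ('z \<Rightarrow> 'a) \<Rightarrow> ('z \<times> 'z) set" where
  "kernel_pair Z \<phi> = {(z, z'). z \<in> topspace Z \<and> z' \<in> topspace Z \<and> \<phi> z = \<phi> z'}"

lemma closedin_kernel_pair:
  assumes "continuous_map Z X \<phi>" "Hausdorff_space X"
  shows "closedin (prod_topology Z Z) (kernel_pair Z \<phi>)"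
proof -
  have "closedin (prod_topology Z Z) {p \<in> topspace (prod_topology Z Z). (\<phi> \<circ> fst) p = (\<phi> \<circ> snd) p}"
    using assms by (intro closedin_continuous_maps_eq[OF assms(2)] continuous_map_compose[OF _ assms(1)] continuous_map_fst continuous_map_snd)
  moreover have "{p \<in> topspace (prod_topology Z Z). (\<phi> \<circ> fst) p = (\<phi> \<circ> snd) p} = kernel_pair Z \<phi>"
    by (auto simp: kernel_pair_def)
  ultimately show ?thesis by simp
qed

text \<open>Distinct points of a common fibre cannot converge to the same point.\<close>

lemma closedin_kernel_pair_diff_Id:
  assumes "continuous_map Z X \<phi>" "Hausdorff_space X" "locally_injective Z \<phi>"
  shows "closedin (prod_topology Z Z) (kernel_pair Z \<phi> - Id)"
proof -
  obtain V where V: "\<And>z. z \<in> topspace Z \<Longrightarrow> openin Z (V z) \<and> z \<in> V z \<and> inj_on \<phi> (V z)"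
    using assms(3) unfolding locally_injective_def by metis
  have "openin (prod_topology Z Z) (\<Union>z\<in>topspace Z. V z \<times> V z)"
    using V by (intro openin_Union) (auto simp: openin_prod_Times_iff)
  then have "closedin (prod_topology Z Z) (kernel_pair Z \<phi> - (\<Union>z\<in>topspace Z. V z \<times> V z))"
    using closedin_kernel_pair[OF assms(1,2)] by blast
  moreover have "kernel_pair Z \<phi> - (\<Union>z\<in>topspace Z. V z \<times> V z) = kernel_pair Z \<phi> - Id"
    using V by (auto simp: kernel_pair_def dest: inj_onD)
  ultimately show ?thesis by simp
qed

text \<open>By compactness, finitely many continuous real functions separate any two distinct points of a
  common fibre; together with \<^term>\<open>\<pi>\<close> they embed the space.\<close>

lemma metrizable_space_locally_injective:
  assumes P: "compact_space P" "Hausdorff_space P" and X: "metrizable_space X"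
    and \<pi>: "continuous_map P X \<pi>" "locally_injective P \<pi>"
  shows "metrizable_space P"
proof -
  let ?S = "topspace P"
  let ?A = "kernel_pair P \<pi> - Id"
  have HX: "Hausdorff_space X" using X by (rule metrizable_imp_Hausdorff_space)
  have "normal_space P" using P compact_Hausdorff_or_regular_imp_normal_space by blast
  have "\<exists>\<eta>. continuous_map P euclideanreal \<eta> \<and> \<eta> u = 0 \<and> \<eta> u' = 1" if "(u, u') \<in> ?A" for u u'
  proof -
    have "closedin P {u}" "closedin P {u'}" "disjnt {u} {u'}"
      using that P(2) by (auto simp: kernel_pair_def closedin_Hausdorff_singleton)
    then obtain \<eta> where "continuous_map P (top_of_set {0..1::real}) \<eta>" "\<eta> ` {u} \<subseteq> {0}" "\<eta> ` {u'} \<subseteq> {1}"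
      using Urysohn_lemma[OF \<open>normal_space P\<close>, of "{u}" "{u'}" 0 1] by auto
    then show ?thesis by (auto simp: continuous_map_in_subtopology)
  qed
  then have "\<forall>d\<in>?A. \<exists>\<eta>. continuous_map P euclideanreal \<eta> \<and> \<eta> (fst d) = 0 \<and> \<eta> (snd d) = 1"
    by (simp add: split_paired_all)
  from bchoice[OF this] obtain \<eta> where \<eta>: "\<And>d. d \<in> ?A \<Longrightarrow> continuous_map P euclideanreal (\<eta> d)"
    "\<And>d. d \<in> ?A \<Longrightarrow> \<eta> d (fst d) = 0" "\<And>d. d \<in> ?A \<Longrightarrow> \<eta> d (snd d) = 1"
    by blast
  define O' where "O' = (\<lambda>d. {u \<in> ?S. \<eta> d u \<in> {..<1/2}} \<times> {u \<in> ?S. \<eta> d u \<in> {1/2<..}})"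
  have op: "openin (prod_topology P P) (O' d)" if "d \<in> ?A" for d
    unfolding O'_def openin_prod_Times_iff
    by (intro disjI2 conjI openin_continuous_map_preimage[OF \<eta>(1)[OF that]]) auto
  have dO: "d \<in> O' d" if "d \<in> ?A" for d
    using that \<eta>(2,3)[OF that] by (cases d) (auto simp: O'_def kernel_pair_def)
  have "compactin (prod_topology P P) ?A"
    using closedin_kernel_pair_diff_Id[OF \<pi>(1) HX \<pi>(2)] P(1)
    by (intro closedin_compact_space) (auto simp: compact_space_prod_topology)
  then have "\<exists>\<D>. finite \<D> \<and> \<D> \<subseteq> O' ` ?A \<and> ?A \<subseteq> \<Union>\<D>"
  proof (rule compactinD)
    show "?A \<subseteq> \<Union>(O' ` ?A)" using dO by (intro subsetI UN_I)
  qed (use op in blast)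
  then obtain D where D: "finite D" "D \<subseteq> ?A" "?A \<subseteq> \<Union>(O' ` D)"
    by (metis finite_subset_image)
  define \<Phi> where "\<Phi> = (\<lambda>u. (\<pi> u, \<lambda>d\<in>D. \<eta> d u))"
  let ?E = "prod_topology X (product_topology (\<lambda>_. euclideanreal) D)"
  have "metrizable_space (product_topology (\<lambda>_. euclideanreal) D)"
    using D(1) by (auto simp: metrizable_space_product_topology countable_finite metrizable_space_euclidean)
  then have E: "metrizable_space ?E"
    using X by (auto simp: metrizable_space_prod_topology)
  have "continuous_map P (product_topology (\<lambda>_. euclideanreal) D) (\<lambda>u. \<lambda>d\<in>D. \<eta> d u)"
    using \<eta>(1) D(2) by (subst continuous_map_componentwise) auto
  then have cont: "continuous_map P ?E \<Phi>"
    unfolding \<Phi>_def using \<pi>(1) by (intro continuous_map_pairedI)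
  have "inj_on \<Phi> ?S"
  proof (rule inj_onI, rule ccontr)
    fix u u' assume u: "u \<in> ?S" "u' \<in> ?S" "\<Phi> u = \<Phi> u'" "u \<noteq> u'"
    then have "(u, u') \<in> ?A" by (auto simp: \<Phi>_def kernel_pair_def)
    then obtain d where d: "d \<in> D" "(u, u') \<in> O' d" using D(3) by blast
    have "(\<lambda>d\<in>D. \<eta> d u) d = (\<lambda>d\<in>D. \<eta> d u') d" using u(3) by (simp add: \<Phi>_def)
    then show False using d by (auto simp: O'_def)
  qed
  then have "embedding_map P ?E \<Phi>"
    using continuous_imp_embedding_map cont P(1) metrizable_imp_Hausdorff_space[OF E] by blast
  then show ?thesis
    using E embedding_map_imp_homeomorphic_space homeomorphic_metrizable_space metrizable_space_subtopology by blast
qed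

section \<open>Galois closures of finite coverings\<close>

lemma continuous_map_tuple_permute:
  assumes "\<And>i. i \<in> I \<Longrightarrow> \<sigma> i \<in> I"
  shows "continuous_map (product_topology (\<lambda>_. T) I) (product_topology (\<lambda>_. T) I) (\<lambda>u. \<lambda>i\<in>I. u (\<sigma> i))"
  using assms by (subst continuous_map_componentwise) (auto intro: continuous_map_product_projection)

text \<open>By compactness the fibres are finite; since the map is open and the base is connected, they all
  have the same number of points (\<open>card_fibre_const\<close> below).\<close>

locale finite_covering =
  fixes T :: "'t topology" and X :: "'a topology" and \<psi> :: "'t \<Rightarrow> 'a"
  assumes compact: "compact_space T" and Haus: "Hausdorff_space T" and X: "continuum X"
    and cont: "continuous_map T X \<psi>" and opn: "open_map T X \<psi>"
    and surj: "\<psi> ` topspace T = topspace X" and inj: "locally_injective T \<psi>"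
begin

lemma base_Haus: "Hausdorff_space X"
  using X by (simp add: continuum_def metrizable_imp_Hausdorff_space)

lemma metr: "metrizable_space T"
  using metrizable_space_locally_injective[OF compact Haus _ cont inj] X by (simp add: continuum_def)

definition fibre :: "'a \<Rightarrow> 't set" where "fibre x = {t \<in> topspace T. \<psi> t = x}"

abbreviation tuple_space :: "nat \<Rightarrow> (nat \<Rightarrow> 't) topology" where
  "tuple_space k \<equiv> product_topology (\<lambda>_. T) {..<k}"

definition tuples :: "nat \<Rightarrow> (nat \<Rightarrow> 't) set" where
  "tuples k = {u \<in> topspace (tuple_space k). \<forall>i<k. \<forall>j<k. i \<noteq> j \<longrightarrow> (u i, u j) \<in> kernel_pair T \<psi> - Id}"

lemma closedin_tuples: "closedin (tuple_space k) (tuples k)"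
proof -
  let ?A = "kernel_pair T \<psi> - Id"
  have A: "closedin (prod_topology T T) ?A"
    using closedin_kernel_pair_diff_Id[OF cont base_Haus inj] .
  define B where "B = (\<lambda>(i, j). {u \<in> topspace (tuple_space k). (u i, u j) \<in> ?A})"
  define D where "D = {(i, j). i < k \<and> j < k \<and> i \<noteq> j}"
  have "closedin (tuple_space k) (B d)" if dD: "d \<in> D" for d
  proof -
    obtain i j where d: "d = (i, j)" "i < k" "j < k" using dD by (auto simp: D_def)
    show ?thesis
      unfolding d(1) B_def prod.case using d(2,3)
      by (intro closedin_continuous_map_preimage[OF _ A] continuous_map_pairedI continuous_map_product_projection) auto
  qed
  then have "closedin (tuple_space k) (\<Inter>(insert (topspace (tuple_space k)) (B ` D)))"
    using closedin_topspace[of "tuple_space k"] by (intro closedin_Inter) blast+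
  moreover have "\<Inter>(insert (topspace (tuple_space k)) (B ` D)) = tuples k"
    unfolding tuples_def B_def D_def by auto
  ultimately show ?thesis by simp
qed

lemma tuples_eq:
  "u \<in> tuples k \<longleftrightarrow> u \<in> ({..<k} \<rightarrow>\<^sub>E topspace T) \<and> inj_on u {..<k} \<and> (\<exists>x. \<forall>i<k. \<psi> (u i) = x)"
proof -
  have "(\<forall>i<k. \<forall>j<k. i \<noteq> j \<longrightarrow> (u i, u j) \<in> kernel_pair T \<psi> - Id) \<longleftrightarrow>
      inj_on u {..<k} \<and> (\<exists>x. \<forall>i<k. \<psi> (u i) = x)" (is "?L \<longleftrightarrow> ?R")
    if u: "u \<in> {..<k} \<rightarrow>\<^sub>E topspace T"
  proof
    assume L: ?L
    have L: "u i \<noteq> u j \<and> \<psi> (u i) = \<psi> (u j)" if "i < k" "j < k" "i \<noteq> j" for i j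
      using L[rule_format, OF that] by (simp add: kernel_pair_def)
    have "\<psi> (u i) = \<psi> (u 0)" if "i < k" for i
      using L[of i 0] that by (cases "i = 0") simp_all
    moreover have "inj_on u {..<k}" using L by (intro inj_onI) (metis lessThan_iff)
    ultimately show ?R by blast
  next
    assume R: ?R
    show ?L
    proof (intro allI impI)
      fix i j assume ij: "i < k" "j < k" "i \<noteq> j"
      have "u i \<in> topspace T" "u j \<in> topspace T" "\<psi> (u i) = \<psi> (u j)" using ij u R by auto
      moreover have "u i \<noteq> u j" using R ij by (auto dest: inj_onD)
      ultimately show "(u i, u j) \<in> kernel_pair T \<psi> - Id" by (simp add: kernel_pair_def)
    qed
  qed
  then show ?thesis unfolding tuples_def by auto
qed

definition fibre_card_ge :: "nat \<Rightarrow> 'a set" where "fibre_card_ge k = (\<lambda>u. \<psi> (u 0)) ` tuples k"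

lemma fibre_card_ge_iff:
  assumes "k > 0"
  shows "x \<in> fibre_card_ge k \<longleftrightarrow> (\<exists>A \<subseteq> fibre x. finite A \<and> card A = k)"
proof
  assume "x \<in> fibre_card_ge k"
  then obtain u where u: "u \<in> tuples k" "x = \<psi> (u 0)" by (auto simp: fibre_card_ge_def)
  then have "u ` {..<k} \<subseteq> fibre x" "card (u ` {..<k}) = k"
    using assms by (auto simp: tuples_eq fibre_def card_image)
  then show "\<exists>A \<subseteq> fibre x. finite A \<and> card A = k" by blast
next
  assume "\<exists>A \<subseteq> fibre x. finite A \<and> card A = k"
  then obtain A where A: "A \<subseteq> fibre x" "finite A" "card A = k" by blast
  then obtain h where h: "bij_betw h {..<k} A"
    using ex_bij_betw_nat_finite[OF A(2)] by (auto simp: atLeast0LessThan)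
  define u where "u = restrict h {..<k}"
  have "u i = h i" "h i \<in> fibre x" if "i < k" for i
    using that h A(1) by (auto simp: u_def bij_betw_def)
  moreover have "inj_on u {..<k}" using h by (simp add: u_def bij_betw_def inj_on_def)
  ultimately have "u \<in> tuples k" "\<psi> (u 0) = x"
    using assms by (auto simp: tuples_eq fibre_def u_def)
  then show "x \<in> fibre_card_ge k" by (auto simp: fibre_card_ge_def)
qed

text \<open>The set in question is a continuous image of the compact space of \<^term>\<open>k\<close>-tuples.\<close>

lemma closedin_fibre_card_ge:
  assumes "k > 0"
  shows "closedin X (fibre_card_ge k)"
proof -
  have "continuous_map (tuple_space k) X (\<psi> \<circ> (\<lambda>u. u 0))"
    using assms by (intro continuous_map_compose[OF _ cont] continuous_map_product_projection) auto
  moreover have "compact_space (tuple_space k)" by (simp add: compact_space_product_topology compact)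
  ultimately have "closed_map (tuple_space k) X (\<psi> \<circ> (\<lambda>u. u 0))"
    using continuous_imp_closed_map base_Haus by blast
  then have "closedin X ((\<psi> \<circ> (\<lambda>u. u 0)) ` tuples k)"
    using closedin_tuples unfolding closed_map_def by blast
  then show ?thesis by (simp add: fibre_card_ge_def comp_def)
qed

text \<open>Take disjoint neighbourhoods of \<^term>\<open>k\<close> points of a fibre. Over every point that lies in the
  images of all of them, which are open, the fibre meets each of these neighbourhoods.\<close>

lemma openin_fibre_card_ge:
  assumes "k > 0"
  shows "openin X (fibre_card_ge k)"
proof -
  have "\<exists>O'. openin X O' \<and> x \<in> O' \<and> O' \<subseteq> fibre_card_ge k" if "x \<in> fibre_card_ge k" for x
  proof -
    obtain u where u: "u \<in> tuples k" "x = \<psi> (u 0)" using \<open>x \<in> fibre_card_ge k\<close> by (auto simp: fibre_card_ge_def)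
    have uT: "u i \<in> topspace T" "\<psi> (u i) = x" if "i < k" for i
      using u that assms by (auto simp: tuples_eq)
    have "\<exists>U V. openin T U \<and> openin T V \<and> u i \<in> U \<and> u j \<in> V \<and> disjnt U V"
      if "i < k" "j < k" "i \<noteq> j" for i j
      using Haus uT that u(1) unfolding Hausdorff_space_def tuples_eq inj_on_def by (metis lessThan_iff)
    then obtain U V where UV: "\<And>i j. i < k \<Longrightarrow> j < k \<Longrightarrow> i \<noteq> j \<Longrightarrow>
        openin T (U i j) \<and> openin T (V i j) \<and> u i \<in> U i j \<and> u j \<in> V i j \<and> disjnt (U i j) (V i j)"
      by metis
    define W where "W = (\<lambda>i. (\<Inter>j\<in>{..<k} - {i}. U i j \<inter> V j i) \<inter> topspace T)"
    have W: "openin T (W i)" "u i \<in> W i" if "i < k" for i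
      unfolding W_def using UV that uT(1)[OF that] by (auto intro!: openin_INT)
    have dis: "disjnt (W i) (W j)" if "i < k" "j < k" "i \<noteq> j" for i j
    proof -
      have "W i \<subseteq> U i j" "W j \<subseteq> V i j" using that unfolding W_def by auto
      then show ?thesis using UV[OF that] by (meson disjnt_subset1 disjnt_subset2)
    qed
    define O' where "O' = (\<Inter>i\<in>{..<k}. \<psi> ` W i) \<inter> topspace X"
    have "openin X O'"
      unfolding O'_def using W(1) opn unfolding open_map_def by (intro openin_INT) auto
    moreover have "x \<in> topspace X" using uT[OF assms] surj by blast
    then have "x \<in> O'" using W(2) uT(2) unfolding O'_def by force
    moreover have "O' \<subseteq> fibre_card_ge k"
    proof
      fix z assume z: "z \<in> O'"
      then have "\<forall>i\<in>{..<k}. \<exists>w. w \<in> W i \<and> \<psi> w = z" unfolding O'_def by blast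
      then obtain w where w: "\<And>i. i < k \<Longrightarrow> w i \<in> W i \<and> \<psi> (w i) = z" by (metis lessThan_iff)
      have "inj_on w {..<k}"
        using w dis unfolding inj_on_def disjnt_iff by (metis lessThan_iff)
      then have "card (w ` {..<k}) = k" by (simp add: card_image)
      moreover have "w ` {..<k} \<subseteq> fibre z" using w by (auto simp: fibre_def W_def)
      ultimately show "z \<in> fibre_card_ge k" unfolding fibre_card_ge_iff[OF assms] by blast
    qed
    ultimately show ?thesis by blast
  qed
  then show ?thesis by (subst openin_subopen) blast
qed

lemma finite_fibre: "finite (fibre x)"
proof -
  obtain V where V: "\<And>t. t \<in> topspace T \<Longrightarrow> openin T (V t) \<and> t \<in> V t \<and> inj_on \<psi> (V t)"
    using inj unfolding locally_injective_def by metis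
  have "compactin T (topspace T)" using compact by (simp add: compact_space_def)
  then have "\<exists>\<D>. finite \<D> \<and> \<D> \<subseteq> V ` topspace T \<and> topspace T \<subseteq> \<Union>\<D>"
  proof (rule compactinD)
    show "topspace T \<subseteq> \<Union>(V ` topspace T)" using V by (intro subsetI UN_I) auto
  qed (use V in blast)
  then obtain D where D: "finite D" "D \<subseteq> topspace T" "topspace T \<subseteq> \<Union>(V ` D)"
    by (metis finite_subset_image)
  have "finite (V d \<inter> fibre x)" if "d \<in> D" for d
  proof -
    have "s = t" if "s \<in> V d \<inter> fibre x" "t \<in> V d \<inter> fibre x" for s t
      using V[of d] \<open>d \<in> D\<close> D(2) that by (auto simp: fibre_def dest: inj_onD)
    then have "is_singleton (V d \<inter> fibre x) \<or> V d \<inter> fibre x = {}"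
      by (metis is_singletonI')
    then show ?thesis by (auto simp: is_singleton_def)
  qed
  then have "finite (\<Union>d\<in>D. V d \<inter> fibre x)" using D(1) by blast
  moreover have "fibre x \<subseteq> (\<Union>d\<in>D. V d \<inter> fibre x)" using D(3) by (auto simp: fibre_def)
  ultimately show ?thesis using finite_subset by blast
qed

lemma card_fibre_const:
  assumes "x \<in> topspace X" "z \<in> topspace X"
  shows "card (fibre z) = card (fibre x)"
proof -
  have fibre_card_ge: "fibre_card_ge k = {} \<or> fibre_card_ge k = topspace X" if "k > 0" for k
    using X openin_fibre_card_ge[OF that] closedin_fibre_card_ge[OF that]
    unfolding continuum_def connected_space_clopen_in by blast
  have le: "card (fibre x) \<le> card (fibre z)" if x: "x \<in> topspace X" and z: "z \<in> topspace X" for x z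
  proof (cases "card (fibre x) > 0")
    case True
    have "x \<in> fibre_card_ge (card (fibre x))" unfolding fibre_card_ge_iff[OF True] using finite_fibre by blast
    then have "z \<in> fibre_card_ge (card (fibre x))" using fibre_card_ge[OF True] z by blast
    then obtain A where "A \<subseteq> fibre z" "card A = card (fibre x)" unfolding fibre_card_ge_iff[OF True] by blast
    then show ?thesis using card_mono[OF finite_fibre] by metis
  qed simp
  show ?thesis using le[OF assms] le[OF assms(2,1)] by simp
qed

text \<open>Enumerations of fibres form a covering on which the symmetric group acts freely, with the
  fibres as orbits; a connected piece of it is a regular covering.\<close>

theorem Galois_closure:
  assumes t: "t \<in> topspace T"
  obtains C :: "(nat \<Rightarrow> 't, 'a) covering" and c k
  where "continuum_cover X C" "c \<in> cov_points C" "continuous_map (cov_space C) T k"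
    "\<And>u. u \<in> cov_points C \<Longrightarrow> \<psi> (k u) = cov_map C u" "k c = t"
proof -
  define x where "x = \<psi> t"
  define n where "n = card (fibre x)"
  have x: "x \<in> topspace X" using t surj by (auto simp: x_def)
  have "t \<in> fibre x" using t by (simp add: x_def fibre_def)
  then have n: "n > 0" unfolding n_def using finite_fibre card_gt_0_iff by blast
  have card: "card (fibre z) = n" if "z \<in> topspace X" for z
    unfolding n_def using card_fibre_const[OF x that] .
  define S where "S = tuples n"
  define P where "P = subtopology (tuple_space n) S"
  define \<pi> where "\<pi> = (\<lambda>u :: nat \<Rightarrow> 't. \<psi> (u 0))"
  define \<kappa> where "\<kappa> = (\<lambda>\<sigma>. \<lambda>u\<in>S. \<lambda>i\<in>{..<n}. (u :: nat \<Rightarrow> 't) (\<sigma> i :: nat))"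
  define K where "K = \<kappa> ` {\<sigma>. \<sigma> permutes {..<n}}"
  have tsP: "topspace P = S" using closedin_subset[OF closedin_tuples, of n] by (auto simp: P_def S_def)
  have uT: "u i \<in> topspace T" "\<psi> (u i) = \<pi> u" if "u \<in> S" "i < n" for u i
    using that n unfolding S_def tuples_eq \<pi>_def by auto
  have ext: "u \<in> extensional {..<n}" if "u \<in> S" for u
    using that unfolding S_def tuples_eq by (auto simp: PiE_def)
  have bij: "bij_betw u {..<n} (fibre (\<pi> u))" if u: "u \<in> S" for u
  proof -
    have i: "inj_on u {..<n}" using u by (simp add: S_def tuples_eq)
    have sub: "u ` {..<n} \<subseteq> fibre (\<pi> u)" using uT[OF u] by (auto simp: fibre_def)
    have "\<pi> u \<in> topspace X" using uT(1)[OF u n] surj unfolding \<pi>_def by blast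
    then have "card (fibre (\<pi> u)) = card (u ` {..<n})" using i by (simp add: card_image card)
    then have "u ` {..<n} = fibre (\<pi> u)" using card_subset_eq[OF finite_fibre sub] by simp
    then show ?thesis using i by (simp add: bij_betw_def)
  qed
  have pl: "\<sigma> i < n" if "\<sigma> permutes {..<n}" "i < n" for \<sigma> i
    using permutes_in_image[OF that(1)] that(2) by blast
  have \<kappa>S: "\<kappa> \<sigma> u \<in> S" if \<sigma>: "\<sigma> permutes {..<n}" and u: "u \<in> S" for \<sigma> u
  proof -
    have "inj_on (u \<circ> \<sigma>) {..<n}"
      using bij[OF u] \<sigma> by (intro comp_inj_on) (auto simp: permutes_inj_on permutes_image bij_betw_def)
    then have "inj_on (\<lambda>i\<in>{..<n}. u (\<sigma> i)) {..<n}" by (simp add: inj_on_def)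
    then show ?thesis using u uT[OF u] pl[OF \<sigma>] by (simp add: \<kappa>_def S_def tuples_eq)
  qed
  have \<kappa>\<kappa>: "\<kappa> \<sigma> (\<kappa> \<tau> u) = \<kappa> (\<tau> \<circ> \<sigma>) u"
    if "\<sigma> permutes {..<n}" "\<tau> permutes {..<n}" "u \<in> S" for \<sigma> \<tau> u
    using that \<kappa>S[OF that(2,3)] pl[OF that(1)] by (auto simp: \<kappa>_def fun_eq_iff)
  have \<kappa>id: "\<kappa> id u = u" if "u \<in> S" for u
    using that ext[OF that] by (auto simp: \<kappa>_def extensional_def fun_eq_iff)
  have \<kappa>inv: "\<kappa> (inv_into UNIV \<sigma>) (\<kappa> \<sigma> u) = u" "\<kappa> \<sigma> (\<kappa> (inv_into UNIV \<sigma>) u) = u"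
    if "\<sigma> permutes {..<n}" "u \<in> S" for \<sigma> u
    using \<kappa>\<kappa> \<kappa>id that permutes_inv[OF that(1)] permutes_inv_o[OF that(1)] by metis+
  have contP: "continuous_map P P (\<kappa> \<sigma>)" if \<sigma>: "\<sigma> permutes {..<n}" for \<sigma>
  proof -
    have "continuous_map P (tuple_space n) (\<lambda>u. \<lambda>i\<in>{..<n}. u (\<sigma> i))"
      unfolding P_def using pl[OF \<sigma>]
      by (intro continuous_map_from_subtopology continuous_map_tuple_permute) auto
    then have "continuous_map P (tuple_space n) (\<kappa> \<sigma>)"
      by (rule continuous_map_eq) (simp add: \<kappa>_def tsP)
    then show ?thesis unfolding P_def using \<kappa>S[OF \<sigma>] tsP by (auto simp: continuous_map_in_subtopology P_def)
  qed
  \<comment> \<open>the action is free since the entries of a tuple are distinct, and transitive on fibres since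
    every tuple enumerates the whole fibre\<close>
  have "free_finite_action P K \<pi> X"
  proof (rule free_finite_action.intro)
    show "compact_space P"
      unfolding P_def S_def using compact closedin_tuples[of n]
      by (intro compact_space_subtopology closedin_compact_space) (auto simp: compact_space_product_topology)
    show "Hausdorff_space P"
      unfolding P_def using Haus by (intro Hausdorff_space_subtopology) (auto simp: Hausdorff_space_product_topology)
    show "Hausdorff_space X" by (rule base_Haus)
    have "continuous_map (tuple_space n) X (\<psi> \<circ> (\<lambda>u. u 0))"
      using n by (intro continuous_map_compose[OF _ cont] continuous_map_product_projection) auto
    then show "continuous_map P X \<pi>"
      unfolding P_def \<pi>_def comp_def by (rule continuous_map_from_subtopology)
    show "finite K" unfolding K_def by (intro finite_imageI finite_permutations) simp
    show "subgroup K (BijGroup (topspace P))"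
      unfolding tsP
    proof (rule subgroup_BijGroupI)
      show "K \<subseteq> Bij S"
      proof
        fix g assume "g \<in> K"
        then obtain \<sigma> where \<sigma>: "\<sigma> permutes {..<n}" "g = \<kappa> \<sigma>" by (auto simp: K_def)
        have "bij_betw (\<kappa> \<sigma>) S S"
          by (rule bij_betwI[where g="\<kappa> (inv_into UNIV \<sigma>)"]) (use \<sigma> \<kappa>S \<kappa>inv permutes_inv[OF \<sigma>(1)] in auto)
        then show "g \<in> Bij S" using \<sigma>(2) by (simp add: Bij_def \<kappa>_def)
      qed
      have "\<kappa> id = (\<lambda>u\<in>S. u)" using \<kappa>id by (auto simp: fun_eq_iff \<kappa>_def)
      then show "(\<lambda>u\<in>S. u) \<in> K" unfolding K_def using permutes_id by (metis (mono_tags, lifting) image_eqI mem_Collect_eq)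
      fix g assume "g \<in> K"
      then obtain \<sigma> where \<sigma>: "\<sigma> permutes {..<n}" "g = \<kappa> \<sigma>" by (auto simp: K_def)
      show "\<exists>h\<in>K. \<forall>u\<in>S. h (g u) = u"
        using \<sigma> \<kappa>inv(1) permutes_inv[OF \<sigma>(1)] by (auto simp: K_def)
      fix h assume "h \<in> K"
      then obtain \<tau> where \<tau>: "\<tau> permutes {..<n}" "h = \<kappa> \<tau>" by (auto simp: K_def)
      have "compose S g h = \<kappa> (\<tau> \<circ> \<sigma>)"
      proof
        fix u show "compose S g h u = \<kappa> (\<tau> \<circ> \<sigma>) u"
          using \<kappa>\<kappa>[OF \<sigma>(1) \<tau>(1), of u] \<sigma>(2) \<tau>(2) by (cases "u \<in> S") (auto simp: compose_def \<kappa>_def)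
      qed
      then show "compose S g h \<in> K" using permutes_compose[OF \<sigma>(1) \<tau>(1)] by (auto simp: K_def)
    qed
    show "homeomorphic_map P P g" if "g \<in> K" for g
    proof -
      obtain \<sigma> where \<sigma>: "\<sigma> permutes {..<n}" "g = \<kappa> \<sigma>" using \<open>g \<in> K\<close> by (auto simp: K_def)
      have "homeomorphic_maps P P (\<kappa> \<sigma>) (\<kappa> (inv_into UNIV \<sigma>))"
        unfolding homeomorphic_maps_def tsP
        using contP \<sigma>(1) permutes_inv[OF \<sigma>(1)] \<kappa>inv[OF \<sigma>(1)] by blast
      then show ?thesis using \<sigma>(2) homeomorphic_map_maps by blast
    qed
    show "g = (\<lambda>u\<in>topspace P. u)" if g: "g \<in> K" and u: "u \<in> topspace P" "g u = u" for g u
    proof -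
      obtain \<sigma> where \<sigma>: "\<sigma> permutes {..<n}" "g = \<kappa> \<sigma>" using g by (auto simp: K_def)
      have uS: "u \<in> S" using u(1) tsP by simp
      have "\<sigma> i = i" for i
      proof (cases "i < n")
        case True
        have "u (\<sigma> i) = u i" using fun_cong[OF u(2), of i] \<sigma>(2) uS True by (simp add: \<kappa>_def)
        then show ?thesis using bij[OF uS] pl[OF \<sigma>(1) True] True by (auto simp: bij_betw_def dest: inj_onD)
      next
        case False
        then show ?thesis using \<sigma>(1) by (simp add: permutes_def)
      qed
      then have "\<sigma> = id" by auto
      then show ?thesis using \<sigma>(2) \<kappa>id unfolding tsP by (auto simp: fun_eq_iff \<kappa>_def)
    qed
    show "orbit_map (topspace P) K \<pi> (topspace X)"
      unfolding orbit_map_def tsP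
    proof (intro conjI ballI)
      have "fibre_card_ge n = \<pi> ` S" by (simp add: fibre_card_ge_def \<pi>_def S_def)
      moreover have "z \<in> fibre_card_ge n" if "z \<in> topspace X" for z
        unfolding fibre_card_ge_iff[OF n] using card[OF that] finite_fibre by blast
      moreover have "\<pi> ` S \<subseteq> topspace X" using uT n surj by (metis image_subsetI imageI)
      ultimately show "\<pi> ` S = topspace X" by blast
      fix u u' assume u: "u \<in> S" "u' \<in> S"
      show "\<pi> u = \<pi> u' \<longleftrightarrow> (\<exists>g\<in>K. u' = g u)"
      proof
        assume eq: "\<pi> u = \<pi> u'"
        let ?v = "inv_into {..<n} u"
        define \<sigma> where "\<sigma> = (\<lambda>i. if i < n then ?v (u' i) else i)"
        have "bij_betw (?v \<circ> u') {..<n} {..<n}"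
          using bij_betw_trans[OF bij[OF u(2)] bij_betw_inv_into[OF bij[OF u(1), unfolded eq]]] .
        then have "bij_betw \<sigma> {..<n} {..<n}"
          by (rule bij_betw_cong[THEN iffD1, rotated]) (simp add: \<sigma>_def)
        then have \<sigma>: "\<sigma> permutes {..<n}" by (rule bij_imp_permutes) (simp add: \<sigma>_def)
        have "u (\<sigma> i) = u' i" if "i < n" for i
          using bij_betw_inv_into_right[OF bij[OF u(1)], of "u' i"] bij[OF u(2)] that eq
          by (auto simp: \<sigma>_def bij_betw_def)
        then have "\<kappa> \<sigma> u = u'" using u ext[OF u(2)] by (auto simp: \<kappa>_def fun_eq_iff extensional_def)
        then show "\<exists>g\<in>K. u' = g u" using \<sigma> by (auto simp: K_def)
      next
        assume "\<exists>g\<in>K. u' = g u"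
        then obtain \<sigma> where \<sigma>: "\<sigma> permutes {..<n}" "u' = \<kappa> \<sigma> u" by (auto simp: K_def)
        then have "u' 0 = u (\<sigma> 0)" using u n by (simp add: \<kappa>_def)
        then show "\<pi> u = \<pi> u'" using uT(2)[OF u(1) pl[OF \<sigma>(1) n]] by (simp add: \<pi>_def)
      qed
    qed
  qed
  then interpret A: free_finite_action P K \<pi> X .
  have "x \<in> fibre_card_ge n" unfolding fibre_card_ge_iff[OF n] using finite_fibre by (auto simp: n_def)
  then obtain u where u: "u \<in> S" "\<pi> u = x" by (auto simp: fibre_card_ge_def S_def \<pi>_def)
  obtain C L where C: "closedin P C" "u \<in> C" "connected_space (subtopology P C)"
    "regular_covering_map (subtopology P C) L \<pi> X"
    using A.connected_piece[of u] X u(1) tsP by (auto simp: continuum_def)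
  have CS: "C \<subseteq> S" using closedin_subset[OF C(1)] tsP by simp
  \<comment> \<open>evaluation at an index where the chosen enumeration has the value \<open>t\<close> is the map to \<open>T\<close>\<close>
  obtain i where i: "i < n" "u i = t"
    using bij[OF u(1)] \<open>t \<in> fibre x\<close> u(2) unfolding bij_betw_def by (metis imageE lessThan_iff)
  have "metrizable_space (tuple_space n)"
    using metr by (auto simp: metrizable_space_product_topology)
  then have "continuum (subtopology P C)"
    using C(1,3) A.compact unfolding continuum_def P_def
    by (simp add: metrizable_space_subtopology closedin_compact_space compact_space_subtopology)
  then have "continuum_cover X (Covering (subtopology P C) \<pi> L)"
    using C(4) by (simp add: continuum_cover_def)
  moreover have "continuous_map (subtopology P C) T (\<lambda>u. u i)"
    unfolding P_def using i(1)
    by (intro continuous_map_from_subtopology continuous_map_product_projection) auto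
  ultimately show thesis
    using that[of "Covering (subtopology P C) \<pi> L" u "\<lambda>u. u i"] C(2) CS tsP uT(2) i by auto
qed

end

section \<open>Pro-coverings\<close>

text \<open>The last two conditions say that the relation is clopen in the fibre product of \<^term>\<open>Z\<close> with itself,
  which is closed in \<open>Z \<times> Z\<close> if the base is a Hausdorff space.\<close>

definition clopen_relation :: "'z topology \<Rightarrow> ('z \<Rightarrow> 'a) \<Rightarrow> ('z \<times> 'z) set \<Rightarrow> bool" where
  "clopen_relation Z \<phi> R \<longleftrightarrow>
     equiv (topspace Z) R \<and> R \<subseteq> kernel_pair Z \<phi> \<and>
     closedin (prod_topology Z Z) R \<and> closedin (prod_topology Z Z) (kernel_pair Z \<phi> - R)"

text \<open>Each of these relations gives a finite covering of \<^term>\<open>X\<close> (\<open>quotient_finite_covering\<close> below),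
  and the condition on neighbourhoods of the diagonal says that \<^term>\<open>Z\<close> is the limit of these
  coverings.\<close>

definition pro_covering :: "'z topology \<Rightarrow> 'a topology \<Rightarrow> ('z \<Rightarrow> 'a) \<Rightarrow> bool" where
  "pro_covering Z X \<phi> \<longleftrightarrow>
     compact_space Z \<and> Hausdorff_space Z \<and>
     continuous_map Z X \<phi> \<and> open_map Z X \<phi> \<and> \<phi> ` topspace Z = topspace X \<and>
     (\<forall>U. openin (prod_topology Z Z) U \<and> (\<forall>z\<in>topspace Z. (z, z) \<in> U) \<longrightarrow>
        (\<exists>R. clopen_relation Z \<phi> R \<and> R \<subseteq> U))"

lemma clopen_relation_separating:
  assumes "pro_covering Z X \<phi>" "z \<in> topspace Z" "z' \<in> topspace Z" "z \<noteq> z'"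
  obtains R where "clopen_relation Z \<phi> R" "(z, z') \<notin> R"
proof -
  let ?U = "topspace (prod_topology Z Z) - {(z, z')}"
  have "Hausdorff_space (prod_topology Z Z)"
    using assms(1) by (simp add: pro_covering_def Hausdorff_space_prod_topology)
  then have "closedin (prod_topology Z Z) {(z, z')}"
    using assms(2,3) by (simp add: closedin_Hausdorff_singleton)
  then have "openin (prod_topology Z Z) ?U" by blast
  moreover have "\<forall>w\<in>topspace Z. (w, w) \<in> ?U" using assms(4) by auto
  ultimately obtain R where "clopen_relation Z \<phi> R" "R \<subseteq> ?U"
    using assms(1) unfolding pro_covering_def by meson
  then show thesis using that by blast
qed

text \<open>Two lifts are related by a given clopen relation on a clopen set, and the clopen relations
  separate points.\<close>

lemma pro_covering_lift_unique:
  assumes pc: "pro_covering Z X \<phi>" and S: "connected_space S"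
    and u: "continuous_map S Z u" and v: "continuous_map S Z v"
    and over: "\<And>s. s \<in> topspace S \<Longrightarrow> \<phi> (u s) = \<phi> (v s)"
    and s0: "s0 \<in> topspace S" "u s0 = v s0" and s: "s \<in> topspace S"
  shows "u s = v s"
proof (rule ccontr)
  assume ne: "u s \<noteq> v s"
  have uZ: "u t \<in> topspace Z" "v t \<in> topspace Z" if "t \<in> topspace S" for t
    using u v that by (auto simp: continuous_map_def)
  obtain R where R: "clopen_relation Z \<phi> R" "(u s, v s) \<notin> R"
    using clopen_relation_separating[OF pc uZ[OF s] ne] by blast
  have uv: "continuous_map S (prod_topology Z Z) (\<lambda>t. (u t, v t))"
    using u v by (rule continuous_map_pairedI)
  let ?A = "{t \<in> topspace S. (u t, v t) \<in> R}"
  let ?B = "{t \<in> topspace S. (u t, v t) \<in> kernel_pair Z \<phi> - R}"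
  have "?A = topspace S"
  proof (rule connected_space_two_closed[OF S])
    show "closedin S ?A" "closedin S ?B"
      using closedin_continuous_map_preimage[OF uv] R(1) unfolding clopen_relation_def by blast+
    show "?A \<inter> ?B = {}" by blast
    show "?A \<union> ?B = topspace S" using uZ over by (auto simp: kernel_pair_def)
    have "(u s0, v s0) \<in> R"
      using R(1) uZ(1)[OF s0(1)] s0(2) unfolding clopen_relation_def equiv_def refl_on_def by metis
    then show "?A \<noteq> {}" using s0(1) by blast
  qed
  then show False using s R(2) by blast
qed

text \<open>Here equality is itself a clopen relation.\<close>

lemma locally_injective_imp_pro_covering:
  assumes "compact_space Z" "Hausdorff_space Z" "Hausdorff_space X" "continuous_map Z X \<phi>"
    "open_map Z X \<phi>" "\<phi> ` topspace Z = topspace X" "locally_injective Z \<phi>"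
  shows "pro_covering Z X \<phi>"
proof -
  have "closedin (prod_topology Z Z) (Id_on (topspace Z))"
    using Hausdorff_space_closedin_diagonal[of Z] assms(2)
    by (simp add: Id_on_def UNION_singleton_eq_range)
  moreover have "kernel_pair Z \<phi> - Id_on (topspace Z) = kernel_pair Z \<phi> - Id"
    by (auto simp: kernel_pair_def)
  ultimately have "clopen_relation Z \<phi> (Id_on (topspace Z))"
    using closedin_kernel_pair_diff_Id[OF assms(4,3,7)]
    by (auto simp: clopen_relation_def kernel_pair_def equiv_def refl_on_def sym_def trans_def)
  then show ?thesis
    unfolding pro_covering_def using assms by (auto intro!: exI[of _ "Id_on (topspace Z)"])
qed

lemma covering_map_open_map:
  assumes "covering_map Y X f"
  shows "open_map Y X f"
  unfolding open_map_def
proof (intro allI impI)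
  fix O' assume O': "openin Y O'"
  have "\<exists>W. openin X W \<and> x \<in> W \<and> W \<subseteq> f ` O'" if "x \<in> f ` O'" for x
  proof -
    obtain y where y: "y \<in> O'" "x = f y" using \<open>x \<in> f ` O'\<close> by blast
    have yY: "y \<in> topspace Y" using O' y openin_subset by blast
    then have "x \<in> topspace X" using assms y by (auto simp: covering_map_def)
    then obtain T \<V> where T: "openin X T" "x \<in> T" "\<Union>\<V> = {y \<in> topspace Y. f y \<in> T}"
      "\<And>V. V \<in> \<V> \<Longrightarrow> homeomorphic_map (subtopology Y V) (subtopology X T) f"
      using assms unfolding covering_map_def by meson
    then obtain V where V: "V \<in> \<V>" "y \<in> V" using yY y by blast
    have "openin (subtopology Y V) (O' \<inter> V)" using O' by (auto simp: openin_subtopology)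
    then have "openin (subtopology X T) (f ` (O' \<inter> V))"
      using homeomorphic_imp_open_map[OF T(4)[OF V(1)]] unfolding open_map_def by blast
    then have "openin X (f ` (O' \<inter> V))" using T(1) openin_trans_full by blast
    then show ?thesis using y V(2) by blast
  qed
  then show "openin X (f ` O')" by (subst openin_subopen) blast
qed

lemma covering_map_locally_injective:
  assumes "covering_map Y X f"
  shows "locally_injective Y f"
  unfolding locally_injective_def
proof
  fix y assume y: "y \<in> topspace Y"
  then have "f y \<in> topspace X" using assms by (auto simp: covering_map_def)
  then obtain T \<V> where T: "f y \<in> T" "\<Union>\<V> = {y \<in> topspace Y. f y \<in> T}" "\<And>V. V \<in> \<V> \<Longrightarrow> openin Y V"
    "\<And>V. V \<in> \<V> \<Longrightarrow> homeomorphic_map (subtopology Y V) (subtopology X T) f"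
    using assms unfolding covering_map_def by meson
  then obtain V where V: "V \<in> \<V>" "y \<in> V" using y by blast
  have "V \<subseteq> topspace Y" using T(3)[OF V(1)] openin_subset by blast
  then have "inj_on f V"
    using homeomorphic_imp_injective_map[OF T(4)[OF V(1)]] by (simp add: Int_absorb1)
  then show "\<exists>V. openin Y V \<and> y \<in> V \<and> inj_on f V" using T(3) V by blast
qed

lemma continuum_coverD:
  assumes "continuum_cover X C"
  shows "compact_space (cov_space C)" "connected_space (cov_space C)" "metrizable_space (cov_space C)"
    "Hausdorff_space (cov_space C)" "continuous_map (cov_space C) X (cov_map C)"
    "open_map (cov_space C) X (cov_map C)" "cov_map C ` cov_points C = topspace X"
    "locally_injective (cov_space C) (cov_map C)"
    "subgroup (cov_group C) (BijGroup (cov_points C))"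
    "\<And>g. g \<in> cov_group C \<Longrightarrow> homeomorphic_map (cov_space C) (cov_space C) g"
    "\<And>g y. g \<in> cov_group C \<Longrightarrow> y \<in> cov_points C \<Longrightarrow> g y = y \<Longrightarrow> g = (\<lambda>y\<in>cov_points C. y)"
    "\<And>y y'. y \<in> cov_points C \<Longrightarrow> y' \<in> cov_points C \<Longrightarrow>
       cov_map C y = cov_map C y' \<longleftrightarrow> (\<exists>g\<in>cov_group C. y' = g y)"
proof -
  have C: "continuum (cov_space C)" "covering_map (cov_space C) X (cov_map C)"
      "regular_covering_map (cov_space C) (cov_group C) (cov_map C) X"
    using assms by (auto simp: continuum_cover_def regular_covering_map_def)
  show "compact_space (cov_space C)" "connected_space (cov_space C)" "metrizable_space (cov_space C)"
    "Hausdorff_space (cov_space C)"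
    using C(1) metrizable_imp_Hausdorff_space by (auto simp: continuum_def)
  show "continuous_map (cov_space C) X (cov_map C)" "cov_map C ` cov_points C = topspace X"
    using C(2) by (simp_all add: covering_map_def)
  show "open_map (cov_space C) X (cov_map C)" "locally_injective (cov_space C) (cov_map C)"
    using C(2) by (simp_all add: covering_map_open_map covering_map_locally_injective)
  show "subgroup (cov_group C) (BijGroup (cov_points C))"
    "\<And>g. g \<in> cov_group C \<Longrightarrow> homeomorphic_map (cov_space C) (cov_space C) g"
    "\<And>y y'. y \<in> cov_points C \<Longrightarrow> y' \<in> cov_points C \<Longrightarrow>
       cov_map C y = cov_map C y' \<longleftrightarrow> (\<exists>g\<in>cov_group C. y' = g y)"
    using C(3) unfolding regular_covering_map_def orbit_map_def by simp_all
  show "\<And>g y. g \<in> cov_group C \<Longrightarrow> y \<in> cov_points C \<Longrightarrow> g y = y \<Longrightarrow> g = (\<lambda>y\<in>cov_points C. y)"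
    using C(3) unfolding regular_covering_map_def by (auto simp: BijGroup_def)
qed

lemma continuum_cover_pro_covering:
  assumes "Hausdorff_space X" "continuum_cover X C"
  shows "pro_covering (cov_space C) X (cov_map C)"
  using locally_injective_imp_pro_covering continuum_coverD[OF assms(2)] assms(1) by blast

subsection \<open>Composition with a covering\<close>

lemma positive_distance_from_diagonal:
  assumes "Metric_space M d" and Z: "Z = Metric_space.mtopology M d" and "compact_space Z"
    and W: "closedin (prod_topology Z Z) W" and off: "\<And>z. (z, z) \<notin> W"
  obtains \<delta> :: real where "\<delta> > 0" "\<And>z z'. (z, z') \<in> W \<Longrightarrow> d z z' \<ge> \<delta>"
proof (cases "W = {}")
  case True
  then show thesis using that[of 1] by simp
next
  case False
  interpret Metric_space M d by fact
  have ts: "topspace Z = M" by (simp add: Z)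
  have "continuous_map (prod_topology Z Z) euclidean (\<lambda>p. d (fst p) (snd p))"
    using continuous_map_mdist[of "prod_topology Z Z" "metric (M, d)" fst snd]
    by (simp add: Z mtopology_of continuous_map_fst continuous_map_snd)
  moreover have "compactin (prod_topology Z Z) W"
    using W assms(3) by (intro closedin_compact_space) (auto simp: compact_space_prod_topology)
  ultimately have "compactin euclidean ((\<lambda>p. d (fst p) (snd p)) ` W)"
    by (rule image_compactin[rotated])
  then have "compact ((\<lambda>p. d (fst p) (snd p)) ` W)" by simp
  then obtain p where p: "p \<in> W" "\<And>w. w \<in> W \<Longrightarrow> d (fst p) (snd p) \<le> d (fst w) (snd w)"
    using compact_attains_inf[of "(\<lambda>p. d (fst p) (snd p)) ` W"] False by blast
  have "fst p \<in> M" "snd p \<in> M" using closedin_subset[OF W] p(1) ts by auto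
  moreover have "fst p \<noteq> snd p" using off[of "fst p"] p(1) by (metis prod.collapse)
  ultimately have "d (fst p) (snd p) > 0" by simp
  then show thesis using that[of "d (fst p) (snd p)"] p(2) by force
qed

lemma openin_image_second_coordinate:
  assumes "open_map Z Y p" "openin (prod_topology W Z) O'"
  shows "openin (prod_topology W Y) ((\<lambda>(w, z). (w, p z)) ` O')"
  unfolding openin_prod_topology_alt
proof (intro allI impI)
  fix w y assume "(w, y) \<in> (\<lambda>(w, z). (w, p z)) ` O'"
  then obtain z where z: "(w, z) \<in> O'" "y = p z" by auto
  then obtain A B where AB: "openin W A" "openin Z B" "w \<in> A" "z \<in> B" "A \<times> B \<subseteq> O'"
    using assms(2) unfolding openin_prod_topology_alt by meson
  show "\<exists>U V. openin W U \<and> openin Y V \<and> w \<in> U \<and> y \<in> V \<and> U \<times> V \<subseteq> (\<lambda>(w, z). (w, p z)) ` O'"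
  proof (intro exI conjI)
    show "openin Y (p ` B)" using assms(1) AB(2) unfolding open_map_def by blast
    show "A \<times> p ` B \<subseteq> (\<lambda>(w, z). (w, p z)) ` O'" using AB(5) by force
  qed (use AB z in auto)
qed

text \<open>A clopen relation \<^term>\<open>R'\<close> on \<^term>\<open>Y\<close> is lifted by relating points of \<^term>\<open>Z\<close> at distance less
  than \<^term>\<open>\<epsilon>\<close> that lie over \<^term>\<open>R'\<close>-related points. If distinct points of a fibre of \<^term>\<open>p\<close> are at
  least \<open>4\<epsilon>\<close> apart and \<^term>\<open>R'\<close> is small, then points over \<^term>\<open>R'\<close>-related points at distance less
  than \<open>3\<epsilon>\<close> are at distance less than \<^term>\<open>\<epsilon>\<close> (the fact \<open>shrink\<close> in the proof). This
  gap in the distances makes the lifted relation both transitive and clopen.\<close>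

lemma pro_covering_compose:
  assumes pc: "pro_covering Y X f"
    and Z: "compact_space Z" "metrizable_space Z"
    and p: "continuous_map Z Y p" "open_map Z Y p" "p ` topspace Z = topspace Y" "locally_injective Z p"
  shows "pro_covering Z X (f \<circ> p)"
proof -
  have HZ: "Hausdorff_space Z" using Z(2) metrizable_imp_Hausdorff_space by blast
  have Y: "compact_space Y" "Hausdorff_space Y" and f: "continuous_map Y X f" "open_map Y X f" "f ` topspace Y = topspace X"
    using pc by (auto simp: pro_covering_def)
  obtain M d where M: "Metric_space M d" and ZM: "Z = Metric_space.mtopology M d"
    using Z(2) unfolding metrizable_space_def by blast
  interpret Metric_space M d by fact
  have ts: "topspace Z = M" by (simp add: ZM)
  have pM: "p z \<in> topspace Y" if "z \<in> M" for z using p(3) ts that by blast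
  have dcont: "continuous_map (prod_topology Z Z) euclidean (\<lambda>q. d (fst q) (snd q))"
    using continuous_map_mdist[of "prod_topology Z Z" "metric (M, d)" fst snd]
    by (simp add: ZM mtopology_of continuous_map_fst continuous_map_snd)
  have pp: "continuous_map (prod_topology Z Z) (prod_topology Y Y) (\<lambda>q. (p (fst q), p (snd q)))"
    using continuous_map_pairedI[OF continuous_map_compose[OF continuous_map_fst p(1)]
      continuous_map_compose[OF continuous_map_snd p(1)]] by (simp add: comp_def)
  have "\<exists>R. clopen_relation Z (f \<circ> p) R \<and> R \<subseteq> U"
    if U: "openin (prod_topology Z Z) U" "\<forall>z\<in>topspace Z. (z, z) \<in> U" for U
  proof -
    define W where "W = (topspace (prod_topology Z Z) - U) \<union> (kernel_pair Z p - Id)"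
    have "closedin (prod_topology Z Z) W"
      unfolding W_def using U(1) closedin_kernel_pair_diff_Id[OF p(1) Y(2) p(4)] by blast
    moreover have "(z, z) \<notin> W" for z using U(2) by (auto simp: W_def)
    ultimately obtain \<delta> where \<delta>: "\<delta> > 0" "\<And>z z'. (z, z') \<in> W \<Longrightarrow> d z z' \<ge> \<delta>"
      using positive_distance_from_diagonal[OF M ZM Z(1)] by metis
    define \<epsilon> where "\<epsilon> = \<delta> / 4"
    have \<epsilon>: "\<epsilon> > 0" using \<delta>(1) by (simp add: \<epsilon>_def)
    have near: "(z, z') \<in> U" if "z \<in> M" "z' \<in> M" "d z z' < \<epsilon>" for z z'
      using \<delta>(2)[of z z'] \<epsilon> that ts unfolding W_def \<epsilon>_def by force
    have eq: "z = z'" if "z \<in> M" "z' \<in> M" "p z = p z'" "d z z' < 4 * \<epsilon>" for z z'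
      using \<delta>(2)[of z z'] that ts unfolding W_def \<epsilon>_def kernel_pair_def by force
    \<comment> \<open>\<open>F\<close> consists of the pairs \<open>(y, y')\<close> such that each point over \<open>y\<close> is within \<open>\<epsilon>\<close> of a point over \<open>y'\<close>\<close>
    define O' where "O' = {q \<in> topspace (prod_topology Z Z). d (fst q) (snd q) \<in> {..<\<epsilon>}}"
    define Bad where "Bad = topspace (prod_topology Z Y) - (\<lambda>(w, z). (w, p z)) ` O'"
    define F where "F = topspace (prod_topology Y Y) - (\<lambda>(w, y). (p w, y)) ` Bad"
    have "openin (prod_topology Z Z) O'"
      unfolding O'_def using openin_continuous_map_preimage[OF dcont, of "{..<\<epsilon>}"] by simp
    then have "closedin (prod_topology Z Y) Bad"
      unfolding Bad_def using openin_image_second_coordinate[OF p(2)] by blast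
    moreover have "closed_map (prod_topology Z Y) (prod_topology Y Y) (\<lambda>(w, y). (p w, y))"
    proof (rule continuous_imp_closed_map)
      show "continuous_map (prod_topology Z Y) (prod_topology Y Y) (\<lambda>(w, y). (p w, y))"
        using p(1) by (simp add: continuous_map_prod_top)
      show "compact_space (prod_topology Z Y)" using Z(1) Y(1) by (simp add: compact_space_prod_topology)
      show "Hausdorff_space (prod_topology Y Y)" using Y(2) by (simp add: Hausdorff_space_prod_topology)
    qed
    ultimately have opF: "openin (prod_topology Y Y) F"
      unfolding F_def closed_map_def by blast
    have inBad: "(z, y') \<in> Bad \<longleftrightarrow> z \<in> M \<and> y' \<in> topspace Y \<and> \<not> (\<exists>z'\<in>M. p z' = y' \<and> d z z' < \<epsilon>)" for z y'
      unfolding Bad_def O'_def using ts by (auto simp: image_iff)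
    have "(y, y) \<in> F" if y: "y \<in> topspace Y" for y
    proof (rule ccontr)
      assume "(y, y) \<notin> F"
      then obtain z where "(z, y) \<in> Bad" "p z = y" using y by (auto simp: F_def)
      then show False using \<epsilon> unfolding inBad by (metis mdist_zero)
    qed
    then obtain R' where R': "clopen_relation Y f R'" "R' \<subseteq> F"
      using pc opF unfolding pro_covering_def by meson
    have eR': "equiv (topspace Y) R'" using R'(1) by (simp add: clopen_relation_def)
    have shrink: "d z z' < \<epsilon>" if z: "z \<in> M" "z' \<in> M" "(p z, p z') \<in> R'" "d z z' < 3 * \<epsilon>" for z z'
    proof -
      have "(z, p z') \<notin> Bad" using R'(2) z(3) by (force simp: F_def)
      then obtain w where w: "w \<in> M" "p w = p z'" "d z w < \<epsilon>" using z(1,2) pM inBad by blast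
      have "d w z' < 4 * \<epsilon>" using triangle[of w z z'] commute[of z w] w z by linarith
      then show ?thesis using eq[of w z'] w z(2) by simp
    qed
    define R where "R = {(z, z'). z \<in> M \<and> z' \<in> M \<and> (p z, p z') \<in> R' \<and> d z z' < \<epsilon>}"
    have "clopen_relation Z (f \<circ> p) R"
      unfolding clopen_relation_def
    proof (intro conjI)
      show "equiv (topspace Z) R"
      proof (rule equivI)
        show "R \<subseteq> topspace Z \<times> topspace Z" by (auto simp: R_def ts)
        show "refl_on (topspace Z) R"
          using eR' pM \<epsilon> by (auto simp: refl_on_def R_def ts equiv_def)
        show "sym R" using eR' commute by (auto simp: sym_def R_def equiv_def)
        show "trans R"
        proof (rule transI)
          fix a b c assume ab: "(a, b) \<in> R" and bc: "(b, c) \<in> R"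
          then have "(p a, p c) \<in> R'" using eR' unfolding R_def equiv_def by (blast dest: transD)
          moreover have "d a c < 3 * \<epsilon>" using ab bc triangle[of a b c] \<epsilon> unfolding R_def by auto
          ultimately show "(a, c) \<in> R" using shrink[of a c] ab bc unfolding R_def by blast
        qed
      qed
      have R'K: "R' \<subseteq> kernel_pair Y f" using R'(1) by (simp add: clopen_relation_def)
      then show "R \<subseteq> kernel_pair Z (f \<circ> p)" by (auto simp: R_def kernel_pair_def ts)
      let ?P = "prod_topology Z Z"
      have clR': "closedin ?P {q \<in> topspace ?P. (p (fst q), p (snd q)) \<in> R'}"
        and clK: "closedin ?P {q \<in> topspace ?P. (p (fst q), p (snd q)) \<in> kernel_pair Y f - R'}"
        using R'(1) closedin_continuous_map_preimage[OF pp] unfolding clopen_relation_def by blast+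
      have cl1: "closedin ?P {q \<in> topspace ?P. d (fst q) (snd q) \<in> {..\<epsilon>}}"
        and cl2: "closedin ?P {q \<in> topspace ?P. d (fst q) (snd q) \<in> {\<epsilon>..}}"
        by (rule closedin_continuous_map_preimage[OF dcont], simp)+
      have "R = {q \<in> topspace ?P. (p (fst q), p (snd q)) \<in> R'} \<inter> {q \<in> topspace ?P. d (fst q) (snd q) \<in> {..\<epsilon>}}"
        using shrink \<epsilon> unfolding R_def by (force simp: ts)
      then show "closedin ?P R" using closedin_Int[OF clR' cl1] by simp
      have "kernel_pair Z (f \<circ> p) - R = {q \<in> topspace ?P. (p (fst q), p (snd q)) \<in> kernel_pair Y f - R'} \<union>
         ({q \<in> topspace ?P. (p (fst q), p (snd q)) \<in> R'} \<inter> {q \<in> topspace ?P. d (fst q) (snd q) \<in> {\<epsilon>..}})"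
        using R'K pM unfolding R_def by (auto simp: ts kernel_pair_def)
      then show "closedin ?P (kernel_pair Z (f \<circ> p) - R)" 
        using closedin_Un[OF clK closedin_Int[OF clR' cl2]] by simp
    qed
    moreover have "R \<subseteq> U" using near by (auto simp: R_def)
    ultimately show ?thesis by blast
  qed
  moreover have "(f \<circ> p) ` topspace Z = topspace X" using p(3) f(3) by (metis image_comp)
  ultimately show ?thesis
    unfolding pro_covering_def
    using Z(1) HZ continuous_map_compose[OF p(1) f(1)] open_map_compose[OF p(2) f(2)] by blast
qed

subsection \<open>Generalized regular covering maps\<close>

lemma uniformity_ofD:
  assumes u: "uniformity_of Y \<E>"
  shows "\<exists>E. E \<in> \<E>"
    and "\<And>E. E \<in> \<E> \<Longrightarrow> E \<subseteq> topspace Y \<times> topspace Y"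
    and "\<And>E y. E \<in> \<E> \<Longrightarrow> y \<in> topspace Y \<Longrightarrow> (y, y) \<in> E"
    and "\<And>E a b. E \<in> \<E> \<Longrightarrow> (a, b) \<in> E \<Longrightarrow> (b, a) \<in> E"
    and "\<And>E F. E \<in> \<E> \<Longrightarrow> F \<in> \<E> \<Longrightarrow> E \<inter> F \<in> \<E>"
    and "\<And>E. E \<in> \<E> \<Longrightarrow> \<exists>F\<in>\<E>. F O F \<subseteq> E"
    and "\<And>U y. openin Y U \<Longrightarrow> y \<in> U \<Longrightarrow> \<exists>E\<in>\<E>. E `` {y} \<subseteq> U"
    and "\<And>U. U \<subseteq> topspace Y \<Longrightarrow> (\<And>y. y \<in> U \<Longrightarrow> \<exists>E\<in>\<E>. E `` {y} \<subseteq> U) \<Longrightarrow> openin Y U"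
proof -
  have *: "\<E> \<noteq> {}" "\<forall>E\<in>\<E>. E \<subseteq> topspace Y \<times> topspace Y \<and> Id_on (topspace Y) \<subseteq> E \<and> sym E"
    "\<forall>E\<in>\<E>. \<forall>F\<in>\<E>. E \<inter> F \<in> \<E>" "\<forall>E\<in>\<E>. \<exists>F\<in>\<E>. F O F \<subseteq> E"
    "\<forall>U. openin Y U \<longleftrightarrow> U \<subseteq> topspace Y \<and> (\<forall>x\<in>U. \<exists>E\<in>\<E>. E `` {x} \<subseteq> U)"
    using u unfolding uniformity_of_def by - (elim conjE, assumption)+
  show "\<exists>E. E \<in> \<E>" using *(1) by blast
  show "E \<subseteq> topspace Y \<times> topspace Y" if "E \<in> \<E>" for E using *(2) that by simp
  show "(y, y) \<in> E" if "E \<in> \<E>" "y \<in> topspace Y" for E y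
    using *(2)[rule_format, OF that(1)] that(2) by (meson Id_onI subsetD)
  show "(b, a) \<in> E" if "E \<in> \<E>" "(a, b) \<in> E" for E a b
    using *(2)[rule_format, OF that(1)] that(2) by (meson symD)
  show "E \<inter> F \<in> \<E>" if "E \<in> \<E>" "F \<in> \<E>" for E F using *(3) that by simp
  show "\<exists>F\<in>\<E>. F O F \<subseteq> E" if "E \<in> \<E>" for E using *(4) that by simp
  show "\<exists>E\<in>\<E>. E `` {y} \<subseteq> U" if "openin Y U" "y \<in> U" for U y using *(5) that by simp
  show "openin Y U" if "U \<subseteq> topspace Y" "\<And>y. y \<in> U \<Longrightarrow> \<exists>E\<in>\<E>. E `` {y} \<subseteq> U" for U
    using *(5) that by simp
qed

lemma uniformity_neighbourhood:
  assumes u: "uniformity_of Y \<E>" and E: "E \<in> \<E>" and y: "y \<in> topspace Y"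
  obtains A where "openin Y A" "y \<in> A" "A \<subseteq> E `` {y}"
proof -
  note U = uniformity_ofD[OF u]
  define A where "A = {x \<in> topspace Y. \<exists>F\<in>\<E>. F `` {x} \<subseteq> E `` {y}}"
  have "\<exists>F\<in>\<E>. F `` {x} \<subseteq> A" if x: "x \<in> A" for x
  proof -
    obtain F where F: "F \<in> \<E>" "F `` {x} \<subseteq> E `` {y}" using x by (auto simp: A_def)
    obtain D where D: "D \<in> \<E>" "D O D \<subseteq> F" using U(6)[OF F(1)] by blast
    note U(2)[OF D(1)]
    moreover have "D `` {w} \<subseteq> E `` {y}" if "w \<in> D `` {x}" for w
      using that D(2) F(2) by blast
    ultimately have "D `` {x} \<subseteq> A" using D(1) by (auto simp: A_def)
    then show ?thesis using D(1) by blast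
  qed
  moreover have "A \<subseteq> topspace Y" by (auto simp: A_def)
  ultimately have "openin Y A" by (intro U(8))
  moreover have "y \<in> A" using E y by (auto simp: A_def)
  moreover have "A \<subseteq> E `` {y}" using U(3) unfolding A_def by blast
  ultimately show thesis using that by blast
qed

lemma uniformity_finite_Inter:
  assumes u: "uniformity_of Y \<E>" and "finite D" "D \<noteq> {}" "\<And>y. y \<in> D \<Longrightarrow> F y \<in> \<E>"
  shows "(\<Inter>y\<in>D. F y) \<in> \<E>"
  using assms(2-4)
proof (induction D rule: finite_ne_induct)
  case (insert y D)
  then show ?case using uniformity_ofD(5)[OF u] by simp
qed simp

text \<open>This is one half of the uniqueness of the uniformity of a compact space: around each point an
  entourage can be chosen with its double inside the given set, and finitely many points suffice.\<close>

lemma uniformity_inside_neighbourhood_of_diagonal: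
  assumes u: "uniformity_of Y \<E>" and Y: "compact_space Y"
    and U: "openin (prod_topology Y Y) U" "\<And>y. y \<in> topspace Y \<Longrightarrow> (y, y) \<in> U"
  obtains E where "E \<in> \<E>" "E \<subseteq> U"
proof -
  note un = uniformity_ofD[OF u]
  have "\<exists>F A. F \<in> \<E> \<and> openin Y A \<and> y \<in> A \<and> A \<subseteq> F `` {y} \<and> (F O F) `` {y} \<times> (F O F) `` {y} \<subseteq> U"
    if y: "y \<in> topspace Y" for y
  proof -
    obtain A B where AB: "openin Y A" "openin Y B" "y \<in> A" "y \<in> B" "A \<times> B \<subseteq> U"
      using U y unfolding openin_prod_topology_alt by meson
    then have "openin Y (A \<inter> B)" "y \<in> A \<inter> B" by auto
    then obtain E where E: "E \<in> \<E>" "E `` {y} \<subseteq> A \<inter> B" using un(7) by meson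
    obtain F where F: "F \<in> \<E>" "F O F \<subseteq> E" using un(6)[OF E(1)] by blast
    obtain O' where O': "openin Y O'" "y \<in> O'" "O' \<subseteq> F `` {y}"
      using uniformity_neighbourhood[OF u F(1) y] by blast
    have "(F O F) `` {y} \<subseteq> A \<inter> B" using F(2) E(2) by blast
    then have "(F O F) `` {y} \<times> (F O F) `` {y} \<subseteq> U" using AB(5) by blast
    then show ?thesis using F(1) O' by (intro exI[of _ F] exI[of _ O'] conjI)
  qed
  then obtain F A where FA: "\<And>y. y \<in> topspace Y \<Longrightarrow> F y \<in> \<E> \<and> openin Y (A y) \<and> y \<in> A y \<and>
      A y \<subseteq> F y `` {y} \<and> (F y O F y) `` {y} \<times> (F y O F y) `` {y} \<subseteq> U" by metis
  have "compactin Y (topspace Y)" using Y by (simp add: compact_space_def)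
  then have "\<exists>\<D>. finite \<D> \<and> \<D> \<subseteq> A ` topspace Y \<and> topspace Y \<subseteq> \<Union>\<D>"
  proof (rule compactinD)
    show "topspace Y \<subseteq> \<Union>(A ` topspace Y)" using FA by (intro subsetI UN_I) auto
  qed (use FA in blast)
  then obtain D where D: "finite D" "D \<subseteq> topspace Y" "topspace Y \<subseteq> \<Union>(A ` D)"
    by (metis finite_subset_image)
  show thesis
  proof (cases "D = {}")
    case True
    then have "topspace Y = {}" using D(3) by simp
    moreover obtain E where E: "E \<in> \<E>" using un(1) by blast
    ultimately have "E = {}" using un(2)[OF E] by simp
    then show thesis using that[OF E] by simp
  next
    case False
    define E where "E = (\<Inter>y\<in>D. F y)"
    have E: "E \<in> \<E>" unfolding E_def using uniformity_finite_Inter[OF u D(1) False] FA D(2) by blast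
    have "(a, b) \<in> U" if ab: "(a, b) \<in> E" for a b
    proof -
      have "a \<in> topspace Y" using un(2)[OF E] ab by blast
      then obtain y where y: "y \<in> D" "a \<in> A y" using D(3) by blast
      have yY: "y \<in> topspace Y" using y D(2) by blast
      have "(y, a) \<in> F y" "(a, b) \<in> F y" using FA[OF yY] y ab by (auto simp: E_def)
      moreover have "(y, y) \<in> F y" using un(3) FA[OF yY] yY by blast
      ultimately have "a \<in> (F y O F y) `` {y}" "b \<in> (F y O F y) `` {y}" by blast+
      then show ?thesis using FA[OF yY] by blast
    qed
    then have "E \<subseteq> U" by (rule subrelI)
    then show thesis using that[OF E] by simp
  qed
qed

text \<open>The clopen relations are those of lying in the same orbit of \<open>N\<^sub>F(G)\<close>; prodiscreteness makes them
  small. They are clopen for the following reason. Let \<open>y' = n y\<close> with \<open>n\<close> in \<open>N\<^sub>F(G)\<close>, and let \<open>z\<close>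
  and \<open>z' = g z\<close> be close to \<open>y\<close> and \<open>y'\<close>. As the action is isomorphic, \<open>n z\<close> is close to
  \<open>n y = y'\<close>, hence to \<open>z'\<close>. So \<open>g n\<inverse>\<close> moves the point \<open>n z\<close> only within \<open>F\<close>, which puts it
  into \<open>S\<^sub>F(G)\<close> and \<open>g\<close> into \<open>N\<^sub>F(G)\<close> (the fact \<open>stable\<close> in the proof).\<close>

theorem generalized_regular_covering_map_pro_covering:
  assumes g: "generalized_regular_covering_map Y \<E> G f X \<F>"
    and Y: "compact_space Y" "Hausdorff_space Y" and X: "Hausdorff_space X"
  shows "pro_covering Y X f"
proof -
  let ?S = "topspace Y"
  have uY: "uniformity_of Y \<E>" and uX: "uniformity_of X \<F>" and sub: "subgroup G (BijGroup ?S)"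
    and iso: "acts_isomorphically \<E> G" and prod: "acts_prodiscretely ?S \<E> G"
    and orb: "orbit_map ?S G f (topspace X)" and \<F>: "\<F> = {map_prod f f ` E | E. E \<in> \<E>}"
    using g unfolding generalized_regular_covering_map_def by auto
  note act = subgroup_BijGroup_apply[OF sub]
  have im: "f ` ?S = topspace X" using orb by (simp add: orbit_map_def)
  have fib: "f y = f y' \<longleftrightarrow> (\<exists>g\<in>G. y' = g y)" if "y \<in> ?S" "y' \<in> ?S" for y y'
    using orb that by (simp add: orbit_map_def)
  have ES: "E \<subseteq> ?S \<times> ?S" "sym E" "\<And>y. y \<in> ?S \<Longrightarrow> (y, y) \<in> E" if "E \<in> \<E>" for E
    using uniformity_ofD(2-4)[OF uY that] by (auto intro: symI)
  have inv: "\<exists>F\<in>\<E>. F \<subseteq> E \<and> (\<forall>g\<in>G. \<forall>a b. (a, b) \<in> F \<longrightarrow> (g a, g b) \<in> F)" if "E \<in> \<E>" for E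
  proof -
    have "\<exists>F\<in>\<E>. F \<subseteq> E \<and> (\<forall>g\<in>G. map_prod g g ` F = F)"
      using iso \<open>E \<in> \<E>\<close> unfolding acts_isomorphically_def by (rule bspec)
    then obtain F where F: "F \<in> \<E>" "F \<subseteq> E" "\<And>g. g \<in> G \<Longrightarrow> map_prod g g ` F = F"
      by auto
    have "(g a, g b) \<in> F" if "g \<in> G" "(a, b) \<in> F" for g a b
      using map_prod_imageI[OF that(2), of g g] F(3)[OF that(1)] by simp
    then show ?thesis using F(1,2) by blast
  qed
  have cont: "continuous_map Y X f"
    unfolding continuous_map_def
  proof (intro conjI allI impI)
    show "f \<in> ?S \<rightarrow> topspace X" using im by blast
    fix U assume U: "openin X U"
    have "\<exists>E\<in>\<E>. E `` {y} \<subseteq> {y \<in> ?S. f y \<in> U}" if y: "y \<in> {y \<in> ?S. f y \<in> U}" for y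
    proof -
      obtain F where F: "F \<in> \<F>" "F `` {f y} \<subseteq> U" using uniformity_ofD(7)[OF uX U, of "f y"] y by blast
      then obtain E where E: "E \<in> \<E>" "F = map_prod f f ` E" using \<F> by blast
      have "z \<in> ?S \<and> f z \<in> U" if "(y, z) \<in> E" for z
        using that ES(1)[OF E(1)] F(2) E(2) by force
      then show ?thesis using E(1) by blast
    qed
    then show "openin Y {y \<in> ?S. f y \<in> U}" by (intro uniformity_ofD(8)[OF uY]) auto
  qed
  have opn: "open_map Y X f"
    unfolding open_map_def
  proof (intro allI impI)
    fix V assume V: "openin Y V"
    have VS: "V \<subseteq> ?S" using V openin_subset by blast
    have "\<exists>F\<in>\<F>. F `` {x} \<subseteq> f ` V" if x: "x \<in> f ` V" for x
    proof -
      obtain v where v: "v \<in> V" "x = f v" using x by blast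
      obtain E' where E': "E' \<in> \<E>" "E' `` {v} \<subseteq> V" using uniformity_ofD(7)[OF uY V v(1)] by blast
      obtain E where E: "E \<in> \<E>" "E \<subseteq> E'" "\<forall>g\<in>G. \<forall>a b. (a, b) \<in> E \<longrightarrow> (g a, g b) \<in> E"
        using inv[OF E'(1)] by blast
      have "x' \<in> f ` V" if "(f v, x') \<in> map_prod f f ` E" for x'
      proof -
        obtain a b where ab: "(a, b) \<in> E" "f v = f a" "x' = f b" using \<open>(f v, x') \<in> _\<close> by auto
        then have aS: "a \<in> ?S" "b \<in> ?S" using ES(1)[OF E(1)] by blast+
        then obtain g where gG: "g \<in> G" "v = g a" using fib[of a v] ab(2) VS v(1) by auto
        then have "(v, g b) \<in> E" using E(3) ab(1) by blast
        then have "g b \<in> V" using E(2) E'(2) by blast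
        moreover have "f b = f (g b)" using fib[of b "g b"] aS act(2) gG(1) by blast
        ultimately show ?thesis using ab(3) by blast
      qed
      then have "(map_prod f f ` E) `` {x} \<subseteq> f ` V"
        by (intro subsetI) (simp only: Image_singleton_iff v(2))
      then show ?thesis using \<F> E(1) by blast
    qed
    moreover have "f ` V \<subseteq> topspace X" using VS im by blast
    ultimately show "openin X (f ` V)" by (intro uniformity_ofD(8)[OF uX])
  qed
  have "\<exists>R. clopen_relation Y f R \<and> R \<subseteq> U"
    if U: "openin (prod_topology Y Y) U" "\<forall>y\<in>?S. (y, y) \<in> U" for U
  proof -
    obtain E where E: "E \<in> \<E>" "E \<subseteq> U"
      using uniformity_inside_neighbourhood_of_diagonal[OF uY Y(1) U(1)] U(2) by blast
    obtain F where F: "F \<in> \<E>" "N_ent ?S G F \<subseteq> U_ent ?S G E"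
      using prod E(1) unfolding acts_prodiscretely_def by blast
    define N where "N = N_ent ?S G F"
    have SG: "S_ent ?S G F \<subseteq> G" by (auto simp: S_ent_def)
    have SN: "S_ent ?S G F \<subseteq> N" unfolding N_def N_ent_def by (auto intro: generate.incl)
    have NG: "N \<subseteq> G"
      unfolding N_def N_ent_def by (rule group.generate_subgroup_incl[OF group_BijGroup SG sub])
    have "G \<subseteq> carrier (BijGroup ?S)" using subgroup.subset[OF sub] .
    then have subN: "subgroup N (BijGroup ?S)"
      unfolding N_def N_ent_def using SG by (intro group.generate_is_subgroup[OF group_BijGroup]) blast
    note actN = subgroup_BijGroup_apply[OF subN]
    obtain D' where D': "D' \<in> \<E>" "D' O D' \<subseteq> F" using uniformity_ofD(6)[OF uY F(1)] by blast
    obtain D where D: "D \<in> \<E>" "D \<subseteq> D'" and Dinv: "\<And>g a b. g \<in> G \<Longrightarrow> (a, b) \<in> D \<Longrightarrow> (g a, g b) \<in> D"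
      using inv[OF D'(1)] by blast
    define R where "R = {(y, y'). y \<in> ?S \<and> (\<exists>n\<in>N. y' = n y)}"
    have RK: "R \<subseteq> kernel_pair Y f"
    proof (clarsimp simp: R_def kernel_pair_def)
      fix y n assume y: "y \<in> ?S" "n \<in> N"
      then have "n y \<in> ?S" using actN(2) by blast
      then show "n y \<in> ?S \<and> f y = f (n y)" using fib[of y "n y"] y NG by blast
    qed
    have stable: "(z, z') \<in> R" if R: "(y, y') \<in> R" and K: "(z, z') \<in> kernel_pair Y f"
      and near: "(y, z) \<in> D" "(y', z') \<in> D" for y y' z z'
    proof -
      obtain n where n: "n \<in> N" "y' = n y" "y \<in> ?S" using R by (auto simp: R_def)
      obtain g where gG: "g \<in> G" "z' = g z" and zS: "z \<in> ?S" "z' \<in> ?S"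
        using K fib[of z z'] by (auto simp: kernel_pair_def)
      obtain m where m: "m \<in> G" "\<And>y. y \<in> ?S \<Longrightarrow> m (n y) = y" using act(5)[of n] n(1) NG by blast
      define k where "k = compose ?S g m"
      have kG: "k \<in> G" unfolding k_def using act(4) gG(1) m(1) .
      have nz: "n z \<in> ?S" using actN(2) n(1) zS(1) .
      have "k (n z) = z'" using nz m(2)[OF zS(1)] gG(2) by (simp add: k_def compose_def)
      moreover have "(n z, n y) \<in> D" using Dinv[of n z y] ES(2)[OF D(1)] near(1) n(1) NG by (blast dest: symD)
      then have "(n z, z') \<in> F" using near(2) n(2) D(2) D'(2) by blast
      ultimately have "k \<in> S_ent ?S G F" using kG nz by (auto simp: S_ent_def)
      then have "compose ?S k n \<in> N" using actN(4) SN n(1) by blast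
      moreover have "z' = compose ?S k n z" using \<open>k (n z) = z'\<close> zS(1) by (simp add: compose_def)
      ultimately show ?thesis using zS(1) by (auto simp: R_def)
    qed
    have "\<exists>A. \<forall>y\<in>?S. openin Y (A y) \<and> y \<in> A y \<and> A y \<subseteq> D `` {y}"
      using uniformity_neighbourhood[OF uY D(1)] by (intro bchoice ballI) metis
    then obtain A where A: "\<And>y. y \<in> ?S \<Longrightarrow> openin Y (A y) \<and> y \<in> A y \<and> A y \<subseteq> D `` {y}" by blast
    \<comment> \<open>\<open>B Q\<close> is an open neighbourhood of \<open>Q\<close> whose points are close to points of \<open>Q\<close>\<close>
    define B where "B = (\<lambda>Q. \<Union>q\<in>Q. A (fst q) \<times> A (snd q))"
    have B: "openin (prod_topology Y Y) (B Q)" if "Q \<subseteq> kernel_pair Y f" for Q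
      unfolding B_def using A that by (intro openin_Union) (auto simp: openin_prod_Times_iff kernel_pair_def)
    have BQ: "Q \<subseteq> B Q" if "Q \<subseteq> kernel_pair Y f" for Q
    proof
      fix q assume "q \<in> Q"
      moreover then have "fst q \<in> A (fst q)" "snd q \<in> A (snd q)" using A that by (auto simp: kernel_pair_def)
      ultimately show "q \<in> B Q" unfolding B_def by (intro UN_I[of q]) (auto simp: mem_Times_iff)
    qed
    have near: "\<exists>y y'. (y, y') \<in> Q \<and> (y, z) \<in> D \<and> (y', z') \<in> D"
      if Q: "Q \<subseteq> kernel_pair Y f" and z: "(z, z') \<in> B Q" for Q z z'
    proof -
      obtain q where q: "q \<in> Q" "z \<in> A (fst q)" "z' \<in> A (snd q)" using z by (auto simp: B_def)
      have "fst q \<in> ?S" "snd q \<in> ?S" using q(1) Q by (auto simp: kernel_pair_def)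
      then have "(fst q, z) \<in> D" "(snd q, z') \<in> D" using A q(2,3) by blast+
      then show ?thesis using q(1) by (metis prod.collapse)
    qed
    have K: "closedin (prod_topology Y Y) (kernel_pair Y f)" using closedin_kernel_pair[OF cont X] .
    have "kernel_pair Y f - R = kernel_pair Y f - B R"
    proof -
      have "q \<in> R" if q: "q \<in> kernel_pair Y f" "q \<in> B R" for q
      proof -
        obtain y y' where "(y, y') \<in> R" "(y, fst q) \<in> D" "(y', snd q) \<in> D"
          using near[OF RK, of "fst q" "snd q"] q(2) by auto
        then show ?thesis using stable[of y y' "fst q" "snd q"] q(1) by simp
      qed
      then show ?thesis using BQ[OF RK] by blast
    qed
    then have cl1: "closedin (prod_topology Y Y) (kernel_pair Y f - R)" using K B[OF RK] by auto
    have "R = kernel_pair Y f - B (kernel_pair Y f - R)"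
    proof (intro equalityI subsetI)
      fix q assume q: "q \<in> R"
      have "q \<notin> B (kernel_pair Y f - R)"
      proof
        assume "q \<in> B (kernel_pair Y f - R)"
        then obtain y y' where "(y, y') \<in> kernel_pair Y f - R" "(y, fst q) \<in> D" "(y', snd q) \<in> D"
          using near[of "kernel_pair Y f - R" "fst q" "snd q"] by auto
        moreover then have "(fst q, y) \<in> D" "(snd q, y') \<in> D"
          using uniformity_ofD(4)[OF uY D(1)] by blast+
        ultimately show False using stable[of "fst q" "snd q" y y'] q by simp
      qed
      then show "q \<in> kernel_pair Y f - B (kernel_pair Y f - R)" using RK q by blast
    qed (use BQ[of "kernel_pair Y f - R"] in blast)
    then have cl2: "closedin (prod_topology Y Y) R" using K B[of "kernel_pair Y f - R"] by (metis Diff_subset closedin_diff)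
    have "equiv ?S R"
    proof (rule equivI)
      show "R \<subseteq> ?S \<times> ?S" using RK by (auto simp: kernel_pair_def)
      show "refl_on ?S R" 
        unfolding refl_on_def R_def by (auto intro!: bexI[OF _ actN(3)])
      show "sym R"
      proof (rule symI)
        fix y y' assume "(y, y') \<in> R"
        then obtain n where n: "n \<in> N" "y' = n y" "y \<in> ?S" by (auto simp: R_def)
        obtain m where "m \<in> N" "m (n y) = y" using actN(5)[OF n(1)] n(3) by blast
        then show "(y', y) \<in> R" using n(2) actN(2)[OF n(1,3)] by (auto simp: R_def intro: bexI[of _ m])
      qed
      show "trans R"
      proof (rule transI)
        fix a b c assume "(a, b) \<in> R" "(b, c) \<in> R"
        then obtain m n where mn: "m \<in> N" "n \<in> N" "a \<in> ?S" "b = m a" "c = n b" by (auto simp: R_def)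
        then have "c = compose ?S n m a" by (simp add: compose_def)
        then show "(a, c) \<in> R" using actN(4)[OF mn(2,1)] mn(3) by (auto simp: R_def)
      qed
    qed
    moreover have "R \<subseteq> E"
    proof (clarsimp simp: R_def)
      fix y n assume "y \<in> ?S" "n \<in> N"
      then show "(y, n y) \<in> E" using F(2) by (auto simp: N_def U_ent_def)
    qed
    ultimately show ?thesis using RK cl1 cl2 E(2) unfolding clopen_relation_def by blast
  qed
  then show ?thesis unfolding pro_covering_def using Y cont opn im by blast
qed

section \<open>Lifting to pro-coverings\<close>

lemma clopen_relation_Int:
  assumes "clopen_relation Z \<phi> R" "clopen_relation Z \<phi> R'"
  shows "clopen_relation Z \<phi> (R \<inter> R')"
proof -
  have "equiv (topspace Z) (R \<inter> R')"
    using assms refl_on_Int[of "topspace Z" R "topspace Z" R']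
    by (auto simp: clopen_relation_def equiv_def sym_Int trans_Int)
  moreover have "kernel_pair Z \<phi> - R \<inter> R' = (kernel_pair Z \<phi> - R) \<union> (kernel_pair Z \<phi> - R')" by blast
  ultimately show ?thesis
    using assms unfolding clopen_relation_def by (auto intro: closedin_Int closedin_Un)
qed

text \<open>The quotient is locally injective over the base because the image in its square of the part of
  the fibre product outside \<^term>\<open>R\<close> is compact and misses the diagonal.\<close>

lemma quotient_finite_covering:
  assumes pc: "pro_covering Z X \<phi>" and X: "continuum X" and R: "clopen_relation Z \<phi> R"
  obtains \<psi> where "finite_covering (quotient_space Z R) X \<psi>"
    "\<And>z. z \<in> topspace Z \<Longrightarrow> \<psi> (R `` {z}) = \<phi> z"
proof -
  let ?T = "quotient_space Z R" and ?q = "\<lambda>z. R `` {z}"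
  define \<psi> where "\<psi> = (\<lambda>t. \<phi> (SOME z. z \<in> t))"
  have Z: "compact_space Z" "Hausdorff_space Z" and \<phi>: "continuous_map Z X \<phi>" "open_map Z X \<phi>" "\<phi> ` topspace Z = topspace X"
    using pc by (auto simp: pro_covering_def)
  have R: "equiv (topspace Z) R" "R \<subseteq> kernel_pair Z \<phi>" "closedin (prod_topology Z Z) R"
    "closedin (prod_topology Z Z) (kernel_pair Z \<phi> - R)"
    using R by (auto simp: clopen_relation_def)
  have \<psi>: "\<psi> (?q z) = \<phi> z" if "z \<in> topspace Z" for z
  proof -
    have "z \<in> ?q z" using equiv_class_self[OF R(1) that] .
    then have "(z, SOME w. w \<in> ?q z) \<in> R" by (metis Image_singleton_iff someI)
    then show ?thesis using R(2) by (auto simp: \<psi>_def kernel_pair_def)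
  qed
  note q = quotient_map_quotient_space[of Z R]
  have HT: "Hausdorff_space ?T" using compact_Hausdorff_quotient_space[OF Z R(1,3)] by blast
  have qim: "?q ` topspace Z = topspace ?T" using quotient_imp_surjective_map[OF q] .
  have "finite_covering ?T X \<psi>"
  proof
    show "compact_space ?T" "Hausdorff_space ?T" using compact_Hausdorff_quotient_space[OF Z R(1,3)] .
    show "continuum X" by (rule X)
    have "continuous_map Z X (\<psi> \<circ> ?q)" by (rule continuous_map_eq[OF \<phi>(1)]) (simp add: \<psi>)
    then show "continuous_map ?T X \<psi>" using continuous_compose_quotient_map[OF q] by blast
    show "\<psi> ` topspace ?T = topspace X"
      unfolding qim[symmetric] image_image using \<psi> \<phi>(3) by simp
    show "open_map ?T X \<psi>"
      unfolding open_map_def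
    proof (intro allI impI)
      fix U assume U: "openin ?T U"
      then have op: "openin Z {z \<in> topspace Z. ?q z \<in> U}" using openin_quotient_space by blast
      have "U \<subseteq> ?q ` topspace Z" using openin_subset[OF U] qim by simp
      then have "U = ?q ` {z \<in> topspace Z. ?q z \<in> U}" by blast
      then have "\<psi> ` U = (\<lambda>z. \<psi> (?q z)) ` {z \<in> topspace Z. ?q z \<in> U}" by (metis image_image)
      also have "\<dots> = \<phi> ` {z \<in> topspace Z. ?q z \<in> U}" using \<psi> by (intro image_cong) auto
      finally show "openin X (\<psi> ` U)" using op \<phi>(2) unfolding open_map_def by simp
    qed
    show "locally_injective ?T \<psi>"
      unfolding locally_injective_def
    proof
      fix t assume t: "t \<in> topspace ?T"
      let ?qq = "\<lambda>p. (?q (fst p), ?q (snd p))"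
      let ?D = "?qq ` (kernel_pair Z \<phi> - R)"
      have "continuous_map (prod_topology Z Z) (prod_topology ?T ?T) ?qq"
        using continuous_map_pairedI[OF continuous_map_compose[OF continuous_map_fst quotient_imp_continuous_map[OF q]]
            continuous_map_compose[OF continuous_map_snd quotient_imp_continuous_map[OF q]]] by (simp add: comp_def)
      then have "closed_map (prod_topology Z Z) (prod_topology ?T ?T) ?qq"
        using Z(1) HT by (intro continuous_imp_closed_map) (auto simp: compact_space_prod_topology Hausdorff_space_prod_topology)
      then have "closedin (prod_topology ?T ?T) ?D" using R(4) unfolding closed_map_def by blast
      define W where "W = topspace (prod_topology ?T ?T) - ?D"
      have opW: "openin (prod_topology ?T ?T) W"
        unfolding W_def using \<open>closedin _ ?D\<close> by blast
      have "(t, t) \<notin> ?D"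
      proof
        assume "(t, t) \<in> ?D"
        then obtain p where p: "p \<in> kernel_pair Z \<phi> - R" "?q (fst p) = ?q (snd p)" by auto
        then have "(fst p, snd p) \<in> R"
          using eq_equiv_class[OF p(2) R(1)] by (auto simp: kernel_pair_def)
        then show False using p(1) by simp
      qed
      then have "(t, t) \<in> W" using t by (simp add: W_def)
      then obtain U V where UV: "openin ?T U" "openin ?T V" "t \<in> U" "t \<in> V" "U \<times> V \<subseteq> W"
        using opW unfolding openin_prod_topology_alt by meson
      have "inj_on \<psi> (U \<inter> V)"
      proof (rule inj_onI, rule ccontr)
        fix s s' assume s: "s \<in> U \<inter> V" "s' \<in> U \<inter> V" "\<psi> s = \<psi> s'" "s \<noteq> s'"
        then have "s \<in> ?q ` topspace Z" "s' \<in> ?q ` topspace Z" using openin_subset[OF UV(1)] qim by blast+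
        then obtain z z' where z: "z \<in> topspace Z" "z' \<in> topspace Z" "s = ?q z" "s' = ?q z'" by blast
        then have "(z, z') \<in> kernel_pair Z \<phi>" using s(3) \<psi> by (simp add: kernel_pair_def)
        moreover have "(z, z') \<notin> R" using s(4) z(3,4) equiv_class_eq[OF R(1)] by blast
        ultimately have "(s, s') \<in> ?D" using z(3,4) by force
        moreover have "(s, s') \<in> W" using s(1,2) UV(5) by blast
        ultimately show False by (simp add: W_def)
      qed
      then show "\<exists>V. openin ?T V \<and> t \<in> V \<and> inj_on \<psi> V" using UV by (intro exI[of _ "U \<inter> V"]) auto
    qed
  qed
  then show thesis using that \<psi> by blast
qed

text \<open>For each clopen relation \<^term>\<open>R\<close>, the Galois closure of the quotient provides a lift to the
  quotient. It is recorded as a closed subset of \<open>S \<times> Z\<close> whose sections are \<^term>\<open>R\<close>-classes. Smaller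
  relations have smaller sets, by the connectedness argument behind uniqueness of lifts (the fact
  \<open>mono\<close> in the proof), and the intersection of all these sets is the graph of the lift: its
  sections are nonempty by compactness and have one element since the relations separate points.\<close>

theorem lift_to_pro_covering:
  fixes Z :: "'z topology" and X :: "'a topology" and S :: "'s topology"
  assumes X: "continuum X" and S: "connected_space S" and s0: "s0 \<in> topspace S"
    and lift: "\<And>(C :: (nat \<Rightarrow> 'z set, 'a) covering) c.
        continuum_cover X C \<Longrightarrow> c \<in> cov_points C \<Longrightarrow> cov_map C c = \<Phi> s0 \<Longrightarrow>
        \<exists>k. continuous_map S (cov_space C) k \<and> k s0 = c \<and> (\<forall>s\<in>topspace S. cov_map C (k s) = \<Phi> s)"
    and pc: "pro_covering Z X \<phi>" and z0: "z0 \<in> topspace Z" "\<phi> z0 = \<Phi> s0"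
  obtains h where "continuous_map S Z h" "h s0 = z0" "\<And>s. s \<in> topspace S \<Longrightarrow> \<phi> (h s) = \<Phi> s"
proof -
  let ?SZ = "prod_topology S Z"
  have Z: "compact_space Z" "Hausdorff_space Z" using pc by (auto simp: pro_covering_def)
  \<comment> \<open>\<open>lv R \<Gamma>\<close>: \<open>\<Gamma>\<close> is the closed set that records a lift to the quotient by \<open>R\<close> starting at the class of \<open>z0\<close>\<close>
  define lv where "lv = (\<lambda>R \<Gamma>. closedin ?SZ \<Gamma> \<and> (s0, z0) \<in> \<Gamma> \<and>
      (\<forall>s\<in>topspace S. \<exists>z\<in>topspace Z. \<phi> z = \<Phi> s \<and> {z'. (s, z') \<in> \<Gamma>} = R `` {z}))"
  have ex: "\<exists>\<Gamma>. lv R \<Gamma>" if R: "clopen_relation Z \<phi> R" for R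
  proof -
    let ?T = "quotient_space Z R" and ?q = "\<lambda>z. R `` {z}"
    have eR: "equiv (topspace Z) R" using R by (simp add: clopen_relation_def)
    obtain \<psi> where "finite_covering ?T X \<psi>" and \<psi>: "\<And>z. z \<in> topspace Z \<Longrightarrow> \<psi> (?q z) = \<phi> z"
      using quotient_finite_covering[OF pc X R] by blast
    then interpret finite_covering ?T X \<psi> by blast
    have t0: "?q z0 \<in> topspace ?T" using z0(1) by (simp add: quotientI)
    obtain C :: "(nat \<Rightarrow> 'z set, 'a) covering" and c k
      where C: "continuum_cover X C" "c \<in> cov_points C" "continuous_map (cov_space C) ?T k"
        "\<And>u. u \<in> cov_points C \<Longrightarrow> \<psi> (k u) = cov_map C u" "k c = ?q z0"
      using Galois_closure[OF t0] by blast
    have "cov_map C c = \<Phi> s0" using C(4)[OF C(2)] C(5) \<psi>[OF z0(1)] z0(2) by simp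
    then obtain l where l: "continuous_map S (cov_space C) l" "l s0 = c"
        "\<And>s. s \<in> topspace S \<Longrightarrow> cov_map C (l s) = \<Phi> s"
      using lift[OF C(1,2)] by blast
    define g where "g = k \<circ> l"
    have g: "continuous_map S ?T g" unfolding g_def using l(1) C(3) by (rule continuous_map_compose)
    have gT: "g s \<in> topspace ?T" if "s \<in> topspace S" for s using g that by (auto simp: continuous_map_def)
    have lC: "l s \<in> cov_points C" if "s \<in> topspace S" for s using l(1) that by (auto simp: continuous_map_def)
    define \<Gamma> where "\<Gamma> = {p \<in> topspace ?SZ. (?q \<circ> snd) p = (g \<circ> fst) p}"
    have "closedin ?SZ \<Gamma>"
      unfolding \<Gamma>_def
      using continuous_map_compose[OF continuous_map_snd quotient_imp_continuous_map[OF quotient_map_quotient_space]]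
        continuous_map_compose[OF continuous_map_fst g]
      by (intro closedin_continuous_maps_eq[OF Haus])
    moreover have "(s0, z0) \<in> \<Gamma>" using s0 z0(1) l(2) C(5) by (simp add: \<Gamma>_def g_def)
    moreover have "\<exists>z\<in>topspace Z. \<phi> z = \<Phi> s \<and> {z'. (s, z') \<in> \<Gamma>} = ?q z" if s: "s \<in> topspace S" for s
    proof -
      obtain z where z: "z \<in> topspace Z" "g s = ?q z" using gT[OF s] by (auto elim: quotientE)
      have "\<phi> z = \<psi> (g s)" using \<psi>[OF z(1)] z(2) by simp
      also have "\<dots> = \<Phi> s" using C(4)[OF lC[OF s]] l(3)[OF s] by (simp add: g_def)
      finally have "\<phi> z = \<Phi> s" .
      moreover have "{z'. (s, z') \<in> \<Gamma>} = {z' \<in> topspace Z. ?q z' = ?q z}"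
        using s z(2) by (auto simp: \<Gamma>_def)
      moreover have "{z' \<in> topspace Z. ?q z' = ?q z} = ?q z"
      proof (intro equalityI subsetI)
        fix z' assume "z' \<in> {z' \<in> topspace Z. ?q z' = ?q z}"
        then show "z' \<in> ?q z" using equiv_class_self[OF eR, of z'] by auto
      next
        fix z' assume z': "z' \<in> ?q z"
        then have "z' \<in> topspace Z" using eR by (auto simp: equiv_def)
        moreover have "?q z = ?q z'" using z' equiv_class_eq[OF eR] by blast
        ultimately show "z' \<in> {z' \<in> topspace Z. ?q z' = ?q z}" by simp
      qed
      ultimately show ?thesis using z(1) by auto
    qed
    ultimately show ?thesis unfolding lv_def by blast
  qed
  have cls: "(z, z') \<in> R" if asm: "clopen_relation Z \<phi> R" "lv R \<Gamma>" "s \<in> topspace S" "(s, z) \<in> \<Gamma>" "(s, z') \<in> \<Gamma>" for R \<Gamma> s z z'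
  proof -
    have eR: "equiv (topspace Z) R" using asm(1) by (simp add: clopen_relation_def)
    obtain w where w: "{z'. (s, z') \<in> \<Gamma>} = R `` {w}" using asm(2,3) unfolding lv_def by blast
    then have "(w, z) \<in> R" "(w, z') \<in> R" using asm(4,5) by auto
    then show ?thesis using eR unfolding equiv_def by (meson symD transD)
  qed
  have cls': "(s, z') \<in> \<Gamma>" if asm: "clopen_relation Z \<phi> R" "lv R \<Gamma>" "s \<in> topspace S" "(s, z) \<in> \<Gamma>" "(z, z') \<in> R" for R \<Gamma> s z z'
  proof -
    have eR: "equiv (topspace Z) R" using asm(1) by (simp add: clopen_relation_def)
    obtain w where w: "{z'. (s, z') \<in> \<Gamma>} = R `` {w}" using asm(2,3) unfolding lv_def by blast
    then have "(w, z) \<in> R" using asm(4) by auto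
    then have "(w, z') \<in> R" using eR asm(5) unfolding equiv_def by (meson transD)
    then show ?thesis using w by auto
  qed
  have sec: "\<exists>z\<in>topspace Z. (s, z) \<in> \<Gamma>" if asm: "clopen_relation Z \<phi> R" "lv R \<Gamma>" "s \<in> topspace S" for R \<Gamma> s
  proof -
    obtain w where w: "w \<in> topspace Z" "{z'. (s, z') \<in> \<Gamma>} = R `` {w}" using asm(2,3) unfolding lv_def by blast
    moreover have "w \<in> R `` {w}" using asm(1) w(1) equiv_class_self[of "topspace Z" R w] by (simp only: clopen_relation_def)
    ultimately show ?thesis by blast
  qed
  have over: "z \<in> topspace Z \<and> \<phi> z = \<Phi> s" if asm: "clopen_relation Z \<phi> R" "lv R \<Gamma>" "s \<in> topspace S" "(s, z) \<in> \<Gamma>" for R \<Gamma> s z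
  proof -
    obtain w where w: "\<phi> w = \<Phi> s" "{z'. (s, z') \<in> \<Gamma>} = R `` {w}" using asm(2,3) unfolding lv_def by blast
    then have "(w, z) \<in> R" using asm(4) by auto
    then show ?thesis using asm(1) w(1) by (auto simp: clopen_relation_def kernel_pair_def)
  qed
  have mono: "\<Gamma> \<subseteq> \<Gamma>'" if R: "clopen_relation Z \<phi> R" "clopen_relation Z \<phi> R'" "R \<subseteq> R'"
      and \<Gamma>: "lv R \<Gamma>" "lv R' \<Gamma>'" for R R' \<Gamma> \<Gamma>'
  proof -
    let ?ZZ = "prod_topology Z Z"
    let ?P = "prod_topology S ?ZZ"
    define A where "A = fst ` (\<Gamma> \<inter> \<Gamma>')"
    define Q where "Q = {p \<in> topspace ?P. (fst p, fst (snd p)) \<in> \<Gamma>} \<inter> {p \<in> topspace ?P. (fst p, snd (snd p)) \<in> \<Gamma>'} \<inter>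
        {p \<in> topspace ?P. snd p \<in> kernel_pair Z \<phi> - R'}"
    have cl: "closedin ?SZ \<Gamma>" "closedin ?SZ \<Gamma>'" using \<Gamma> by (auto simp: lv_def)
    have "closedin S A"
      unfolding A_def using closed_map_fst[OF Z(1), of S] cl unfolding closed_map_def by blast
    moreover
    have "continuous_map ?P ?SZ (\<lambda>p. (fst p, fst (snd p)))" "continuous_map ?P ?SZ (\<lambda>p. (fst p, snd (snd p)))"
      using continuous_map_pairedI[OF continuous_map_fst continuous_map_compose[OF continuous_map_snd continuous_map_fst]]
        continuous_map_pairedI[OF continuous_map_fst continuous_map_compose[OF continuous_map_snd continuous_map_snd]]
      by (auto simp: comp_def)
    then have "closedin ?P Q"
      unfolding Q_def using cl R(2)
      by (intro closedin_Int closedin_continuous_map_preimage)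
        (auto simp: clopen_relation_def continuous_map_of_snd[of S ?ZZ ?ZZ id, simplified])
    then have "closedin S (fst ` Q)"
      using closed_map_fst[of ?ZZ S] Z(1) unfolding closed_map_def by (simp add: compact_space_prod_topology)
    moreover have "A \<inter> fst ` Q = {}"
    proof (rule ccontr)
      assume "A \<inter> fst ` Q \<noteq> {}"
      then obtain s w z z' where s: "(s, w) \<in> \<Gamma>" "(s, w) \<in> \<Gamma>'" "(s, z) \<in> \<Gamma>" "(s, z') \<in> \<Gamma>'" "(z, z') \<notin> R'" "s \<in> topspace S"
        unfolding A_def Q_def by fastforce
      then have "(w, z) \<in> R'" "(w, z') \<in> R'" using cls[OF R(1) \<Gamma>(1)] cls[OF R(2) \<Gamma>(2)] R(3) by blast+
      then show False using R(2) s(5) unfolding clopen_relation_def equiv_def by (meson symD transD)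
    qed
    moreover have "A \<union> fst ` Q = topspace S"
    proof (intro equalityI subsetI)
      fix s assume s: "s \<in> topspace S"
      obtain z z' where z: "(s, z) \<in> \<Gamma>" "(s, z') \<in> \<Gamma>'" using sec[OF R(1) \<Gamma>(1) s] sec[OF R(2) \<Gamma>(2) s] by blast
      have zz: "z \<in> topspace Z" "z' \<in> topspace Z" "(z, z') \<in> kernel_pair Z \<phi>"
        using over[OF R(1) \<Gamma>(1) s z(1)] over[OF R(2) \<Gamma>(2) s z(2)] by (auto simp: kernel_pair_def)
      show "s \<in> A \<union> fst ` Q"
      proof (cases "(z, z') \<in> R'")
        case True
        then have "(z', z) \<in> R'" using R(2) unfolding clopen_relation_def equiv_def by (meson symD)
        then have "(s, z) \<in> \<Gamma>'" using cls'[OF R(2) \<Gamma>(2) s z(2)] by blast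
        then show ?thesis using z(1) unfolding A_def by force
      next
        case False
        then have "(s, z, z') \<in> Q" using s z zz by (auto simp: Q_def)
        then show ?thesis by force
      qed
    next
      fix s assume "s \<in> A \<union> fst ` Q"
      then show "s \<in> topspace S" using closedin_subset[OF cl(1)] unfolding A_def Q_def by auto
    qed
    moreover have "A \<noteq> {}" using \<Gamma> unfolding lv_def A_def by blast
    ultimately have A: "A = topspace S" by (rule connected_space_two_closed[OF S])
    show ?thesis
    proof
      fix p assume p: "p \<in> \<Gamma>"
      then have "fst p \<in> topspace S" using closedin_subset[OF cl(1)] by auto
      then obtain w where w: "(fst p, w) \<in> \<Gamma>" "(fst p, w) \<in> \<Gamma>'" using A unfolding A_def by force
      then have "(w, snd p) \<in> R'" using cls[OF R(1) \<Gamma>(1) \<open>fst p \<in> _\<close> w(1), of "snd p"] p R(3) by auto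
      then show "p \<in> \<Gamma>'" using cls'[OF R(2) \<Gamma>(2) \<open>fst p \<in> _\<close> w(2)] by fastforce
    qed
  qed
  define \<R> where "\<R> = {R. clopen_relation Z \<phi> R}"
  obtain \<Gamma> where \<Gamma>: "\<And>R. R \<in> \<R> \<Longrightarrow> lv R (\<Gamma> R)" using ex unfolding \<R>_def by (metis mem_Collect_eq)
  have "\<exists>R. clopen_relation Z \<phi> R \<and> R \<subseteq> topspace (prod_topology Z Z)"
    using pc openin_topspace[of "prod_topology Z Z"] unfolding pro_covering_def by auto
  then have \<R>: "\<R> \<noteq> {}" by (auto simp: \<R>_def)
  define G where "G = (\<Inter>R\<in>\<R>. \<Gamma> R)"
  have clG: "closedin ?SZ G" unfolding G_def using \<Gamma> \<R> by (intro closedin_INT) (auto simp: lv_def)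
  have secG: "\<exists>z. (s, z) \<in> G" if s: "s \<in> topspace S" for s
  proof -
    let ?C = "\<lambda>R. {z \<in> topspace Z. (s, z) \<in> \<Gamma> R}"
    have "(\<Inter>R\<in>\<R>. ?C R) \<noteq> {}"
    proof (rule directed_closed_Inter_nonempty[OF Z(1) \<R>])
      fix R assume R: "R \<in> \<R>"
      have "continuous_map Z ?SZ (\<lambda>z. (s, z))"
        using s by (intro continuous_map_pairedI) auto
      then show "closedin Z (?C R)" using closedin_continuous_map_preimage \<Gamma>[OF R] unfolding lv_def by blast
      show "?C R \<noteq> {}" using sec[OF _ \<Gamma>[OF R] s] R by (auto simp: \<R>_def)
      fix R' assume R': "R' \<in> \<R>"
      have I: "R \<inter> R' \<in> \<R>" using R R' clopen_relation_Int by (auto simp: \<R>_def)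
      have "\<Gamma> (R \<inter> R') \<subseteq> \<Gamma> R" "\<Gamma> (R \<inter> R') \<subseteq> \<Gamma> R'"
        using I R R' by (auto intro!: mono[OF _ _ _ \<Gamma>[OF I] \<Gamma>, THEN subsetD] simp: \<R>_def)
      then show "\<exists>R''\<in>\<R>. ?C R'' \<subseteq> ?C R \<inter> ?C R'" using I by blast
    qed
    then show ?thesis by (auto simp: G_def)
  qed
  have uniq: "z = z'" if "s \<in> topspace S" "(s, z) \<in> G" "(s, z') \<in> G" for s z z'
  proof (rule ccontr)
    assume ne: "z \<noteq> z'"
    have zZ: "z \<in> topspace Z" "z' \<in> topspace Z" using closedin_subset[OF clG] that by auto
    obtain R where R: "clopen_relation Z \<phi> R" "(z, z') \<notin> R"
      using clopen_relation_separating[OF pc zZ ne] by blast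
    then have "R \<in> \<R>" by (simp add: \<R>_def)
    then have "(s, z) \<in> \<Gamma> R" "(s, z') \<in> \<Gamma> R" using that by (auto simp: G_def)
    then show False using cls[OF R(1) \<Gamma>[OF \<open>R \<in> \<R>\<close>] that(1)] R(2) by blast
  qed
  define h where "h = (\<lambda>s. SOME z. (s, z) \<in> G)"
  have h: "(s, h s) \<in> G" if "s \<in> topspace S" for s using someI_ex[OF secG[OF that]] by (simp add: h_def)
  obtain R where R: "R \<in> \<R>" using \<R> by blast
  have hR: "(s, h s) \<in> \<Gamma> R" if "s \<in> topspace S" for s using h[OF that] R by (auto simp: G_def)
  have fib: "h s \<in> topspace Z \<and> \<phi> (h s) = \<Phi> s" if "s \<in> topspace S" for s
    using over[OF _ \<Gamma>[OF R] that hR[OF that]] R by (simp add: \<R>_def)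
  have "(s0, z0) \<in> G" using \<Gamma> by (auto simp: G_def lv_def)
  then have "h s0 = z0" using uniq[OF s0 h[OF s0]] by blast
  moreover have "G = {(s, h s) | s. s \<in> topspace S}"
  proof (intro equalityI subsetI)
    fix p assume p: "p \<in> G"
    then have "fst p \<in> topspace S" using closedin_subset[OF clG] by auto
    moreover then have "snd p = h (fst p)" using uniq[OF _ _ h] p by simp
    ultimately show "p \<in> {(s, h s) | s. s \<in> topspace S}" by (metis (mono_tags, lifting) mem_Collect_eq prod.collapse)
  qed (use h in auto)
  then have "continuous_map S Z h"
    using clG fib by (intro closed_graph_imp_continuous_map[OF Z(1)]) auto
  ultimately show thesis using that fib by blast
qed

section \<open>Inverse limits\<close>

locale inverse_system =
  fixes A :: "'i set" and le :: "'i \<Rightarrow> 'i \<Rightarrow> bool" and Y :: "'i \<Rightarrow> 'y topology" and B :: "'i \<Rightarrow> 'i \<Rightarrow> 'y \<Rightarrow> 'y"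
  assumes refl: "\<And>i. i \<in> A \<Longrightarrow> le i i"
    and trans: "\<And>i j k. i \<in> A \<Longrightarrow> j \<in> A \<Longrightarrow> k \<in> A \<Longrightarrow> le i j \<Longrightarrow> le j k \<Longrightarrow> le i k"
    and directed: "\<And>i j. i \<in> A \<Longrightarrow> j \<in> A \<Longrightarrow> \<exists>k\<in>A. le i k \<and> le j k"
    and ne: "A \<noteq> {}"
    and compact: "\<And>i. i \<in> A \<Longrightarrow> compact_space (Y i)" and Haus: "\<And>i. i \<in> A \<Longrightarrow> Hausdorff_space (Y i)"
    and conn: "\<And>i. i \<in> A \<Longrightarrow> connected_space (Y i)" and points: "\<And>i. i \<in> A \<Longrightarrow> topspace (Y i) \<noteq> {}"
    and cont: "\<And>i j. i \<in> A \<Longrightarrow> j \<in> A \<Longrightarrow> le i j \<Longrightarrow> continuous_map (Y j) (Y i) (B i j)"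
    and onto: "\<And>i j. i \<in> A \<Longrightarrow> j \<in> A \<Longrightarrow> le i j \<Longrightarrow> B i j ` topspace (Y j) = topspace (Y i)"
    and ident: "\<And>i y. i \<in> A \<Longrightarrow> y \<in> topspace (Y i) \<Longrightarrow> B i i y = y"
    and functorial: "\<And>i j k y. i \<in> A \<Longrightarrow> j \<in> A \<Longrightarrow> k \<in> A \<Longrightarrow> le i j \<Longrightarrow> le j k \<Longrightarrow>
      y \<in> topspace (Y k) \<Longrightarrow> B i j (B j k y) = B i k y"
begin

abbreviation product where "product \<equiv> product_topology Y A"

definition limit :: "('i \<Rightarrow> 'y) set" where
  "limit = {p \<in> topspace product. \<forall>i\<in>A. \<forall>j\<in>A. le i j \<longrightarrow> B i j (p j) = p i}"

definition partial_limit :: "'i \<Rightarrow> ('i \<Rightarrow> 'y) set" where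
  "partial_limit k = {p \<in> topspace product. \<forall>i\<in>A. le i k \<longrightarrow> B i k (p k) = p i}"

definition retr :: "'i \<Rightarrow> ('i \<Rightarrow> 'y) \<Rightarrow> ('i \<Rightarrow> 'y)" where
  "retr k p = (\<lambda>i\<in>A. if le i k then B i k (p k) else p i)"

lemma compact_product: "compact_space product" and Haus_product: "Hausdorff_space product"
  using compact Haus by (auto simp: compact_space_product_topology Hausdorff_space_product_topology)

lemma proj: "p \<in> topspace product \<Longrightarrow> i \<in> A \<Longrightarrow> p i \<in> topspace (Y i)"
  by auto

lemma B_in: "i \<in> A \<Longrightarrow> j \<in> A \<Longrightarrow> le i j \<Longrightarrow> y \<in> topspace (Y j) \<Longrightarrow> B i j y \<in> topspace (Y i)"
  using onto by blast

lemma retr_in: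
  assumes "k \<in> A" "p \<in> topspace product"
  shows "retr k p \<in> partial_limit k" "retr k p k = p k"
proof -
  show k: "retr k p k = p k" using assms by (simp add: retr_def refl ident proj)
  have "retr k p \<in> topspace product" using assms B_in by (auto simp: retr_def PiE_iff)
  moreover have "B i k (retr k p k) = retr k p i" if "i \<in> A" "le i k" for i
    unfolding k using that by (simp add: retr_def)
  ultimately show "retr k p \<in> partial_limit k" by (simp add: partial_limit_def)
qed

lemma retr_id:
  assumes "p \<in> partial_limit k"
  shows "retr k p = p"
proof
  fix i
  have "p \<in> extensional A" using assms by (auto simp: partial_limit_def PiE_def)
  then show "retr k p i = p i" using assms by (auto simp: retr_def partial_limit_def extensional_def)
qed

text \<open>The threads below \<^term>\<open>k\<close> form a retract of the whole product, so they inherit its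
  connectedness, and the limit is a directed intersection of such sets.\<close>

lemma partial_limit_image:
  assumes "k \<in> A"
  shows "partial_limit k = retr k ` topspace product"
proof (intro equalityI subsetI)
  fix p assume p: "p \<in> partial_limit k"
  then have "p \<in> topspace product" unfolding partial_limit_def by blast
  then show "p \<in> retr k ` topspace product" using retr_id[OF p] by (metis imageI)
qed (use retr_in(1)[OF assms] in blast)

lemma continuous_retr:
  assumes "k \<in> A"
  shows "continuous_map product product (retr k)"
  unfolding retr_def
proof (subst continuous_map_componentwise, intro conjI ballI)
  show "(\<lambda>p. \<lambda>i\<in>A. if le i k then B i k (p k) else p i) ` topspace product \<subseteq> extensional A" by auto
  fix i assume i: "i \<in> A"
  show "continuous_map product (Y i) (\<lambda>p. (\<lambda>i\<in>A. if le i k then B i k (p k) else p i) i)"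
  proof (cases "le i k")
    case True
    have "continuous_map product (Y i) (B i k \<circ> (\<lambda>p. p k))"
      by (rule continuous_map_compose[OF continuous_map_product_projection[OF assms, of Y] cont[OF i assms True]])
    then show ?thesis using i True by (simp add: comp_def)
  next
    case False
    then show ?thesis using i by (simp add: continuous_map_product_projection)
  qed
qed

lemma partial_limit:
  assumes "k \<in> A"
  shows "closedin product (partial_limit k)" "connectedin product (partial_limit k)"
proof -
  have "connected_space product" using conn by (auto simp: connected_space_product_topology)
  then show "connectedin product (partial_limit k)"
    unfolding partial_limit_image[OF assms]
    using connectedin_continuous_map_image[OF continuous_retr[OF assms], of "topspace product"]
    by (simp only: connectedin_topspace)
  show "closedin product (partial_limit k)"
    unfolding partial_limit_image[OF assms]
    using continuous_imp_closed_map[OF continuous_retr[OF assms] compact_product Haus_product]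
    unfolding closed_map_def by blast
qed

lemma partial_limit_antimono:
  assumes "k \<in> A" "m \<in> A" "le k m"
  shows "partial_limit m \<subseteq> partial_limit k"
proof
  fix p assume p: "p \<in> partial_limit m"
  have "B i k (p k) = p i" if i: "i \<in> A" "le i k" for i
  proof -
    have pk: "B k m (p m) = p k" and pi: "B i m (p m) = p i" and pm: "p m \<in> topspace (Y m)"
      using p assms i trans[of i k m] proj[of p m] by (auto simp: partial_limit_def)
    show ?thesis using functorial[OF i(1) assms(1,2) i(2) assms(3) pm] pk pi by simp
  qed
  then show "p \<in> partial_limit k" using p by (auto simp: partial_limit_def)
qed

lemma limit_cofinal:
  assumes "k \<in> A"
  shows "limit = (\<Inter>m\<in>{m \<in> A. le k m}. partial_limit m)"
proof (intro equalityI subsetI)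
  fix p assume p: "p \<in> (\<Inter>m\<in>{m \<in> A. le k m}. partial_limit m)"
  have "p \<in> topspace product" using p assms refl[OF assms] by (auto simp: partial_limit_def)
  moreover have "B i j (p j) = p i" if ij: "i \<in> A" "j \<in> A" "le i j" for i j
  proof -
    obtain m where m: "m \<in> A" "le j m" "le k m" using directed[OF ij(2) assms] by blast
    then have "p \<in> partial_limit m" using p by blast
    then have "p \<in> partial_limit j" using partial_limit_antimono[OF ij(2) m(1,2)] by blast
    then show ?thesis using ij by (auto simp: partial_limit_def)
  qed
  ultimately show "p \<in> limit" by (simp add: limit_def)
qed (auto simp: limit_def partial_limit_def)

lemma directed_above:
  assumes "k \<in> A" "m \<in> {m \<in> A. le k m}" "n \<in> {m \<in> A. le k m}"
  shows "\<exists>l\<in>{m \<in> A. le k m}. partial_limit l \<subseteq> partial_limit m \<inter> partial_limit n"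
proof -
  obtain l where l: "l \<in> A" "le m l" "le n l" using directed[of m n] assms by blast
  then have "le k l" using trans[of k m l] assms by blast
  then show ?thesis using l partial_limit_antimono[of m l] partial_limit_antimono[of n l] assms by blast
qed

lemma limit: "closedin product limit" "connectedin product limit"
proof -
  obtain k where k: "k \<in> A" using ne by blast
  have ne': "{m \<in> A. le k m} \<noteq> {}" using k refl by blast
  show "closedin product limit"
    unfolding limit_cofinal[OF k] using partial_limit(1) ne' by (intro closedin_INT) auto
  show "connectedin product limit"
    unfolding limit_cofinal[OF k]
    by (rule directed_connected_Inter[OF compact_product Haus_product ne' _ _ directed_above[OF k]])
      (use partial_limit in auto)
qed

lemma limit_onto:
  assumes k: "k \<in> A" and a: "a \<in> topspace (Y k)"
  obtains p where "p \<in> limit" "p k = a"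
proof -
  let ?C = "\<lambda>m. partial_limit m \<inter> {p \<in> topspace product. p k \<in> {a}}"
  have "closedin (Y k) {a}" using a Haus[OF k] by (simp add: closedin_Hausdorff_singleton)
  then have cl: "closedin product {p \<in> topspace product. p k \<in> {a}}"
    using closedin_continuous_map_preimage[OF continuous_map_product_projection[OF k]] by blast
  have "(\<Inter>m\<in>{m \<in> A. le k m}. ?C m) \<noteq> {}"
  proof (rule directed_closed_Inter_nonempty[OF compact_product])
    show "{m \<in> A. le k m} \<noteq> {}" using k refl by blast
    fix m assume m: "m \<in> {m \<in> A. le k m}"
    show "closedin product (?C m)" using m cl partial_limit(1) by blast
    have "a \<in> B k m ` topspace (Y m)" using onto[OF k, of m] a m by simp
    then obtain a' where a': "a' \<in> topspace (Y m)" "B k m a' = a" by blast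
    have "topspace product \<noteq> {}" using points by (simp add: PiE_eq_empty_iff)
    then obtain q where q: "q \<in> topspace product" by blast
    define q' where "q' = q(m := a')"
    have "q' \<in> topspace product" using q a' m by (auto simp: q'_def PiE_iff extensional_def)
    then have "retr m q' \<in> partial_limit m" using retr_in m by blast
    moreover have "retr m q' k = a" using m k a' by (simp add: retr_def q'_def)
    ultimately show "?C m \<noteq> {}" by (auto simp: partial_limit_def)
    fix n assume n: "n \<in> {m \<in> A. le k m}"
    show "\<exists>l\<in>{m \<in> A. le k m}. ?C l \<subseteq> ?C m \<inter> ?C n" using directed_above[OF k m n] by blast
  qed
  then obtain p where p: "p \<in> (\<Inter>m\<in>{m \<in> A. le k m}. ?C m)" by blast
  then have "p \<in> limit" unfolding limit_cofinal[OF k] by blast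
  moreover have "p \<in> ?C k" using p k refl[OF k] by blast
  ultimately show thesis using that by blast
qed

end

section \<open>Pullbacks and maps between covers\<close>

lemma locally_injective_compose:
  assumes "continuous_map A B k" "locally_injective A k" "locally_injective B l"
  shows "locally_injective A (l \<circ> k)"
  unfolding locally_injective_def
proof
  fix a assume a: "a \<in> topspace A"
  then obtain V where V: "openin A V" "a \<in> V" "inj_on k V" using assms(2) unfolding locally_injective_def by blast
  have "k a \<in> topspace B" using assms(1) a by (auto simp: continuous_map_def)
  then obtain W where W: "openin B W" "k a \<in> W" "inj_on l W" using assms(3) unfolding locally_injective_def by blast
  have "openin A (V \<inter> {a \<in> topspace A. k a \<in> W})"
    using V(1) openin_continuous_map_preimage[OF assms(1) W(1)] by blast
  moreover have "inj_on (l \<circ> k) (V \<inter> {a \<in> topspace A. k a \<in> W})"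
    using V(3) W(3) by (auto simp: inj_on_def)
  ultimately show "\<exists>V. openin A V \<and> a \<in> V \<and> inj_on (l \<circ> k) V" using V(2) W(2) a by blast
qed

lemma pullback_finite_covering:
  assumes Y: "continuum Y" and f: "continuous_map Y X f" and X: "Hausdorff_space X"
    and Z: "compact_space Z" "Hausdorff_space Z" and p: "continuous_map Z X p" "open_map Z X p"
    "p ` topspace Z = topspace X" "locally_injective Z p"
  shows "finite_covering (subtopology (prod_topology Y Z) {(y, z). f y = p z}) Y fst"
proof
  let ?YZ = "prod_topology Y Z" and ?P = "{(y, z). f y = p z}"
  let ?T = "subtopology ?YZ ?P"
  have cY: "compact_space Y" and HY: "Hausdorff_space Y"
    using Y by (auto simp: continuum_def metrizable_imp_Hausdorff_space)
  have ts: "topspace ?T = {(y, z). y \<in> topspace Y \<and> z \<in> topspace Z \<and> f y = p z}" by auto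
  have "closedin ?YZ {q \<in> topspace ?YZ. (f \<circ> fst) q = (p \<circ> snd) q}"
    using continuous_map_compose[OF continuous_map_fst f] continuous_map_compose[OF continuous_map_snd p(1)]
    by (intro closedin_continuous_maps_eq[OF X])
  moreover have "{q \<in> topspace ?YZ. (f \<circ> fst) q = (p \<circ> snd) q} = topspace ?T" by auto
  ultimately have "closedin ?YZ (topspace ?T)" by simp
  then have "compactin ?YZ (topspace ?T)"
    using cY Z(1) by (intro closedin_compact_space) (auto simp: compact_space_prod_topology)
  then have "compactin ?T (topspace ?T)" by (simp add: compactin_subtopology)
  then show "compact_space ?T" by (simp add: compact_space_def)
  show "Hausdorff_space ?T"
    using HY Z(2) by (intro Hausdorff_space_subtopology) (auto simp: Hausdorff_space_prod_topology)
  show "continuum Y" by (rule Y)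
  show "continuous_map ?T Y fst" by (intro continuous_map_from_subtopology continuous_map_fst)
  show "fst ` topspace ?T = topspace Y"
  proof (intro equalityI subsetI)
    fix y assume y: "y \<in> topspace Y"
    then have "f y \<in> topspace X" using f by (auto simp: continuous_map_def)
    then obtain z where "z \<in> topspace Z" "f y = p z" using p(3) by (metis imageE)
    then show "y \<in> fst ` topspace ?T" unfolding ts using y by force
  qed (auto simp: ts)
  show "open_map ?T Y fst"
    unfolding open_map_def
  proof (intro allI impI)
    fix O' assume "openin ?T O'"
    then obtain W where W: "openin ?YZ W" "O' = W \<inter> ?P" by (auto simp: openin_subtopology)
    have "\<exists>V. openin Y V \<and> y \<in> V \<and> V \<subseteq> fst ` O'" if "y \<in> fst ` O'" for y
    proof -
      obtain z where z: "(y, z) \<in> W" "f y = p z" using \<open>y \<in> fst ` O'\<close> W(2) by auto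
      then obtain A B where AB: "openin Y A" "openin Z B" "y \<in> A" "z \<in> B" "A \<times> B \<subseteq> W"
        using W(1) unfolding openin_prod_topology_alt by meson
      have pB: "openin X (p ` B)" using p(2) AB(2) unfolding open_map_def by blast
      define V where "V = A \<inter> {y \<in> topspace Y. f y \<in> p ` B}"
      have "openin Y V" unfolding V_def using AB(1) openin_continuous_map_preimage[OF f pB] by blast
      moreover have "y \<in> V" using AB z openin_subset[OF AB(1)] by (auto simp: V_def)
      moreover have "V \<subseteq> fst ` O'"
      proof
        fix v assume v: "v \<in> V"
        then obtain w where "w \<in> B" "f v = p w" by (auto simp: V_def)
        then have "(v, w) \<in> O'" using v AB(5) W(2) by (auto simp: V_def)
        then show "v \<in> fst ` O'" by force
      qed
      ultimately show ?thesis by blast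
    qed
    then show "openin Y (fst ` O')" by (subst openin_subopen) blast
  qed
  show "locally_injective ?T fst"
    unfolding locally_injective_def
  proof
    fix t assume t: "t \<in> topspace ?T"
    then have "snd t \<in> topspace Z" by auto
    then obtain V where V: "openin Z V" "snd t \<in> V" "inj_on p V"
      using p(4) unfolding locally_injective_def by blast
    have "openin ?T ((topspace Y \<times> V) \<inter> ?P)"
      unfolding openin_subtopology using V(1)
      by (intro exI[of _ "topspace Y \<times> V"] conjI refl) (simp add: openin_prod_Times_iff)
    moreover have "inj_on fst ((topspace Y \<times> V) \<inter> ?P)"
      using V(3) by (auto simp: inj_on_def)
    ultimately show "\<exists>V. openin ?T V \<and> t \<in> V \<and> inj_on fst V" using t V(2) by (intro exI[of _ "topspace Y \<times> V \<inter> ?P"]) auto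
  qed
qed

lemma cover_map_surjective:
  assumes "continuum_cover X C" "continuum_cover X D" "cov_points D \<noteq> {}"
    and "continuous_map (cov_space D) (cov_space C) k"
    and "\<And>y. y \<in> cov_points D \<Longrightarrow> cov_map D y = cov_map C (k y)"
  shows "k ` cov_points D = cov_points C"
  using surjective_lift[OF continuum_coverD(6)[OF assms(2)] continuum_coverD(5)[OF assms(1)]
      continuum_coverD(8)[OF assms(1)] assms(4,5) continuum_coverD(1)[OF assms(2)] assms(3)
      continuum_coverD(2,4)[OF assms(1)]] .

lemma finite_covering_compose:
  assumes X: "continuum X" and C: "continuum_cover X C" and T: "finite_covering T (cov_space C) f"
  shows "finite_covering T X (cov_map C \<circ> f)"
proof -
  interpret finite_covering T "cov_space C" f by (rule T)
  note C = continuum_coverD[OF C]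
  show ?thesis
  proof
    show "compact_space T" "Hausdorff_space T" "continuum X" using compact Haus assms(1) by simp_all
    show "continuous_map T X (cov_map C \<circ> f)" by (rule continuous_map_compose[OF cont C(5)])
    show "open_map T X (cov_map C \<circ> f)" by (rule open_map_compose[OF opn C(6)])
    show "(cov_map C \<circ> f) ` topspace T = topspace X" unfolding image_comp[symmetric] surj by (rule C(7))
    show "locally_injective T (cov_map C \<circ> f)" by (rule locally_injective_compose[OF cont inj C(8)])
  qed
qed

text \<open>This cover makes the index set of the limit nonempty.\<close>

lemma trivial_cover:
  assumes "continuum X"
  shows "continuum_cover X (Covering X (\<lambda>x. x) {\<lambda>x\<in>topspace X. x})"
proof -
  have "free_finite_action X {\<lambda>x\<in>topspace X. x} (\<lambda>x. x) X"
  proof (rule free_finite_action.intro)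
    show "compact_space X" "Hausdorff_space X" "Hausdorff_space X"
      using assms by (auto simp: continuum_def metrizable_imp_Hausdorff_space)
    show "subgroup {\<lambda>x\<in>topspace X. x} (BijGroup (topspace X))"
      by (rule subgroup_BijGroupI) (auto simp: id_Bij compose_def)
    show "homeomorphic_map X X g" if "g \<in> {\<lambda>x\<in>topspace X. x}" for g
      using homeomorphic_map_eq[OF homeomorphic_map_id[THEN iffD2, OF refl], of X g] that by auto
    show "orbit_map (topspace X) {\<lambda>x\<in>topspace X. x} (\<lambda>x. x) (topspace X)"
      by (auto simp: orbit_map_def)
  qed auto
  then show ?thesis
    using assms free_finite_action.regular_covering_map by (fastforce simp: continuum_cover_def)
qed

lemma deck_transformation:
  assumes C: "continuum_cover X C" and g: "g \<in> cov_group C"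
  shows "continuous_map (cov_space C) (cov_space C) g" "\<And>y. y \<in> cov_points C \<Longrightarrow> g y \<in> cov_points C"
    "\<And>y. y \<in> cov_points C \<Longrightarrow> cov_map C (g y) = cov_map C y" "inj_on g (cov_points C)"
    "g ` cov_points C = cov_points C" "g \<in> extensional (cov_points C)"
proof -
  note C = continuum_coverD[OF C]
  show "continuous_map (cov_space C) (cov_space C) g" "inj_on g (cov_points C)" and im: "g ` cov_points C = cov_points C"
    using C(10)[OF g] by (simp_all add: homeomorphic_eq_everything_map)
  show "g \<in> extensional (cov_points C)"
    using subgroup_BijGroup_apply(1)[OF C(9) g] by (simp add: Bij_def)
  show gy: "g y \<in> cov_points C" if "y \<in> cov_points C" for y using im that by blast
  show "cov_map C (g y) = cov_map C y" if "y \<in> cov_points C" for y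
    using C(12)[OF that gy[OF that]] g by auto
qed

section \<open>The compact universal cover\<close>

locale cover_system =
  fixes X :: "'a topology" and x :: 'a and I :: "(real, 'a) covering set" and b :: "(real, 'a) covering \<Rightarrow> real"
  assumes X: "continuum X" and sys: "pointed_cover_system X x I b"
begin

lemma HX: "Hausdorff_space X"
  using X by (simp add: continuum_def metrizable_imp_Hausdorff_space)

lemma cover: "i \<in> I \<Longrightarrow> continuum_cover X i"
  and base: "i \<in> I \<Longrightarrow> b i \<in> cov_points i" "i \<in> I \<Longrightarrow> cov_map i (b i) = x"
  using sys by (auto simp: pointed_cover_system_def)

lemmas cover_facts = cover[THEN continuum_coverD(1)] cover[THEN continuum_coverD(2)]
  cover[THEN continuum_coverD(4)] cover[THEN continuum_coverD(5)]

lemma pro: "i \<in> I \<Longrightarrow> pro_covering (cov_space i) X (cov_map i)"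
  using continuum_cover_pro_covering[OF HX cover] .

lemma dominated:
  assumes "continuum_cover X C"
  obtains i k where "i \<in> I" "continuous_map (cov_space i) (cov_space C) k"
    "\<And>y. y \<in> cov_points i \<Longrightarrow> cov_map C (k y) = cov_map i y"
proof -
  obtain i where i: "i \<in> I" "covering_equiv C i"
    using continuum_cover_representative[OF sys assms] by blast
  obtain h where h: "homeomorphic_map (cov_space C) (cov_space i) h"
    "\<And>y. y \<in> cov_points C \<Longrightarrow> cov_map i (h y) = cov_map C y"
    using i(2) unfolding covering_equiv_def by blast
  obtain k where k: "homeomorphic_maps (cov_space C) (cov_space i) h k"
    using h(1) homeomorphic_map_maps by blast
  have "cov_map C (k y) = cov_map i y" if "y \<in> cov_points i" for y
  proof -
    have "k y \<in> cov_points C" "h (k y) = y" using k that by (auto simp: homeomorphic_maps_def continuous_map_def)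
    then show ?thesis using h(2)[of "k y"] by simp
  qed
  then show thesis using that i(1) k by (auto simp: homeomorphic_maps_def)
qed

lemma I_ne: "I \<noteq> {}"
  using dominated[OF trivial_cover[OF X]] by blast

lemma covering_leI:
  assumes "i \<in> I" "j \<in> I" "continuous_map (cov_space j) (cov_space i) k"
    "\<And>y. y \<in> cov_points j \<Longrightarrow> cov_map i (k y) = cov_map j y"
  shows "covering_le i j"
  unfolding covering_le_def
  using cover_map_surjective[OF cover[OF assms(1)] cover[OF assms(2)] _ assms(3)] assms base(1)[OF assms(2)] by fastforce

text \<open>The condition in the definite description that defines \<^const>\<open>bonding_map\<close>.\<close>

definition bonding_spec :: "(real, 'a) covering \<Rightarrow> (real, 'a) covering \<Rightarrow> (real \<Rightarrow> real) \<Rightarrow> bool" where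
  "bonding_spec i j k \<longleftrightarrow> k \<in> extensional (cov_points j) \<and>
        continuous_map (cov_space j) (cov_space i) k \<and>
        k ` cov_points j = cov_points i \<and>
        (\<forall>y\<in>cov_points j. cov_map j y = cov_map i (k y)) \<and>
        k (b j) = b i"

text \<open>A map over the base becomes basepoint preserving after composition with a deck transformation,
  and two such maps agree by uniqueness of lifts.\<close>

lemma bonding_spec:
  assumes ij: "i \<in> I" "j \<in> I" "covering_le i j"
  shows "bonding_spec i j (bonding_map b i j)"
proof -
  obtain k where k: "continuous_map (cov_space j) (cov_space i) k"
    "\<And>y. y \<in> cov_points j \<Longrightarrow> cov_map j y = cov_map i (k y)"
    using ij(3) unfolding covering_le_def by blast
  have kb: "k (b j) \<in> cov_points i" using k(1) base(1)[OF ij(2)] by (auto simp: continuous_map_def)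
  have "cov_map i (k (b j)) = cov_map i (b i)"
    using k(2)[OF base(1)[OF ij(2)]] base ij by simp
  then obtain g where g: "g \<in> cov_group i" "b i = g (k (b j))"
    using continuum_coverD(12)[OF cover[OF ij(1)] kb base(1)[OF ij(1)]] by blast
  note gg = deck_transformation[OF cover[OF ij(1)] g(1)]
  define k' where "k' = restrict (g \<circ> k) (cov_points j)"
  have "continuous_map (cov_space j) (cov_space i) (g \<circ> k)"
    using continuous_map_compose[OF k(1) gg(1)] .
  then have c: "continuous_map (cov_space j) (cov_space i) k'"
    by (rule continuous_map_eq) (simp add: k'_def)
  have o: "cov_map j y = cov_map i (k' y)" if y: "y \<in> cov_points j" for y
  proof -
    have ky: "k y \<in> cov_points i" using k(1) y by (auto simp: continuous_map_def)
    then show ?thesis using k(2)[OF y] y gg(3)[OF ky] by (simp add: k'_def)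
  qed
  have "bonding_spec i j k'"
    unfolding bonding_spec_def
  proof (intro conjI ballI c o)
    show "k' ` cov_points j = cov_points i"
      using cover_map_surjective[OF cover[OF ij(1)] cover[OF ij(2)] _ c o] base(1)[OF ij(2)] by blast
  qed (use g(2) base(1)[OF ij(2)] in \<open>simp_all add: k'_def\<close>)
  moreover have "l = k'" if l: "bonding_spec i j l" for l
  proof (rule extensionalityI[of _ "cov_points j"])
    show "l \<in> extensional (cov_points j)" using l by (simp add: bonding_spec_def)
    fix y assume y: "y \<in> cov_points j"
    show "l y = k' y"
    proof (rule pro_covering_lift_unique[OF pro[OF ij(1)] cover_facts(2)[OF ij(2)] _ c _ base(1)[OF ij(2)] _ y])
      show "continuous_map (cov_space j) (cov_space i) l" "l (b j) = k' (b j)"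
        using l \<open>bonding_spec i j k'\<close> by (auto simp: bonding_spec_def)
      show "cov_map i (l y) = cov_map i (k' y)" if "y \<in> cov_points j" for y
        using l o that unfolding bonding_spec_def by metis
    qed
  qed (simp add: k'_def)
  ultimately have "bonding_spec i j (THE k. bonding_spec i j k)"
    by (rule theI)
  then show ?thesis unfolding bonding_map_def bonding_spec_def .
qed

abbreviation B where "B \<equiv> bonding_map b"

lemma B:
  assumes ij: "i \<in> I" "j \<in> I" "covering_le i j"
  shows "continuous_map (cov_space j) (cov_space i) (B i j)" "B i j ` cov_points j = cov_points i"
    "\<And>y. y \<in> cov_points j \<Longrightarrow> cov_map i (B i j y) = cov_map j y" "B i j (b j) = b i"
    "\<And>y. y \<in> cov_points j \<Longrightarrow> B i j y \<in> cov_points i"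
  using bonding_spec[OF ij] unfolding bonding_spec_def by (auto dest: continuous_map_image_subset_topspace)

lemma covering_le_refl: "i \<in> I \<Longrightarrow> covering_le i i"
  by (rule covering_leI[of _ _ "\<lambda>y. y"]) auto

lemma covering_le_trans:
  assumes "i \<in> I" "j \<in> I" "k \<in> I" "covering_le i j" "covering_le j k"
  shows "covering_le i k"
  by (rule covering_leI[OF assms(1,3) continuous_map_compose[OF B(1)[OF assms(2,3,5)] B(1)[OF assms(1,2,4)]]])
    (use B[OF assms(2,3,5)] B[OF assms(1,2,4)] in auto)

text \<open>Any two covers are dominated by the Galois closure of their fibre product.\<close>

lemma covering_le_directed:
  assumes ij: "i \<in> I" "j \<in> I"
  shows "\<exists>k\<in>I. covering_le i k \<and> covering_le j k"
proof -
  note ci = continuum_coverD[OF cover[OF ij(1)]] and cj = continuum_coverD[OF cover[OF ij(2)]]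
  have Ci: "continuum (cov_space i)" using cover[OF ij(1)] by (simp add: continuum_cover_def)
  define T where "T = subtopology (prod_topology (cov_space i) (cov_space j)) {(y, z). cov_map i y = cov_map j z}"
  interpret P: finite_covering T "cov_space i" fst
    unfolding T_def by (rule pullback_finite_covering[OF Ci ci(5) HX cj(1,4,5,6,7,8)])
  interpret finite_covering T X "cov_map i \<circ> fst"
    by (rule finite_covering_compose[OF X cover[OF ij(1)] P.finite_covering_axioms])
  have t: "(b i, b j) \<in> topspace T" using base ij by (simp add: T_def)
  obtain C :: "(nat \<Rightarrow> real \<times> real, 'a) covering" and k
    where C: "continuum_cover X C" "continuous_map (cov_space C) T k"
      "\<And>u. u \<in> cov_points C \<Longrightarrow> (cov_map i \<circ> fst) (k u) = cov_map C u"
    using Galois_closure[OF t] by metis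
  obtain m l where m: "m \<in> I" "continuous_map (cov_space m) (cov_space C) l"
    "\<And>y. y \<in> cov_points m \<Longrightarrow> cov_map C (l y) = cov_map m y"
    using dominated[OF C(1)] by blast
  have kl: "continuous_map (cov_space m) T (k \<circ> l)" using continuous_map_compose[OF m(2) C(2)] .
  have Tj: "continuous_map T (cov_space j) snd" unfolding T_def by (intro continuous_map_from_subtopology continuous_map_snd)
  have lC: "l y \<in> cov_points C" if "y \<in> cov_points m" for y using m(2) that by (auto simp: continuous_map_def)
  have i: "cov_map i (fst (k (l y))) = cov_map m y" if "y \<in> cov_points m" for y
    using C(3)[OF lC[OF that]] m(3)[OF that] by simp
  have "cov_map j (snd (k (l y))) = cov_map m y" if y: "y \<in> cov_points m" for y
  proof -
    have "k (l y) \<in> topspace T" using kl y by (auto simp: continuous_map_def)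
    then show ?thesis using i[OF y] by (auto simp: T_def)
  qed
  then have "covering_le j m" using covering_leI[OF ij(2) m(1) continuous_map_compose[OF kl Tj]] by simp
  moreover have "covering_le i m" using covering_leI[OF ij(1) m(1) continuous_map_compose[OF kl P.cont]] i by simp
  ultimately show ?thesis using m(1) by blast
qed

lemma B_functorial:
  assumes "i \<in> I" "j \<in> I" "k \<in> I" "covering_le i j" "covering_le j k" and y: "y \<in> cov_points k"
  shows "B i j (B j k y) = B i k y"
proof -
  have ik: "covering_le i k" using covering_le_trans assms by blast
  note ij = B[OF assms(1,2,4)] and jk = B[OF assms(2,3,5)] and ik = B[OF assms(1,3) ik]
  have "(B i j \<circ> B j k) y = B i k y"
    by (rule pro_covering_lift_unique[OF pro[OF assms(1)] cover_facts(2)[OF assms(3)]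
          continuous_map_compose[OF jk(1) ij(1)] ik(1) _ base(1)[OF assms(3)] _ y])
      (use ij jk ik in auto)
  then show ?thesis by simp
qed

sublocale inverse_system I covering_le cov_space B
proof
  show "covering_le i i" if "i \<in> I" for i using covering_le_refl that .
  show "covering_le i k" if "i \<in> I" "j \<in> I" "k \<in> I" "covering_le i j" "covering_le j k" for i j k
    using covering_le_trans that .
  show "\<exists>k\<in>I. covering_le i k \<and> covering_le j k" if "i \<in> I" "j \<in> I" for i j
    using covering_le_directed that .
  show "I \<noteq> {}" by (rule I_ne)
  show "compact_space (cov_space i)" "Hausdorff_space (cov_space i)" "connected_space (cov_space i)"
    "cov_points i \<noteq> {}" if "i \<in> I" for i
    using cover_facts[OF that] base(1)[OF that] by auto
  show "continuous_map (cov_space j) (cov_space i) (B i j)" "B i j ` cov_points j = cov_points i"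
    if "i \<in> I" "j \<in> I" "covering_le i j" for i j using B[OF that] by auto
  show "B i i y = y" if "i \<in> I" "y \<in> cov_points i" for i y
    using pro_covering_lift_unique[OF pro[OF that(1)] cover_facts(2)[OF that(1)]
        B(1)[OF that(1,1) covering_le_refl[OF that(1)]] continuous_map_id _ base(1)[OF that(1)] _ that(2)]
      B[OF that(1,1) covering_le_refl[OF that(1)]] by simp
  show "B i j (B j k y) = B i k y"
    if "i \<in> I" "j \<in> I" "k \<in> I" "covering_le i j" "covering_le j k" "y \<in> cov_points k" for i j k y
    using B_functorial that .
qed

abbreviation U where "U \<equiv> compact_universal_cover I b"
abbreviation \<Phi> where "\<Phi> \<equiv> compact_universal_covering_map I"

lemma topspace_U: "topspace U = limit"
  unfolding compact_universal_cover_def limit_def by auto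

lemma U_eq: "U = subtopology product limit"
  unfolding compact_universal_cover_def limit_def by (rule arg_cong[of _ _ "subtopology product"]) auto

lemma U: "compact_space U" "Hausdorff_space U" "connected_space U"
proof -
  show "compact_space U"
    unfolding U_eq using limit(1) compact_product by (intro compact_space_subtopology closedin_compact_space)
  show "Hausdorff_space U" unfolding U_eq using Haus_product by (rule Hausdorff_space_subtopology)
  show "connected_space U" unfolding U_eq using limit(2) by (simp add: connectedin_def)
qed

lemma coordinate:
  assumes "i \<in> I"
  shows "continuous_map U (cov_space i) (\<lambda>p. p i)" "\<And>p. p \<in> topspace U \<Longrightarrow> p i \<in> cov_points i"
proof -
  show "continuous_map U (cov_space i) (\<lambda>p. p i)"
    unfolding U_eq using assms by (intro continuous_map_from_subtopology continuous_map_product_projection)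
  then show "p i \<in> cov_points i" if "p \<in> topspace U" for p using that by (auto simp: continuous_map_def)
qed

lemma thread: "p \<in> topspace U \<Longrightarrow> i \<in> I \<Longrightarrow> j \<in> I \<Longrightarrow> covering_le i j \<Longrightarrow> B i j (p j) = p i"
  unfolding topspace_U limit_def by blast

lemma extensional: "p \<in> topspace U \<Longrightarrow> p \<in> extensional I"
  unfolding topspace_U limit_def by (auto simp: PiE_def)

lemma topspace_UI:
  assumes "\<And>i. i \<in> I \<Longrightarrow> p i \<in> cov_points i" "p \<in> extensional I"
    "\<And>i j. i \<in> I \<Longrightarrow> j \<in> I \<Longrightarrow> covering_le i j \<Longrightarrow> B i j (p j) = p i"
  shows "p \<in> topspace U"
  unfolding topspace_U limit_def using assms by (auto simp: PiE_def)

lemma \<Phi>: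
  assumes p: "p \<in> topspace U" and i: "i \<in> I"
  shows "\<Phi> p = cov_map i (p i)"
proof -
  have "cov_map j (p j) = cov_map i (p i)" if j: "j \<in> I" for j
  proof -
    obtain k where k: "k \<in> I" "covering_le i k" "covering_le j k" using covering_le_directed[OF i j] by blast
    have "cov_map i (p i) = cov_map k (p k)" "cov_map j (p j) = cov_map k (p k)"
      using B(3)[OF i k(1,2) coordinate(2)[OF k(1) p]] B(3)[OF j k(1,3) coordinate(2)[OF k(1) p]]
        thread[OF p i k(1,2)] thread[OF p j k(1,3)] by auto
    then show ?thesis by simp
  qed
  then have "\<forall>j\<in>I. cov_map j (p j) = cov_map i (p i)" by blast
  then show ?thesis
    unfolding compact_universal_covering_map_def by (rule the_equality) (metis i)
qed

lemma \<Phi>_onto: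
  assumes "z \<in> topspace X"
  obtains p where "p \<in> topspace U" "\<Phi> p = z"
proof -
  obtain i where i: "i \<in> I" using I_ne by blast
  obtain y where y: "y \<in> cov_points i" "cov_map i y = z"
    using continuum_coverD(7)[OF cover[OF i]] assms by (metis imageE)
  obtain p where "p \<in> limit" "p i = y" by (rule limit_onto[OF i y(1)])
  then have "p \<in> topspace U" "\<Phi> p = z" using \<Phi>[of p i] i y(2) by (simp_all add: topspace_U)
  then show thesis by (rule that)
qed

lemma continuous_\<Phi>: "continuous_map U X \<Phi>"
proof -
  obtain i where i: "i \<in> I" using I_ne by blast
  show ?thesis
    using continuous_map_compose[OF coordinate(1)[OF i] cover_facts(4)[OF i]]
    by (rule continuous_map_eq) (simp add: \<Phi>[OF _ i])
qed

lemma continuous_map_into_U: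
  assumes "\<And>i. i \<in> I \<Longrightarrow> continuous_map S (cov_space i) (u i)"
    and "\<And>i j s. i \<in> I \<Longrightarrow> j \<in> I \<Longrightarrow> covering_le i j \<Longrightarrow> s \<in> topspace S \<Longrightarrow> B i j (u j s) = u i s"
  shows "continuous_map S U (\<lambda>s. \<lambda>i\<in>I. u i s)"
proof -
  have "continuous_map S product (\<lambda>s. \<lambda>i\<in>I. u i s)"
    using assms(1) by (subst continuous_map_componentwise) auto
  moreover have "(\<lambda>i\<in>I. u i s) \<in> topspace U" if "s \<in> topspace S" for s
    using assms that by (intro topspace_UI) (auto simp: continuous_map_def)
  ultimately show ?thesis unfolding U_eq by (auto simp: continuous_map_in_subtopology topspace_U[symmetric])
qed

text \<open>A cover is dominated by some member of the system, and a deck transformation adjusts the value at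
  \<^term>\<open>p0\<close>.\<close>

lemma lift_to_cover:
  assumes C: "continuum_cover X C" and p0: "p0 \<in> topspace U" and c: "c \<in> cov_points C" "cov_map C c = \<Phi> p0"
  shows "\<exists>k. continuous_map U (cov_space C) k \<and> k p0 = c \<and> (\<forall>p\<in>topspace U. cov_map C (k p) = \<Phi> p)"
proof -
  obtain i l where i: "i \<in> I" and l: "continuous_map (cov_space i) (cov_space C) l"
    "\<And>y. y \<in> cov_points i \<Longrightarrow> cov_map C (l y) = cov_map i y"
    using dominated[OF C] by blast
  have lC: "l y \<in> cov_points C" if "y \<in> cov_points i" for y using l(1) that by (auto simp: continuous_map_def)
  have "cov_map C (l (p0 i)) = cov_map C c"
    using l(2) coordinate(2)[OF i p0] \<Phi>[OF p0 i] c(2) by simp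
  then obtain g where g: "g \<in> cov_group C" "c = g (l (p0 i))"
    using continuum_coverD(12)[OF C lC[OF coordinate(2)[OF i p0]] c(1)] by blast
  note gg = deck_transformation[OF C g(1)]
  have "continuous_map U (cov_space C) (g \<circ> (l \<circ> (\<lambda>p. p i)))"
    using continuous_map_compose[OF continuous_map_compose[OF coordinate(1)[OF i] l(1)] gg(1)] .
  moreover have "cov_map C (g (l (p i))) = \<Phi> p" if p: "p \<in> topspace U" for p
  proof -
    have ly: "l (p i) \<in> cov_points C" using lC coordinate(2)[OF i p] by blast
    then show ?thesis using gg(3) l(2)[OF coordinate(2)[OF i p]] \<Phi>[OF p i] by simp
  qed
  ultimately show ?thesis using g(2) by (intro exI[of _ "g \<circ> (l \<circ> (\<lambda>p. p i))"]) auto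
qed

subsection \<open>Deck transformations\<close>

lemmas group_apply = deck_transformation[OF cover]

lemma group_eqI:
  assumes i: "i \<in> I" and g: "g \<in> cov_group i" "h \<in> cov_group i" and y: "y \<in> cov_points i" "g y = h y"
  shows "g = h"
proof (rule extensionalityI[of _ "cov_points i"])
  fix z assume z: "z \<in> cov_points i"
  show "g z = h z"
    by (rule pro_covering_lift_unique[OF pro[OF i] cover_facts(2)[OF i] group_apply(1)[OF i g(1)]
          group_apply(1)[OF i g(2)] _ y z]) (use group_apply[OF i g(1)] group_apply[OF i g(2)] in auto)
qed (use group_apply(6)[OF i] g in auto)

lemma bonding_hom:
  assumes ij: "i \<in> I" "j \<in> I" "covering_le i j" and g: "g \<in> cov_group j"
  shows "bonding_hom b i j g \<in> cov_group i"
    "\<And>y. y \<in> cov_points j \<Longrightarrow> bonding_hom b i j g (B i j y) = B i j (g y)"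
proof -
  note Bij = B[OF ij]
  have bj: "b j \<in> cov_points j" "g (b j) \<in> cov_points j" using base(1) ij(2) group_apply(2)[OF ij(2) g] by auto
  have "cov_map i (B i j (b j)) = cov_map i (B i j (g (b j)))"
    using Bij(3) bj group_apply(3)[OF ij(2) g] by simp
  then obtain g' where g': "g' \<in> cov_group i" "B i j (g (b j)) = g' (B i j (b j))"
    using continuum_coverD(12)[OF cover[OF ij(1)] Bij(5)[OF bj(1)] Bij(5)[OF bj(2)]] by blast
  have g'B: "g' (B i j y) = B i j (g y)" if y: "y \<in> cov_points j" for y
  proof -
    have "(g' \<circ> B i j) y = (B i j \<circ> g) y"
      by (rule pro_covering_lift_unique[OF pro[OF ij(1)] cover_facts(2)[OF ij(2)]
            continuous_map_compose[OF Bij(1) group_apply(1)[OF ij(1) g'(1)]]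
            continuous_map_compose[OF group_apply(1)[OF ij(2) g] Bij(1)] _ bj(1) _ y])
        (use Bij group_apply[OF ij(1) g'(1)] group_apply[OF ij(2) g] g'(2) in auto)
    then show ?thesis by simp
  qed
  have "bonding_hom b i j g = g'"
    unfolding bonding_hom_def
  proof (rule the_equality)
    show "g' \<in> cov_group i \<and> (\<forall>y\<in>cov_points j. g' (B i j y) = B i j (g y))" using g'(1) g'B by blast
    fix h assume h: "h \<in> cov_group i \<and> (\<forall>y\<in>cov_points j. h (B i j y) = B i j (g y))"
    then show "h = g'" using group_eqI[OF ij(1) _ g'(1) Bij(5)[OF bj(1)]] g'(2) bj(1) by simp
  qed
  then show "bonding_hom b i j g \<in> cov_group i"
    "\<And>y. y \<in> cov_points j \<Longrightarrow> bonding_hom b i j g (B i j y) = B i j (g y)" using g'(1) g'B by auto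
qed

lemma coordinatewise:
  assumes \<gamma>: "\<gamma> \<in> profinite_group I b"
  shows "homeomorphic_map U U (coordinatewise I \<gamma>)"
    "\<And>p. p \<in> topspace U \<Longrightarrow> \<Phi> (coordinatewise I \<gamma> p) = \<Phi> p"
proof -
  have \<gamma>i: "\<gamma> i \<in> cov_group i" if "i \<in> I" for i using \<gamma> that by (auto simp: profinite_group_def)
  have \<gamma>B: "\<gamma> i (B i j y) = B i j (\<gamma> j y)" if "i \<in> I" "j \<in> I" "covering_le i j" "y \<in> cov_points j" for i j y
    using bonding_hom(2)[OF that(1-3) \<gamma>i[OF that(2)] that(4)] \<gamma> that by (auto simp: profinite_group_def)
  have cont: "continuous_map U U (coordinatewise I \<gamma>)"
    unfolding coordinatewise_def
  proof (rule continuous_map_into_U)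
    show "continuous_map U (cov_space i) (\<lambda>p. \<gamma> i (p i))" if "i \<in> I" for i
      using continuous_map_compose[OF coordinate(1)[OF that] group_apply(1)[OF that \<gamma>i[OF that]]] by (simp add: comp_def)
    show "B i j (\<gamma> j (p j)) = \<gamma> i (p i)" if "i \<in> I" "j \<in> I" "covering_le i j" "p \<in> topspace U" for i j p
      using \<gamma>B[OF that(1-3) coordinate(2)[OF that(2,4)]] thread[OF that(4,1-3)] by simp
  qed
  then have in_U: "coordinatewise I \<gamma> p \<in> topspace U" if "p \<in> topspace U" for p
    using that by (auto simp: continuous_map_def)
  show "\<Phi> (coordinatewise I \<gamma> p) = \<Phi> p" if p: "p \<in> topspace U" for p
  proof -
    obtain i where i: "i \<in> I" using I_ne by blast
    show ?thesis
      using \<Phi>[OF in_U[OF p] i] \<Phi>[OF p i] group_apply(3)[OF i \<gamma>i[OF i] coordinate(2)[OF i p]] i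
      by (simp add: coordinatewise_def)
  qed
  have "inj_on (coordinatewise I \<gamma>) (topspace U)"
  proof (rule inj_onI)
    fix p q assume pq: "p \<in> topspace U" "q \<in> topspace U" "coordinatewise I \<gamma> p = coordinatewise I \<gamma> q"
    show "p = q"
    proof (rule extensionalityI[OF extensional[OF pq(1)] extensional[OF pq(2)]])
      fix i assume i: "i \<in> I"
      have "\<gamma> i (p i) = \<gamma> i (q i)" using fun_cong[OF pq(3), of i] i by (simp add: coordinatewise_def)
      then show "p i = q i"
        using group_apply(4)[OF i \<gamma>i[OF i]] coordinate(2)[OF i] pq(1,2) by (auto dest: inj_onD)
    qed
  qed
  moreover have "coordinatewise I \<gamma> ` topspace U = topspace U"
  proof (intro equalityI subsetI)
    fix p assume p: "p \<in> topspace U"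
    \<comment> \<open>the inverse transformations applied to a thread give a thread since each \<open>\<gamma> i\<close> is injective\<close>
    have "\<forall>i\<in>I. \<exists>y. y \<in> cov_points i \<and> \<gamma> i y = p i"
      using group_apply(5)[OF _ \<gamma>i] coordinate(2)[OF _ p] by (metis imageE)
    then obtain q where q: "\<And>i. i \<in> I \<Longrightarrow> q i \<in> cov_points i \<and> \<gamma> i (q i) = p i" by metis
    have "restrict q I \<in> topspace U"
    proof (rule topspace_UI)
      fix i j assume ij: "i \<in> I" "j \<in> I" "covering_le i j"
      have "\<gamma> i (B i j (q j)) = \<gamma> i (q i)" using \<gamma>B[OF ij] q ij thread[OF p ij] by simp
      then have "B i j (q j) = q i"
        by (rule inj_onD[OF group_apply(4)[OF ij(1) \<gamma>i[OF ij(1)]]]) (use B(5)[OF ij] q ij in auto)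
      then show "B i j (restrict q I j) = restrict q I i" using ij by simp
    qed (use q in auto)
    moreover have "coordinatewise I \<gamma> (restrict q I) = p"
      using q extensional[OF p] by (auto simp: coordinatewise_def extensional_def fun_eq_iff)
    ultimately show "p \<in> coordinatewise I \<gamma> ` topspace U" by (metis imageI)
  qed (use in_U in auto)
  ultimately show "homeomorphic_map U U (coordinatewise I \<gamma>)"
    using continuous_imp_homeomorphic_map[OF cont U(1,2)] by blast
qed

text \<open>On each level an endomorphism over the base agrees with a deck transformation at one point,
  hence everywhere by uniqueness of lifts.\<close>

lemma endomorphism_coordinatewise:
  assumes k: "continuous_map U U k" and over: "\<And>p. p \<in> topspace U \<Longrightarrow> \<Phi> (k p) = \<Phi> p"
  obtains \<gamma> where "\<gamma> \<in> profinite_group I b" "\<And>p. p \<in> topspace U \<Longrightarrow> k p = coordinatewise I \<gamma> p"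
proof -
  have kU: "k p \<in> topspace U" if "p \<in> topspace U" for p using k that by (auto simp: continuous_map_def)
  obtain p0 where p0: "p0 \<in> topspace U"
  proof (rule \<Phi>_onto)
    show "x \<in> topspace X" using sys by (simp add: pointed_cover_system_def)
  qed
  have "\<exists>g\<in>cov_group i. \<forall>p\<in>topspace U. k p i = g (p i)" if i: "i \<in> I" for i
  proof -
    have pts: "p0 i \<in> cov_points i" "k p0 i \<in> cov_points i" using coordinate(2)[OF i] p0 kU by auto
    have "cov_map i (p0 i) = cov_map i (k p0 i)" using over[OF p0] \<Phi>[OF _ i] p0 kU by simp
    then obtain g where g: "g \<in> cov_group i" "k p0 i = g (p0 i)"
      using continuum_coverD(12)[OF cover[OF i] pts] by blast
    have "((\<lambda>p. p i) \<circ> k) p = (g \<circ> (\<lambda>p. p i)) p" if p: "p \<in> topspace U" for p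
    proof (rule pro_covering_lift_unique[OF pro[OF i] U(3) continuous_map_compose[OF k coordinate(1)[OF i]]
          continuous_map_compose[OF coordinate(1)[OF i] group_apply(1)[OF i g(1)]] _ p0 _ p])
      show "cov_map i (((\<lambda>p. p i) \<circ> k) p) = cov_map i ((g \<circ> (\<lambda>p. p i)) p)" if p: "p \<in> topspace U" for p
        using over[OF p] \<Phi>[OF p i] \<Phi>[OF kU[OF p] i] group_apply(3)[OF i g(1) coordinate(2)[OF i p]] by simp
    qed (use g(2) in simp)
    then show ?thesis using g(1) by auto
  qed
  then obtain g where g: "\<And>i. i \<in> I \<Longrightarrow> g i \<in> cov_group i" "\<And>i p. i \<in> I \<Longrightarrow> p \<in> topspace U \<Longrightarrow> k p i = g i (p i)"
    by metis
  have "bonding_hom b i j (g j) = g i" if ij: "i \<in> I" "j \<in> I" "covering_le i j" for i j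
  proof (rule group_eqI[OF ij(1) bonding_hom(1)[OF ij g(1)[OF ij(2)]] g(1)[OF ij(1)] coordinate(2)[OF ij(1) p0]])
    have "bonding_hom b i j (g j) (p0 i) = B i j (g j (p0 j))"
      using bonding_hom(2)[OF ij g(1)[OF ij(2)] coordinate(2)[OF ij(2) p0]] thread[OF p0 ij] by simp
    also have "\<dots> = k p0 i" using g(2)[OF ij(2) p0] thread[OF kU[OF p0] ij] by simp
    finally show "bonding_hom b i j (g j) (p0 i) = g i (p0 i)" using g(2)[OF ij(1) p0] by simp
  qed
  then have "restrict g I \<in> profinite_group I b" using g(1) by (auto simp: profinite_group_def)
  moreover have "k p = coordinatewise I (restrict g I) p" if p: "p \<in> topspace U" for p
    using g(2)[OF _ p] extensional[OF kU[OF p]] by (auto simp: coordinatewise_def extensional_def fun_eq_iff)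
  ultimately show thesis using that by blast
qed

end

section \<open>Comparison of the two compact universal covers\<close>

text \<open>The pullback of \<^term>\<open>C\<close> along \<^term>\<open>f\<close> is a finite covering of \<^term>\<open>X\<close>; its Galois closure is a
  cover of \<^term>\<open>X\<close> that maps to \<^term>\<open>C\<close>, and the compact universal cover lifts to it.\<close>

lemma (in cover_system) lift_to_cover_of_base:
  fixes C :: "('c, 'z) covering"
  assumes Z: "Hausdorff_space Z" and f: "continuous_map X Z f" and C: "continuum_cover Z C"
    and q0: "q0 \<in> topspace U" and c: "c \<in> cov_points C" "cov_map C c = f (\<Phi> q0)"
  obtains h where "continuous_map U (cov_space C) h" "h q0 = c"
    "\<And>q. q \<in> topspace U \<Longrightarrow> cov_map C (h q) = f (\<Phi> q)"
proof -
  note CC = continuum_coverD[OF C]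
  define T where "T = subtopology (prod_topology X (cov_space C)) {(y, z). f y = cov_map C z}"
  interpret T: finite_covering T X fst
    unfolding T_def by (rule pullback_finite_covering[OF X f Z CC(1,4,5,6,7,8)])
  have "\<Phi> q0 \<in> topspace X" using continuous_\<Phi> q0 by (auto simp: continuous_map_def)
  then have t: "(\<Phi> q0, c) \<in> topspace T" using c by (simp add: T_def)
  obtain D d k where D: "continuum_cover X (D :: (nat \<Rightarrow> 'a \<times> 'c, 'a) covering)" "d \<in> cov_points D"
    "continuous_map (cov_space D) T k"
    and kD: "\<And>u. u \<in> cov_points D \<Longrightarrow> fst (k u) = cov_map D u" "k d = (\<Phi> q0, c)"
    using T.Galois_closure[OF t] by metis
  have "cov_map D d = \<Phi> q0" using kD(1)[OF D(2)] kD(2) by simp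
  then obtain l where l: "continuous_map U (cov_space D) l" "l q0 = d"
    "\<And>q. q \<in> topspace U \<Longrightarrow> cov_map D (l q) = \<Phi> q"
    using lift_to_cover[OF D(1) q0 D(2)] by blast
  have kl: "continuous_map U T (k \<circ> l)" by (rule continuous_map_compose[OF l(1) D(3)])
  have sndT: "continuous_map T (cov_space C) snd"
    unfolding T_def by (intro continuous_map_from_subtopology continuous_map_snd)
  have over: "cov_map C ((snd \<circ> (k \<circ> l)) q) = f (\<Phi> q)" if q: "q \<in> topspace U" for q
  proof -
    have lq: "l q \<in> cov_points D" using l(1) q by (auto simp: continuous_map_def)
    have "k (l q) \<in> topspace T" using kl q by (auto simp: continuous_map_def)
    then have "f (fst (k (l q))) = cov_map C (snd (k (l q)))" by (auto simp: T_def)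
    then show ?thesis using kD(1)[OF lq] l(3)[OF q] by simp
  qed
  show thesis
    by (rule that[OF continuous_map_compose[OF kl sndT] _ over]) (simp_all add: l(2) kD(2))
qed

theorem corollary6:
  fixes X :: "'a topology" and Y :: "'b topology"
    and \<E> :: "('b \<times> 'b) set set" and \<F> :: "('a \<times> 'a) set set"
    and G :: "('b \<Rightarrow> 'b) set" and f :: "'b \<Rightarrow> 'a"
    and x :: 'a and y :: 'b
    and I :: "(real, 'a) covering set" and b :: "(real, 'a) covering \<Rightarrow> real"
    and J :: "(real, 'b) covering set" and c :: "(real, 'b) covering \<Rightarrow> real"
  assumes "continuum X" and "continuum Y"
    and "generalized_regular_covering_map Y \<E> G f X \<F>"
    and "pointed_cover_system X x I b"
    and "pointed_cover_system Y y J c"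
  shows "\<exists>h. h \<in> homeomorphisms_over
               (compact_universal_cover I b) (compact_universal_covering_map I)
               (compact_universal_cover J c) (f \<circ> compact_universal_covering_map J) \<and>
             homeomorphisms_over
               (compact_universal_cover I b) (compact_universal_covering_map I)
               (compact_universal_cover J c) (f \<circ> compact_universal_covering_map J) =
             {compose (topspace (compact_universal_cover I b)) h (coordinatewise I \<gamma>) | \<gamma>.
                \<gamma> \<in> profinite_group I b}"
proof -
  interpret XS: cover_system X x I b using assms(1,4) by (rule cover_system.intro)
  interpret YS: cover_system Y y J c using assms(2,5) by (rule cover_system.intro)
  let ?X = "compact_universal_cover I b" and ?Y = "compact_universal_cover J c"
  let ?\<phi> = "compact_universal_covering_map I" and ?\<psi> = "compact_universal_covering_map J"
  have pcY: "pro_covering Y X f"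
    using generalized_regular_covering_map_pro_covering[OF assms(3) _ YS.HX XS.HX] assms(2)
    by (simp add: continuum_def)
  then have f: "continuous_map Y X f" by (simp add: pro_covering_def)
  have pc: "pro_covering (cov_space j) X (f \<circ> cov_map j)" if "j \<in> J" for j
  proof -
    note C = continuum_coverD[OF YS.cover[OF that]]
    show ?thesis by (rule pro_covering_compose[OF pcY C(1,3,5,6,7,8)])
  qed
  \<comment> \<open>the point \<open>y\<close> may lie over a point other than \<open>x\<close>, so the lifts start at a pair of points \<open>q0\<close>
    and \<open>p0\<close> over the same point of \<open>X\<close>\<close>
  have "y \<in> topspace Y" using assms(5) by (simp add: pointed_cover_system_def)
  then obtain q0 where q0: "q0 \<in> topspace ?Y" by (metis YS.\<Phi>_onto)
  have "?\<psi> q0 \<in> topspace Y" using YS.continuous_\<Phi> q0 by (auto simp: continuous_map_def)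
  then have "f (?\<psi> q0) \<in> topspace X" using f by (auto simp: continuous_map_def)
  then obtain p0 where p0: "p0 \<in> topspace ?X" "?\<phi> p0 = f (?\<psi> q0)" by (metis XS.\<Phi>_onto)

  have "\<exists>h. continuous_map ?X (cov_space j) h \<and> h p0 = q0 j \<and> (\<forall>p\<in>topspace ?X. f (cov_map j (h p)) = ?\<phi> p)"
    if j: "j \<in> J" for j
  proof -
    have "(f \<circ> cov_map j) (q0 j) = ?\<phi> p0" using YS.\<Phi>[OF q0 j] p0(2) by simp
    then obtain h where "continuous_map ?X (cov_space j) h" "h p0 = q0 j"
      "\<And>p. p \<in> topspace ?X \<Longrightarrow> (f \<circ> cov_map j) (h p) = ?\<phi> p"
      using lift_to_pro_covering[OF assms(1) XS.U(3) p0(1) XS.lift_to_cover[OF _ p0(1)] pc[OF j]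
          YS.coordinate(2)[OF j q0]] by blast
    then show ?thesis by auto
  qed
  then obtain a where a: "\<And>j. j \<in> J \<Longrightarrow> continuous_map ?X (cov_space j) (a j)"
    "\<And>j. j \<in> J \<Longrightarrow> a j p0 = q0 j"
    "\<And>j p. j \<in> J \<Longrightarrow> p \<in> topspace ?X \<Longrightarrow> f (cov_map j (a j p)) = ?\<phi> p"
    by metis
  have a_in: "a j p \<in> cov_points j" if "j \<in> J" "p \<in> topspace ?X" for j p
    using a(1)[OF that(1)] that(2) by (auto simp: continuous_map_def)
  define \<alpha> where "\<alpha> = (\<lambda>p. \<lambda>j\<in>J. a j p)"
  have \<alpha>: "continuous_map ?X ?Y \<alpha>"
    unfolding \<alpha>_def
  proof (rule YS.continuous_map_into_U[OF a(1)])
    fix i j p assume ij: "i \<in> J" "j \<in> J" "covering_le i j" and p: "p \<in> topspace ?X"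
    note Bij = YS.B[OF ij]
    have "(bonding_map c i j \<circ> a j) p = a i p"
    proof (rule pro_covering_lift_unique[OF pc[OF ij(1)] XS.U(3)
          continuous_map_compose[OF a(1)[OF ij(2)] Bij(1)] a(1)[OF ij(1)] _ p0(1) _ p])
      show "(f \<circ> cov_map i) ((bonding_map c i j \<circ> a j) p) = (f \<circ> cov_map i) (a i p)"
        if "p \<in> topspace ?X" for p
        using a(3)[OF ij(1) that] a(3)[OF ij(2) that] Bij(3)[OF a_in[OF ij(2) that]] by simp
      show "(bonding_map c i j \<circ> a j) p0 = a i p0"
        using a(2)[OF ij(1)] a(2)[OF ij(2)] YS.thread[OF q0 ij] by simp
    qed
    then show "bonding_map c i j (a j p) = a i p" by simp
  qed
  have \<alpha>_in: "\<alpha> p \<in> topspace ?Y" if "p \<in> topspace ?X" for p using \<alpha> that by (auto simp: continuous_map_def)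
  have \<alpha>0: "\<alpha> p0 = q0" using a(2) YS.extensional[OF q0] by (auto simp: \<alpha>_def extensional_def fun_eq_iff)
  obtain j0 where j0: "j0 \<in> J" using YS.I_ne by blast
  have \<alpha>_over: "f (?\<psi> (\<alpha> p)) = ?\<phi> p" if p: "p \<in> topspace ?X" for p
    using YS.\<Phi>[OF \<alpha>_in[OF p] j0] a(3)[OF j0 p] j0 by (simp add: \<alpha>_def)

  have "\<exists>h. continuous_map ?Y (cov_space i) h \<and> h q0 = p0 i \<and> (\<forall>q\<in>topspace ?Y. cov_map i (h q) = f (?\<psi> q))"
    if i: "i \<in> I" for i
  proof -
    have "cov_map i (p0 i) = f (?\<psi> q0)" using XS.\<Phi>[OF p0(1) i] p0(2) by simp
    then obtain h where "continuous_map ?Y (cov_space i) h" "h q0 = p0 i"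
      "\<And>q. q \<in> topspace ?Y \<Longrightarrow> cov_map i (h q) = f (?\<psi> q)"
      using YS.lift_to_cover_of_base[OF XS.HX f XS.cover[OF i] q0 XS.coordinate(2)[OF i p0(1)]] by blast
    then show ?thesis by blast
  qed
  then obtain d where d: "\<And>i. i \<in> I \<Longrightarrow> continuous_map ?Y (cov_space i) (d i)"
    "\<And>i. i \<in> I \<Longrightarrow> d i q0 = p0 i"
    "\<And>i q. i \<in> I \<Longrightarrow> q \<in> topspace ?Y \<Longrightarrow> cov_map i (d i q) = f (?\<psi> q)"
    by metis
  have d_in: "d i q \<in> cov_points i" if "i \<in> I" "q \<in> topspace ?Y" for i q
    using d(1)[OF that(1)] that(2) by (auto simp: continuous_map_def)
  define \<beta> where "\<beta> = (\<lambda>q. \<lambda>i\<in>I. d i q)"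
  have \<beta>: "continuous_map ?Y ?X \<beta>"
    unfolding \<beta>_def
  proof (rule XS.continuous_map_into_U[OF d(1)])
    fix i j q assume ij: "i \<in> I" "j \<in> I" "covering_le i j" and q: "q \<in> topspace ?Y"
    note Bij = XS.B[OF ij]
    have "(bonding_map b i j \<circ> d j) q = d i q"
    proof (rule pro_covering_lift_unique[OF XS.pro[OF ij(1)] YS.U(3)
          continuous_map_compose[OF d(1)[OF ij(2)] Bij(1)] d(1)[OF ij(1)] _ q0 _ q])
      show "cov_map i ((bonding_map b i j \<circ> d j) q) = cov_map i (d i q)" if "q \<in> topspace ?Y" for q
        using d(3)[OF ij(1) that] d(3)[OF ij(2) that] Bij(3)[OF d_in[OF ij(2) that]] by simp
      show "(bonding_map b i j \<circ> d j) q0 = d i q0"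
        using d(2)[OF ij(1)] d(2)[OF ij(2)] XS.thread[OF p0(1) ij] by simp
    qed
    then show "bonding_map b i j (d j q) = d i q" by simp
  qed
  have \<beta>_in: "\<beta> q \<in> topspace ?X" if "q \<in> topspace ?Y" for q using \<beta> that by (auto simp: continuous_map_def)
  have \<beta>0: "\<beta> q0 = p0" using d(2) XS.extensional[OF p0(1)] by (auto simp: \<beta>_def extensional_def fun_eq_iff)

  have \<beta>\<alpha>: "\<beta> (\<alpha> p) = p" if p: "p \<in> topspace ?X" for p
  proof (rule extensionalityI[OF XS.extensional[OF \<beta>_in[OF \<alpha>_in[OF p]]] XS.extensional[OF p]])
    fix i assume i: "i \<in> I"
    have "(d i \<circ> \<alpha>) p = p i"
    proof (rule pro_covering_lift_unique[OF XS.pro[OF i] XS.U(3) continuous_map_compose[OF \<alpha> d(1)[OF i]]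
          XS.coordinate(1)[OF i] _ p0(1) _ p])
      show "cov_map i ((d i \<circ> \<alpha>) p) = cov_map i (p i)" if "p \<in> topspace ?X" for p
        using d(3)[OF i \<alpha>_in[OF that]] \<alpha>_over[OF that] XS.\<Phi>[OF that i] by simp
    qed (simp add: \<alpha>0 d(2)[OF i])
    then show "\<beta> (\<alpha> p) i = p i" using i by (simp add: \<beta>_def)
  qed
  have \<beta>_over: "?\<phi> (\<beta> q) = f (?\<psi> q)" if q: "q \<in> topspace ?Y" for q
  proof -
    obtain i where i: "i \<in> I" using XS.I_ne by blast
    show ?thesis using XS.\<Phi>[OF \<beta>_in[OF q] i] d(3)[OF i q] i by (simp add: \<beta>_def)
  qed
  have \<alpha>\<beta>: "\<alpha> (\<beta> q) = q" if q: "q \<in> topspace ?Y" for q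
  proof (rule extensionalityI[OF YS.extensional[OF \<alpha>_in[OF \<beta>_in[OF q]]] YS.extensional[OF q]])
    fix j assume j: "j \<in> J"
    have "(a j \<circ> \<beta>) q = q j"
    proof (rule pro_covering_lift_unique[OF pc[OF j] YS.U(3) continuous_map_compose[OF \<beta> a(1)[OF j]]
          YS.coordinate(1)[OF j] _ q0 _ q])
      show "(f \<circ> cov_map j) ((a j \<circ> \<beta>) q) = (f \<circ> cov_map j) (q j)" if "q \<in> topspace ?Y" for q
        using a(3)[OF j \<beta>_in[OF that]] \<beta>_over[OF that] YS.\<Phi>[OF that j] by simp
    qed (simp add: \<beta>0 a(2)[OF j])
    then show "\<alpha> (\<beta> q) j = q j" using j by (simp add: \<alpha>_def)
  qed
  have "homeomorphic_maps ?X ?Y \<alpha> \<beta>"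
    unfolding homeomorphic_maps_def using \<alpha> \<beta> \<beta>\<alpha> \<alpha>\<beta> by blast
  then have "homeomorphic_map ?X ?Y \<alpha>" using homeomorphic_map_maps by blast
  define h where "h = restrict \<alpha> (topspace ?X)"
  have h: "homeomorphic_map ?X ?Y h"
    using \<open>homeomorphic_map ?X ?Y \<alpha>\<close> by (rule homeomorphic_map_eq) (simp add: h_def)
  let ?H = "homeomorphisms_over ?X ?\<phi> ?Y (f \<circ> ?\<psi>)"
  have hH: "h \<in> ?H"
    using h \<alpha>_over by (simp add: homeomorphisms_over_def h_def)
  moreover have "?H = {compose (topspace ?X) h (coordinatewise I \<gamma>) | \<gamma>. \<gamma> \<in> profinite_group I b}"
  proof (intro equalityI subsetI)
    fix h' assume "h' \<in> ?H"
    then have h': "h' \<in> extensional (topspace ?X)" "homeomorphic_map ?X ?Y h'"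
      "\<And>p. p \<in> topspace ?X \<Longrightarrow> f (?\<psi> (h' p)) = ?\<phi> p"
      by (auto simp: homeomorphisms_over_def)
    have h'_in: "h' p \<in> topspace ?Y" if "p \<in> topspace ?X" for p
      using homeomorphic_imp_surjective_map[OF h'(2)] that by blast
    have "continuous_map ?X ?X (\<beta> \<circ> h')"
      using continuous_map_compose[OF homeomorphic_imp_continuous_map[OF h'(2)] \<beta>] .
    then obtain \<gamma> where \<gamma>: "\<gamma> \<in> profinite_group I b"
      "\<And>p. p \<in> topspace ?X \<Longrightarrow> (\<beta> \<circ> h') p = coordinatewise I \<gamma> p"
    proof (rule XS.endomorphism_coordinatewise)
      show "?\<phi> ((\<beta> \<circ> h') p) = ?\<phi> p" if "p \<in> topspace ?X" for p
        using \<beta>_over[OF h'_in[OF that]] h'(3)[OF that] by simp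
    qed blast
    have "h' = compose (topspace ?X) h (coordinatewise I \<gamma>)"
    proof (rule extensionalityI[OF h'(1) compose_extensional])
      fix p assume p: "p \<in> topspace ?X"
      have "coordinatewise I \<gamma> p = \<beta> (h' p)" using \<gamma>(2)[OF p] by simp
      then show "h' p = compose (topspace ?X) h (coordinatewise I \<gamma>) p"
        using p \<alpha>\<beta>[OF h'_in[OF p]] \<beta>_in[OF h'_in[OF p]] by (simp add: compose_def h_def)
    qed
    then show "h' \<in> {compose (topspace ?X) h (coordinatewise I \<gamma>) | \<gamma>. \<gamma> \<in> profinite_group I b}"
      using \<gamma>(1) by blast
  next
    fix h' assume "h' \<in> {compose (topspace ?X) h (coordinatewise I \<gamma>) | \<gamma>. \<gamma> \<in> profinite_group I b}"
    then obtain \<gamma> where \<gamma>: "\<gamma> \<in> profinite_group I b" "h' = compose (topspace ?X) h (coordinatewise I \<gamma>)"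
      by blast
    note cw = XS.coordinatewise[OF \<gamma>(1)]
    have cw_in: "coordinatewise I \<gamma> p \<in> topspace ?X" if "p \<in> topspace ?X" for p
      using homeomorphic_imp_surjective_map[OF cw(1)] that by blast
    have "homeomorphic_map ?X ?Y (h \<circ> coordinatewise I \<gamma>)"
      by (rule homeomorphic_map_compose[OF cw(1) h])
    then have "homeomorphic_map ?X ?Y h'"
      by (rule homeomorphic_map_eq) (simp add: \<gamma>(2) compose_def)
    moreover have "?\<phi> p = (f \<circ> ?\<psi>) (h' p)" if p: "p \<in> topspace ?X" for p
      using \<alpha>_over[OF cw_in[OF p]] cw(2)[OF p] cw_in[OF p] p by (simp add: \<gamma>(2) compose_def h_def)
    ultimately show "h' \<in> ?H" by (simp add: homeomorphisms_over_def \<gamma>(2))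
  qed
  ultimately show ?thesis by blast
qed

end
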